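(* Let $M$ be a Finsler manifold, let $\phi$ be its $k$-dimensional Holmes-Thompson density, with unit bundle $S_\phi TM$, and let $\sigma:M\to S_\phi TM$ be a local section. Let $\Theta_k\in\Omega^k(S_\phi TM)$ be the Hilbert form for $\phi$ defined by the Busemann forms, let $\omega_1\in\Omega^1(STM)$ be the Hilbert form of the norm, and let $\pi_\sigma:U_\sigma\to M$ be the bundle of unit vectors contained in the $k$-planes $\langle\sigma(x)\rangle$. Then $\Theta_k$ and $\omega_1$ are related by $$\sigma^*\Theta_k=\frac{(-1)^{\frac{k(k+1)}{2}}}{k!\,\epsilon_k}\,\pi_{\sigma*}\big(\omega_1\wedge(d\omega_1)^{k-1}\big).$$
   Context: Minkowski space: a finite-dimensional real normed space $(V,\|\cdot\|)$ whose unit sphere is smooth and has all principal curvatures strictly positive for any auxiliary Euclidean metric. $B^*$ and $S^*=\partial B^*$ denote the dual unit ball and sphere in $V^*$. A Finsler manifold carries a function on $TM$, smooth off the zero section, restricting to a norm on each $T_xM$ that makes it a Minkowski space. $STM\subset TM$ is the bundle of unit vectors. $\Lambda^k_sV\subset\Lambda^kV$ is the cone of simple $k$-vectors; $0\ne a=v_1\wedge\dots\wedge v_k$ determines the oriented $k$-plane $\langle a\rangle=\mathrm{span}\{v_1,\dots,v_k\}$, with oriented dual $\langle a\rangle^*$. $P_a:V^*\to\langle a\rangle^*$ is the projection dual to the inclusion $\langle a\rangle\hookrightarrow V$. Elements of $\Lambda^kV$ are viewed as constant-coefficient $k$-forms on $V^*$. Holmes-Thompson density: $\phi(a)=\frac1{\epsilon_k}\int_{P_a(B^*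 )}a$, with $\epsilon_k$ the Euclidean volume of the Euclidean unit $k$-ball; on a Finsler manifold it is defined in this way on each $T_xM$. Its unit bundle is $S_\phi TM=\{(x,a): a\in\Lambda^k_sT_xM,\ \phi(x,a)=1\}$, with projection $\pi$ to $M$. Busemann form: let $\Sigma_a\subset S^*$ be the set of singular points of the restriction $P_a:S^*\to\langle a\rangle^*$; $P_a:\Sigma_a\to\partial P_a(B^* )$ is a diffeomorphism, through which $\Sigma_a$ is oriented as the boundary of $P_a(B^* )$ (so that $\beta_a(a)=\phi(a)$). Then $\beta_a\in\Lambda^kV^*$ is $\beta_a(b)=\frac1{k\epsilon_k}\int_{\Sigma_a}i_\chi b$ for $b\in\Lambda^kV$, where $i_\chi b$ is the contraction of $b$ with the Euler vector field $\chi(p)=p$ on $V^*$. Hilbert forms: $(\Theta_k)_{(x,a)}=\beta_a\circ D\pi$ for $(x,a)\in S_\phi TM$ ($\beta_a$ computed in $T_xM$); $(\omega_1)_{(x,v)}=\mathcal L^1_x(v)\circ D\pi$ for $(x,v)\in STM$ (here $\pi:STM\to M$), where $\mathcal L^1_x(v)=\frac12 d(\|\cdot\|_x^2)_v\in T_x^*M$. $U_\sigma=\{(x,v)\in STM: v\in\langle\sigma(x)\rangle\}$, and $\pi_\sigma:U_\sigma\to M$ is its projection; in the formula $\omega_1$ is restricted to $U_\sigma$. The fibre $\pi_\sigma^{-1}(x)$ is the $(k-1)$-dimensional unit sphere of $\langle\sigma(x)\rangle$; since $\langle\sigma(x)\rangle$ is oriented, so is the fibre. $\pi_{\sigma*}$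 is the push-forward (integration along the fibre): $(\pi_{\sigma*}\eta)_x(b)=\int_{\pi_\sigma^{-1}(x)}i_{\tilde b}\eta$, where $b\in\Lambda^k T_xM$ and $\tilde b$ is a lift of $b$ to $U_\sigma$. *)

theory Defs
  imports "HOL-Analysis.Analysis" "HOL-Combinatorics.Permutations"
begin

section \<open>Alternating algebra\<close>

text \<open>
  The dual space of \<open>'e\<close> is \<open>'e \<Rightarrow>\<^sub>L real\<close>.
  A tuple of length \<open>k\<close> is a function on \<open>nat\<close> of which only the entries below \<open>k\<close>
  matter.  Elements of the \<open>k\<close>-th exterior power of \<open>'e\<close> are represented by the
  constant-coefficient \<open>k\<close>-forms they define on the dual space.
\<close>

type_synonym 'w form = "(nat \<Rightarrow> 'w) \<Rightarrow> real"
type_synonym 'e kvec = "('e \<Rightarrow>\<^sub>L real) form"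

definition kwedge :: "nat \<Rightarrow> (nat \<Rightarrow> 'e) \<Rightarrow> 'e::real_normed_vector kvec" where
  "kwedge k v = (\<lambda>\<xi>. \<Sum>p | p permutes {..<k}. of_int (sign p) * (\<Prod>i<k. blinfun_apply (\<xi> i) (v (p i))))"

definition simple_kvecs :: "nat \<Rightarrow> 'e::real_normed_vector kvec set" where
  "simple_kvecs k = range (kwedge k)"

text \<open>The \<open>k\<close>-plane of a nonzero simple \<open>a\<close>: all frames \<open>v\<close> with \<open>kwedge k v = a\<close> have the
  same span, so the union is over equal sets.\<close>

definition kplane :: "nat \<Rightarrow> 'e::real_normed_vector kvec \<Rightarrow> 'e set" where
  "kplane k a = (\<Union>v\<in>{v. kwedge k v = a}. span (v ` {..<k}))"

text \<open>Sign of a frame \<open>w\<close> of the plane of \<open>a\<close>, relative to the orientation given by \<open>a\<close>.\<close>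

definition frame_sign :: "nat \<Rightarrow> 'e::real_normed_vector kvec \<Rightarrow> (nat \<Rightarrow> 'e) \<Rightarrow> real" where
  "frame_sign k a w = sgn (THE c. kwedge k w = (\<lambda>\<xi>. c * a \<xi>))"

definition push_kvec :: "('e \<Rightarrow> 'e) \<Rightarrow> 'e::real_normed_vector kvec \<Rightarrow> 'e kvec" where
  "push_kvec T a = (\<lambda>\<xi>. a (\<lambda>i. Blinfun (\<lambda>w. blinfun_apply (\<xi> i) (T w))))"

definition wedge :: "nat \<Rightarrow> nat \<Rightarrow> 'w form \<Rightarrow> 'w form \<Rightarrow> 'w form" where
  "wedge p q \<alpha> \<beta> = (\<lambda>w. (\<Sum>\<pi> | \<pi> permutes {..<p + q}.
      of_int (sign \<pi>) * \<alpha> (\<lambda>i. w (\<pi> i)) * \<beta> (\<lambda>i. w (\<pi> (p + i)))) / (fact p * fact q))"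

primrec wedge_power :: "nat \<Rightarrow> 'w form \<Rightarrow> nat \<Rightarrow> 'w form" where
  "wedge_power q \<beta> 0 = (\<lambda>w. 1)"
| "wedge_power q \<beta> (Suc j) = wedge q (q * j) \<beta> (wedge_power q \<beta> j)"


section \<open>Smooth functions and manifolds\<close>

fun Ck_on :: "nat \<Rightarrow> 'a::real_normed_vector set \<Rightarrow> ('a \<Rightarrow> 'b::real_normed_vector) \<Rightarrow> bool" where
  "Ck_on 0 S f \<longleftrightarrow> continuous_on S f"
| "Ck_on (Suc n) S f \<longleftrightarrow> (\<forall>x\<in>S. f differentiable at x) \<and>
     (\<forall>v. Ck_on n S (\<lambda>x. frechet_derivative f (at x) v))"

text \<open>To be used for open subsets of finite-dimensional spaces only.\<close>

definition smooth_on :: "'a::real_normed_vector set \<Rightarrow> ('a \<Rightarrow> 'b::real_normed_vector) \<Rightarrow> bool" where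
  "smooth_on S f \<longleftrightarrow> (\<forall>n. Ck_on n S f)"

text \<open>
  A chart is a domain together with a coordinate map.  The differentiable structure of a manifold
  is given by a family \<open>ch\<close> that selects a chart around each point; these charts form the atlas.
  The chart \<open>ch x\<close> identifies the tangent space at \<open>x\<close> with the model space \<open>'e\<close>.
\<close>

type_synonym ('m, 'e) chart = "'m set \<times> ('m \<Rightarrow> 'e)"

abbreviation dom_chart :: "('m, 'e) chart \<Rightarrow> 'm set" where
  "dom_chart c \<equiv> fst c"

abbreviation chart_inv :: "('m, 'e) chart \<Rightarrow> 'e \<Rightarrow> 'm" where
  "chart_inv c \<equiv> inv_into (fst c) (snd c)"

definition smooth_manifold ::
    "'m topology \<Rightarrow> ('m \<Rightarrow> ('m, 'e::euclidean_space) chart) \<Rightarrow> bool" where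
  "smooth_manifold X ch \<longleftrightarrow>
     Hausdorff_space X \<and> second_countable X \<and>
     (\<forall>x\<in>topspace X. x \<in> dom_chart (ch x) \<and> openin X (dom_chart (ch x)) \<and>
        open (snd (ch x) ` dom_chart (ch x)) \<and>
        homeomorphic_map (subtopology X (dom_chart (ch x)))
          (top_of_set (snd (ch x) ` dom_chart (ch x))) (snd (ch x))) \<and>
     (\<forall>x\<in>topspace X. \<forall>y\<in>topspace X.
        smooth_on (snd (ch x) ` (dom_chart (ch x) \<inter> dom_chart (ch y)))
          (snd (ch y) \<circ> chart_inv (ch x)))"

text \<open>A normed space as a manifold over itself.\<close>

definition flat_chart :: "'v \<Rightarrow> ('v, 'v) chart" where
  "flat_chart p = (UNIV, \<lambda>v. v)"

text \<open>Change of coordinates from chart \<open>c\<close> to chart \<open>d\<close> for tangent vectors at \<open>q\<close>.\<close>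

definition coord_change ::
    "('m, 'e::real_normed_vector) chart \<Rightarrow> ('m, 'e) chart \<Rightarrow> 'm \<Rightarrow> 'e \<Rightarrow> 'e" where
  "coord_change c d q = frechet_derivative (snd d \<circ> chart_inv c) (at (snd c q))"

text \<open>The differential of \<open>f\<close> at \<open>x\<close>, with respect to the chart around \<open>x\<close> and the one around
  \<open>f x\<close>.\<close>

definition tangent_map ::
    "('m \<Rightarrow> ('m, 'e::real_normed_vector) chart) \<Rightarrow> ('n \<Rightarrow> ('n, 'f::real_normed_vector) chart)
      \<Rightarrow> ('m \<Rightarrow> 'n) \<Rightarrow> 'm \<Rightarrow> 'e \<Rightarrow> 'f" where
  "tangent_map ch ch' f x =
     frechet_derivative (snd (ch' (f x)) \<circ> f \<circ> chart_inv (ch x)) (at (snd (ch x) x))"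

text \<open>The tangent space at \<open>p\<close> of a submanifold \<open>S\<close>, as the set of velocities of curves
  in \<open>S\<close> through \<open>p\<close>.\<close>

definition velocity_at ::
    "('m \<Rightarrow> ('m, 'e::real_normed_vector) chart) \<Rightarrow> 'm set \<Rightarrow> (real \<Rightarrow> 'm) \<Rightarrow> 'm \<Rightarrow> 'e \<Rightarrow> bool" where
  "velocity_at ch S \<gamma> p w \<longleftrightarrow> \<gamma> 0 = p \<and> (\<forall>\<^sub>F t in nhds 0. \<gamma> t \<in> S \<inter> dom_chart (ch p)) \<and>
     ((\<lambda>t. snd (ch p) (\<gamma> t)) has_vector_derivative w) (at 0)"

definition tangent_space ::
    "('m \<Rightarrow> ('m, 'e::real_normed_vector) chart) \<Rightarrow> 'm set \<Rightarrow> 'm \<Rightarrow> 'e set" where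
  "tangent_space ch S p = {w. \<exists>\<gamma>. velocity_at ch S \<gamma> p w}"

text \<open>
  The tangent bundle: its points are pairs \<open>(x, v)\<close> with \<open>v\<close> in the tangent space at \<open>x\<close>
  (a copy of \<open>'e\<close>, in the coordinates of \<open>ch x\<close>), and its charts are the ones induced by \<open>ch\<close>.
\<close>

definition tangent_chart ::
    "('m \<Rightarrow> ('m, 'e::real_normed_vector) chart) \<Rightarrow> 'm \<times> 'e \<Rightarrow> ('m \<times> 'e, 'e \<times> 'e) chart" where
  "tangent_chart ch p = (dom_chart (ch (fst p)) \<times> UNIV,
     \<lambda>q. (snd (ch (fst p)) (fst q),
           coord_change (ch (fst q)) (ch (fst p)) (fst q) (snd q)))"

text \<open>A differential form is a family of forms on the tangent spaces.  Its exterior derivative at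
  \<open>x\<close> is computed from its coordinate expression in the chart around \<open>x\<close>.\<close>

definition coord_form ::
    "('m \<Rightarrow> ('m, 'e::real_normed_vector) chart) \<Rightarrow> ('m \<Rightarrow> 'e form) \<Rightarrow> ('m, 'e) chart
      \<Rightarrow> 'e \<Rightarrow> 'e form" where
  "coord_form ch \<alpha> c y u =
     \<alpha> (chart_inv c y) (\<lambda>i. coord_change c (ch (chart_inv c y)) (chart_inv c y) (u i))"

definition ext_deriv ::
    "('m \<Rightarrow> ('m, 'e::real_normed_vector) chart) \<Rightarrow> nat \<Rightarrow> ('m \<Rightarrow> 'e form) \<Rightarrow> 'm \<Rightarrow> 'e form" where
  "ext_deriv ch p \<alpha> x u = (\<Sum>i\<le>p. (- 1) ^ i *
     frechet_derivative
       (\<lambda>y. coord_form ch \<alpha> (ch x) y (\<lambda>j. if j < i then u j else u (Suc j)))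
       (at (snd (ch x) x)) (u i))"


section \<open>Integration of forms\<close>

abbreviation Rn :: "nat \<Rightarrow> (nat \<Rightarrow> real) topology" where
  "Rn m \<equiv> product_topology (\<lambda>_. euclideanreal) {..<m}"

abbreviation Rn_lborel :: "nat \<Rightarrow> (nat \<Rightarrow> real) measure" where
  "Rn_lborel m \<equiv> Pi\<^sub>M {..<m} (\<lambda>_. lborel)"

definition partial :: "((nat \<Rightarrow> real) \<Rightarrow> 'v::real_normed_vector) \<Rightarrow> (nat \<Rightarrow> real) \<Rightarrow> nat \<Rightarrow> 'v" where
  "partial g t i = vector_derivative (\<lambda>s. g (t(i := s))) (at (t i))"

text \<open>\<open>g\<close> is a regular parametrisation, with domain \<open>D\<close> in \<open>m\<close>-space, of an open part of \<open>S\<close>.\<close>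

definition param_patch ::
    "nat \<Rightarrow> 'v::real_normed_vector set \<Rightarrow> (nat \<Rightarrow> real) set \<Rightarrow> ((nat \<Rightarrow> real) \<Rightarrow> 'v) \<Rightarrow> bool" where
  "param_patch m S D g \<longleftrightarrow>
     openin (Rn m) D \<and> openin (top_of_set S) (g ` D) \<and>
     homeomorphic_map (subtopology (Rn m) D) (top_of_set (g ` D)) g \<and>
     (\<forall>i<m. (\<forall>t\<in>D. (\<lambda>s. g (t(i := s))) differentiable at (t i)) \<and>
        continuous_map (subtopology (Rn m) D) euclidean (\<lambda>t. partial g t i)) \<and>
     (\<forall>t\<in>D. \<forall>c. (\<Sum>i<m. c i *\<^sub>R partial g t i) = 0 \<longrightarrow> (\<forall>i<m. c i = 0))"

text \<open>
  Integration of an \<open>m\<close>-form \<open>\<eta>\<close> over a compact \<open>m\<close>-dimensional submanifold \<open>S\<close> of a normed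
  space by means of finitely many parametrisations and a partition of unity subordinate to them.
  The orientation is described by the sign \<open>ori p \<tau>\<close> of each basis \<open>\<tau>\<close> of the tangent space at
  \<open>p\<close>; for \<open>m = 0\<close> this is a sign attached to each point.  With signs, the parametrisations need
  not preserve orientation.
\<close>

definition has_form_integral ::
    "nat \<Rightarrow> 'v::real_normed_vector set \<Rightarrow> ('v \<Rightarrow> 'v form) \<Rightarrow> ('v \<Rightarrow> 'v form) \<Rightarrow> real \<Rightarrow> bool" where
  "has_form_integral m S ori \<eta> I \<longleftrightarrow>
     (\<exists>N D g \<rho>. (\<forall>j<(N::nat). param_patch m S (D j) (g j) \<and>
          continuous_on S (\<rho> j) \<and> (\<forall>p\<in>S. 0 \<le> \<rho> j p) \<and>
          S \<inter> closure {p\<in>S. \<rho> j p \<noteq> 0} \<subseteq> g j ` D j) \<and>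
        (\<forall>p\<in>S. (\<Sum>j<N. \<rho> j p) = (1::real)) \<and>
        I = (\<Sum>j<N. LINT t:D j|Rn_lborel m.
               \<rho> j (g j t) * ori (g j t) (partial (g j) t) * \<eta> (g j t) (partial (g j) t)))"

text \<open>The value does not depend on the parametrisations and the partition of unity when \<open>S\<close> is a
  compact oriented submanifold and \<open>\<eta>\<close> is continuous; where it is undefined we put \<open>0\<close>.\<close>

definition form_integral ::
    "nat \<Rightarrow> 'v::real_normed_vector set \<Rightarrow> ('v \<Rightarrow> 'v form) \<Rightarrow> ('v \<Rightarrow> 'v form) \<Rightarrow> real" where
  "form_integral m S ori \<eta> =
     (if \<exists>!I. has_form_integral m S ori \<eta> I then THE I. has_form_integral m S ori \<eta> I else 0)"


section \<open>Minkowski spaces\<close>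

definition is_norm :: "('e::real_vector \<Rightarrow> real) \<Rightarrow> bool" where
  "is_norm N \<longleftrightarrow> (\<forall>v. 0 \<le> N v) \<and> (\<forall>v. N v = 0 \<longleftrightarrow> v = 0) \<and>
     (\<forall>c v. N (c *\<^sub>R v) = \<bar>c\<bar> * N v) \<and> (\<forall>v w. N (v + w) \<le> N v + N w)"

definition unit_sphere :: "('e \<Rightarrow> real) \<Rightarrow> 'e set" where
  "unit_sphere N = {v. N v = 1}"

definition smooth_hypersurface :: "'e::euclidean_space set \<Rightarrow> bool" where
  "smooth_hypersurface S \<longleftrightarrow> (\<forall>p\<in>S. \<exists>U (f :: 'e \<Rightarrow> real). open U \<and> p \<in> U \<and> smooth_on U f \<and>
     S \<inter> U = {q\<in>U. f q = 0} \<and> (\<forall>q\<in>U. frechet_derivative f (at q) \<noteq> (\<lambda>_. 0)))"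

definition euclidean_metric :: "('e::euclidean_space \<Rightarrow> 'e \<Rightarrow> real) \<Rightarrow> bool" where
  "euclidean_metric G \<longleftrightarrow> bilinear G \<and> (\<forall>v w. G v w = G w v) \<and> (\<forall>v. v \<noteq> 0 \<longrightarrow> 0 < G v v)"

text \<open>The outer unit normal at \<open>v\<close> of a hypersurface \<open>S\<close> enclosing the origin and transverse to
  the position vector.\<close>

definition outer_normal ::
    "('e::euclidean_space \<Rightarrow> 'e \<Rightarrow> real) \<Rightarrow> 'e set \<Rightarrow> 'e \<Rightarrow> 'e" where
  "outer_normal G S v = (THE \<nu>. G \<nu> \<nu> = 1 \<and> (\<forall>w\<in>tangent_space flat_chart S v. G \<nu> w = 0) \<and> 0 < G \<nu> v)"

text \<open>Principal curvatures are the eigenvalues of the shape operator, the derivative of the outer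
  unit normal along \<open>S\<close>; with this sign, those of a round sphere are positive.\<close>

definition principal_curvature ::
    "('e::euclidean_space \<Rightarrow> 'e \<Rightarrow> real) \<Rightarrow> 'e set \<Rightarrow> 'e \<Rightarrow> real \<Rightarrow> bool" where
  "principal_curvature G S v \<kappa> \<longleftrightarrow> (\<exists>\<gamma> w. w \<noteq> 0 \<and> velocity_at flat_chart S \<gamma> v w \<and>
     ((\<lambda>t. outer_normal G S (\<gamma> t)) has_vector_derivative \<kappa> *\<^sub>R w) (at 0))"

definition minkowski_norm :: "('e::euclidean_space \<Rightarrow> real) \<Rightarrow> bool" where
  "minkowski_norm N \<longleftrightarrow> is_norm N \<and> smooth_hypersurface (unit_sphere N) \<and>
     (\<forall>G. euclidean_metric G \<longrightarrow>
        (\<forall>v\<in>unit_sphere N. \<forall>\<kappa>. principal_curvature G (unit_sphere N) v \<kappa> \<longrightarrow> 0 < \<kappa>))"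

definition dual_ball :: "('e::euclidean_space \<Rightarrow> real) \<Rightarrow> ('e \<Rightarrow>\<^sub>L real) set" where
  "dual_ball N = {\<xi>. \<forall>v. N v \<le> 1 \<longrightarrow> blinfun_apply \<xi> v \<le> 1}"

definition dual_sphere :: "('e::euclidean_space \<Rightarrow> real) \<Rightarrow> ('e \<Rightarrow>\<^sub>L real) set" where
  "dual_sphere N = frontier (dual_ball N)"

text \<open>The dual of a plane \<open>W\<close> consists of the restrictions to \<open>W\<close> of linear functionals.\<close>

definition dual_proj :: "nat \<Rightarrow> 'e::euclidean_space kvec \<Rightarrow> ('e \<Rightarrow>\<^sub>L real) \<Rightarrow> 'e \<Rightarrow> real" where
  "dual_proj k a \<xi> = restrict (blinfun_apply \<xi>) (kplane k a)"

definition dual_plane :: "nat \<Rightarrow> 'e::euclidean_space kvec \<Rightarrow> ('e \<Rightarrow> real) set" where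
  "dual_plane k a = {restrict f (kplane k a) | f. linear f}"

text \<open>
  Integral of \<open>a\<close> over the projection of the dual ball.  If \<open>a (f\<^sub>0, \<dots>) > 0\<close>, the restrictions of
  the covectors \<open>f\<^sub>i\<close> form a positive basis of the dual plane, and the
  corresponding linear coordinates are used to compute the integral; the value does not depend on
  \<open>f\<close>.  For \<open>a = 0\<close> there is no such \<open>f\<close>, and the value is \<open>0\<close>.
\<close>

definition has_proj_integral ::
    "nat \<Rightarrow> ('e::euclidean_space \<Rightarrow> real) \<Rightarrow> 'e kvec \<Rightarrow> real \<Rightarrow> bool" where
  "has_proj_integral k N a I \<longleftrightarrow> (\<exists>f. 0 < a f \<and>
     I = (LINT t:{t \<in> space (Rn_lborel k).
              dual_proj k a (\<Sum>i<k. t i *\<^sub>R f i) \<in> dual_proj k a ` dual_ball N}|Rn_lborel k. a f))"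

definition HT_density :: "nat \<Rightarrow> ('e::euclidean_space \<Rightarrow> real) \<Rightarrow> 'e kvec \<Rightarrow> real" where
  "HT_density k N a = 1 / unit_ball_vol (real k) *
     (if \<exists>!I. has_proj_integral k N a I then THE I. has_proj_integral k N a I else 0)"

text \<open>The singular points: those where the differential of \<open>dual_proj k a\<close> restricted to the dual
  sphere (again \<open>dual_proj k a\<close>, by linearity) is not onto.\<close>

definition sing_set ::
    "nat \<Rightarrow> ('e::euclidean_space \<Rightarrow> real) \<Rightarrow> 'e kvec \<Rightarrow> ('e \<Rightarrow>\<^sub>L real) set" where
  "sing_set k N a = {\<xi>\<in>dual_sphere N.
     dual_proj k a ` tangent_space flat_chart (dual_sphere N) \<xi> \<noteq> dual_plane k a}"

text \<open>
  Orientation of the singular set as the boundary of the projected dual ball, outward vector first: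
  the projection of \<open>\<xi>\<close> points outward, and a basis of the oriented dual plane is positive iff
  \<open>a\<close>, as a \<open>k\<close>-form, is positive on it.
\<close>

definition sing_ori :: "'e::euclidean_space kvec \<Rightarrow> ('e \<Rightarrow>\<^sub>L real) \<Rightarrow> ('e \<Rightarrow>\<^sub>L real) form" where
  "sing_ori a \<xi> \<tau> = sgn (a (case_nat \<xi> \<tau>))"

definition euler_contraction :: "'v form \<Rightarrow> 'v \<Rightarrow> 'v form" where
  "euler_contraction b \<xi> \<tau> = b (case_nat \<xi> \<tau>)"

definition busemann_form ::
    "nat \<Rightarrow> ('e::euclidean_space \<Rightarrow> real) \<Rightarrow> 'e kvec \<Rightarrow> 'e kvec \<Rightarrow> real" where
  "busemann_form k N a b = 1 / (real k * unit_ball_vol (real k)) *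
     form_integral (k - 1) (sing_set k N a) (sing_ori a) (euler_contraction b)"

definition legendre1 :: "('e::euclidean_space \<Rightarrow> real) \<Rightarrow> 'e \<Rightarrow> 'e \<Rightarrow> real" where
  "legendre1 N v u = 1 / 2 * frechet_derivative (\<lambda>w. (N w)\<^sup>2) (at v) u"


section \<open>Finsler manifolds\<close>

definition finsler_manifold ::
    "'m topology \<Rightarrow> ('m \<Rightarrow> ('m, 'e::euclidean_space) chart) \<Rightarrow> ('m \<Rightarrow> 'e \<Rightarrow> real) \<Rightarrow> bool" where
  "finsler_manifold X ch F \<longleftrightarrow> smooth_manifold X ch \<and>
     (\<forall>x\<in>topspace X. minkowski_norm (F x)) \<and>
     (\<forall>x\<in>topspace X. smooth_on ((snd (ch x) ` dom_chart (ch x)) \<times> (UNIV - {0}))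
        ((\<lambda>(q, w). F q w) \<circ> chart_inv (tangent_chart ch (x, 0))))"

definition unit_bundle :: "'m topology \<Rightarrow> ('m \<Rightarrow> 'e \<Rightarrow> real) \<Rightarrow> ('m \<times> 'e) set" where
  "unit_bundle X F = {(x, v). x \<in> topspace X \<and> F x v = 1}"

definition HT_unit_bundle ::
    "nat \<Rightarrow> 'm topology \<Rightarrow> ('m \<Rightarrow> 'e::euclidean_space \<Rightarrow> real) \<Rightarrow> ('m \<times> 'e kvec) set" where
  "HT_unit_bundle k X F =
     {(x, a). x \<in> topspace X \<and> a \<in> simple_kvecs k \<and> HT_density k (F x) a = 1}"

text \<open>
  Coordinates of \<open>k\<close>-vectors in the chart \<open>c\<close>.  Since \<open>k\<close>-vectors are functions of covectors,
  smoothness and derivatives of maps into the bundle of \<open>k\<close>-vectors are taken for their values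
  on constant covectors; a tangent vector of that bundle is thus a pair of a tangent vector of the
  base and a \<open>k\<close>-vector, and the projection to the base has differential \<open>fst\<close>.
\<close>

definition coord_kvec ::
    "('m \<Rightarrow> ('m, 'e::euclidean_space) chart) \<Rightarrow> ('m, 'e) chart \<Rightarrow> 'm \<times> 'e kvec \<Rightarrow> 'e kvec" where
  "coord_kvec ch c p = push_kvec (coord_change (ch (fst p)) c (fst p)) (snd p)"

definition kvec_tangent_map ::
    "('m \<Rightarrow> ('m, 'e::euclidean_space) chart) \<Rightarrow> ('m \<Rightarrow> 'm \<times> 'e kvec) \<Rightarrow> 'm \<Rightarrow> 'e \<Rightarrow> 'e \<times> 'e kvec" where
  "kvec_tangent_map ch f x u =
     (tangent_map ch ch (fst \<circ> f) x u,
      \<lambda>\<xi>. frechet_derivative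
             (\<lambda>y. coord_kvec ch (ch (fst (f x))) (f (chart_inv (ch x) y)) \<xi>)
             (at (snd (ch x) x)) u)"

definition local_section ::
    "nat \<Rightarrow> 'm topology \<Rightarrow> ('m \<Rightarrow> ('m, 'e::euclidean_space) chart) \<Rightarrow> ('m \<Rightarrow> 'e \<Rightarrow> real)
      \<Rightarrow> 'm set \<Rightarrow> ('m \<Rightarrow> 'm \<times> 'e kvec) \<Rightarrow> bool" where
  "local_section k X ch F D \<sigma> \<longleftrightarrow> openin X D \<and>
     (\<forall>x\<in>D. \<sigma> x \<in> HT_unit_bundle k X F \<and> fst (\<sigma> x) = x) \<and>
     (\<forall>x\<in>topspace X. \<forall>\<xi>. smooth_on (snd (ch x) ` (dom_chart (ch x) \<inter> D))
        (\<lambda>y. coord_kvec ch (ch x) (\<sigma> (chart_inv (ch x) y)) \<xi>))"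

definition Theta ::
    "nat \<Rightarrow> ('m \<Rightarrow> 'e::euclidean_space \<Rightarrow> real) \<Rightarrow> 'm \<times> 'e kvec \<Rightarrow> ('e \<times> 'e kvec) form" where
  "Theta k F p w = busemann_form k (F (fst p)) (snd p) (kwedge k (\<lambda>i. fst (w i)))"

definition pullback_section ::
    "('m \<Rightarrow> ('m, 'e::euclidean_space) chart) \<Rightarrow> ('m \<Rightarrow> 'm \<times> 'e kvec)
      \<Rightarrow> ('m \<times> 'e kvec \<Rightarrow> ('e \<times> 'e kvec) form) \<Rightarrow> 'm \<Rightarrow> 'e form" where
  "pullback_section ch \<sigma> \<Theta> x b = \<Theta> (\<sigma> x) (\<lambda>i. kvec_tangent_map ch \<sigma> x (b i))"

text \<open>The Hilbert form of the norm.  The formula makes sense on the whole tangent bundle without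
  its zero section; exterior derivatives are computed there.\<close>

definition omega1 ::
    "('m \<Rightarrow> ('m, 'e::euclidean_space) chart) \<Rightarrow> ('m \<Rightarrow> 'e \<Rightarrow> real) \<Rightarrow> 'm \<times> 'e \<Rightarrow> ('e \<times> 'e) form" where
  "omega1 ch F p w = legendre1 (F (fst p)) (snd p) (tangent_map (tangent_chart ch) ch fst p (w 0))"

definition omega1_power ::
    "nat \<Rightarrow> ('m \<Rightarrow> ('m, 'e::euclidean_space) chart) \<Rightarrow> ('m \<Rightarrow> 'e \<Rightarrow> real)
      \<Rightarrow> 'm \<times> 'e \<Rightarrow> ('e \<times> 'e) form" where
  "omega1_power k ch F p = wedge 1 (2 * (k - 1)) (omega1 ch F p)
     (wedge_power 2 (ext_deriv (tangent_chart ch) 1 (omega1 ch F) p) (k - 1))"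

definition U_bundle ::
    "nat \<Rightarrow> 'm topology \<Rightarrow> ('m \<Rightarrow> 'e::euclidean_space \<Rightarrow> real) \<Rightarrow> 'm set
      \<Rightarrow> ('m \<Rightarrow> 'm \<times> 'e kvec) \<Rightarrow> ('m \<times> 'e) set" where
  "U_bundle k X F D \<sigma> =
     {(x, v). x \<in> D \<and> (x, v) \<in> unit_bundle X F \<and> v \<in> kplane k (snd (\<sigma> x))}"

text \<open>A tangent vector of \<open>U\<close> at \<open>p\<close> that projects to \<open>u\<close>; the integral along the fibre does not
  depend on the choice.\<close>

definition tangent_lift ::
    "('m \<Rightarrow> ('m, 'e::euclidean_space) chart) \<Rightarrow> ('m \<times> 'e) set \<Rightarrow> 'm \<times> 'e \<Rightarrow> 'e \<Rightarrow> 'e \<times> 'e" where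
  "tangent_lift ch U p u = (SOME w. w \<in> tangent_space (tangent_chart ch) U p \<and>
     tangent_map (tangent_chart ch) ch fst p w = u)"

text \<open>
  Orientation of the unit sphere of the oriented plane of \<open>a\<close>: a basis
  \<open>\<tau>\<^sub>0, \<dots>, \<tau>\<^bsub>k-2\<^esub>\<close> of the tangent space at \<open>v\<close> is positive iff
  \<open>\<tau>\<^sub>0, \<dots>, \<tau>\<^bsub>k-2\<^esub>, - v\<close> is a positive basis of the plane (inward vector last).
\<close>

definition fibre_ori :: "nat \<Rightarrow> 'e::euclidean_space kvec \<Rightarrow> 'e \<Rightarrow> 'e form" where
  "fibre_ori k a v \<tau> = frame_sign k a (\<lambda>i. if i < k - 1 then \<tau> i else - v)"

text \<open>Push-forward of a \<open>(2k-1)\<close>-form: the fibre over \<open>x\<close> is embedded in the tangent space at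
  \<open>x\<close>, and its tangent vectors \<open>\<tau>\<close> are mapped to vertical vectors of the tangent bundle.\<close>

definition fibre_integral ::
    "nat \<Rightarrow> ('m \<Rightarrow> ('m, 'e::euclidean_space) chart) \<Rightarrow> ('m \<times> 'e) set \<Rightarrow> ('m \<Rightarrow> 'm \<times> 'e kvec)
      \<Rightarrow> ('m \<times> 'e \<Rightarrow> ('e \<times> 'e) form) \<Rightarrow> 'm \<Rightarrow> 'e form" where
  "fibre_integral k ch U \<sigma> \<eta> x b =
     form_integral (k - 1) {v. (x, v) \<in> U} (fibre_ori k (snd (\<sigma> x)))
       (\<lambda>v \<tau>. \<eta> (x, v) (\<lambda>i. if i < k then tangent_lift ch U (x, v) (b i)
          else tangent_map flat_chart (tangent_chart ch) (\<lambda>w. (x, w)) v (\<tau> (i - k))))"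

end

(*
  The Legendre transformation L = d(N^2/2) of a Minkowski norm N is a diffeomorphism off the origin
  that maps the unit sphere onto the dual sphere, and the tangent space of the dual sphere at L(v) is
  the annihilator of v.  So the singular points of the projection to <a>^* are the L(v) with v a unit
  vector of <a>: L carries the fibre of U_sigma onto Sigma_a, and the integrands can be compared
  pointwise.

  Let t_1, ..., t_(k-1) be vertical.  In omega_1 wedge (d omega_1)^(k-1) only the terms survive in
  which each d omega_1 takes one vertical argument, and d omega_1(lift of b, t) = - dL_v(t)(b).  This
  gives (-1)^(k(k-1)/2) (k-1)! times b on L(v), dL_v(t_1), ..., dL_v(t_(k-1)), the Busemann integrand.
  The orientations differ by (-1)^k since the Gram matrix dL_v(t_i)(t_l) is positive definite.

  Parametrisations and partitions of unity are transported along L in both directions.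
*)
theory Submission
  imports Defs "Jordan_Normal_Form.Determinant"
begin

no_notation scalar_prod (infix "\<bullet>" 70)
no_notation vec_index (infixl "$" 100)

section \<open>Simple multivectors and their planes\<close>

text \<open>The curvature condition enters at one point. Monotonicity of the gradient L makes the
  Hessian \<open>H v\<close> positive semidefinite, and a null direction of it would be a principal
  direction with curvature 0. Definiteness then gives injectivity of L, invertibility of its
  derivative and the positive Gram determinant. The values of d omega_1 on two lifts contain
  derivatives of \<open>F\<close> along the manifold and depend on the lifts. Matching the k-1
  vertical arguments with the k-1 factors excludes such pairs, so a lift enters only through its
  projection. A form integral is the unique value over all admissible choices, and 0 if there is no
  unique one. Transport in one direction would not exclude further values on the other side; with
  both directions existence and uniqueness correspond, and the scaling law covers the default value
  too. The parameter domains are kept, so no Jacobian arises and the integrands differ by a constant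
  factor. That factor has modulus 1/(k-1)!, which together with the 1/k in the Busemann form gives
  1/k!; its sign combines the exponents k(k-1)/2 and k into k(k+1)/2.\<close>

definition pairing :: "nat \<Rightarrow> (nat \<Rightarrow> 'e::real_normed_vector \<Rightarrow>\<^sub>L real) \<Rightarrow> (nat \<Rightarrow> 'e) \<Rightarrow> real mat" where
  "pairing k \<xi> w = mat k k (\<lambda>(i, j). \<xi> i (w j))"

lemma pairing_carrier [simp]: "pairing k \<xi> w \<in> carrier_mat k k"
  by (simp add: pairing_def)

lemma pairing_index [simp]: "i < k \<Longrightarrow> j < k \<Longrightarrow> pairing k \<xi> w $$ (i, j) = \<xi> i (w j)"
  by (simp add: pairing_def)

lemma det_mat_permutes:
  "Determinant.det (mat k k f) = (\<Sum>p | p permutes {..<k}. of_int (sign p) * (\<Prod>i<k. f (i, p i)))"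
proof -
  have "(\<Prod>i = 0..<k. mat k k f $$ (i, p i)) = (\<Prod>i<k. f (i, p i))" if "p permutes {..<k}" for p
    unfolding atLeast0LessThan using permutes_in_image[OF that]
    by (intro prod.cong) auto
  then show ?thesis
    by (subst det_def'[of _ k]) (auto simp: atLeast0LessThan)
qed

lemma kwedge_det: "kwedge k w \<xi> = Determinant.det (pairing k \<xi> w)"
  by (simp add: kwedge_def pairing_def det_mat_permutes)

text \<open>The pairing matrix with \<open>\<xi>\<^sub>0\<close> is invertible; the rows of its
  adjugate, divided by its determinant, combine the \<open>\<xi>\<^sub>0 l\<close> into a dual
  frame.\<close>

lemma dual_frame_exists:
  fixes w :: "nat \<Rightarrow> 'e::real_normed_vector"
  assumes "kwedge k w \<xi>\<^sub>0 \<noteq> 0"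
  shows "\<exists>\<eta>. \<forall>i<k. \<forall>j<k. blinfun_apply (\<eta> i) (w j) = (if i = j then 1 else (0 :: real))"
proof -
  let ?A = "pairing k \<xi>\<^sub>0 w"
  define d where "d = Determinant.det ?A"
  have d: "d \<noteq> 0" using assms by (simp add: kwedge_det d_def)
  let ?B = "adj_mat ?A"
  have B: "?B \<in> carrier_mat k k" "?B * ?A = d \<cdot>\<^sub>m 1\<^sub>m k"
    unfolding d_def using adj_mat[of ?A k] by auto
  define \<eta> where "\<eta> i = (\<Sum>l<k. (?B $$ (i, l) / d) *\<^sub>R \<xi>\<^sub>0 l)" for i
  have "blinfun_apply (\<eta> i) (w j) = (if i = j then 1 else (0 :: real))" if ij: "i < k" "j < k" for i j
  proof -
    have "blinfun_apply (\<eta> i) (w j) = (\<Sum>l<k. ?B $$ (i, l) * ?A $$ (l, j)) / d"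
      using ij by (simp add: \<eta>_def blinfun.sum_left blinfun.scaleR_left sum_divide_distrib)
    also have "(\<Sum>l<k. ?B $$ (i, l) * ?A $$ (l, j)) = (?B * ?A) $$ (i, j)"
      using ij carrier_matD[OF B(1)] carrier_matD[OF pairing_carrier[of k \<xi>\<^sub>0 w]]
      by (simp add: scalar_prod_def atLeast0LessThan)
    also have "\<dots> = d * (if i = j then 1 else 0)"
      unfolding B(2) using ij by simp
    finally show ?thesis using d by simp
  qed
  then show ?thesis by (intro exI[of _ \<eta>]) simp
qed

text \<open>Contraction of a \<open>k\<close>-vector with covectors in every slot but
  \<open>j\<close>, read as a vector through the coordinate functionals. It uses only values of
  \<open>a\<close> and no frame, so it is smooth in \<open>a\<close>; this allows vectors to be
  extended along a section of \<open>k\<close>-vectors.\<close>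

definition contr :: "'e::euclidean_space kvec \<Rightarrow> (nat \<Rightarrow> 'e \<Rightarrow>\<^sub>L real) \<Rightarrow> nat \<Rightarrow> 'e" where
  "contr a \<xi> j = (\<Sum>e\<in>Basis. a (\<xi>(j := blinfun_inner_right e)) *\<^sub>R e)"

lemma contr_kwedge:
  fixes w :: "nat \<Rightarrow> 'e::euclidean_space"
  assumes j: "j < k"
  shows "contr (kwedge k w) \<xi> j =
    (\<Sum>p | p permutes {..<k}. (of_int (sign p) * (\<Prod>i\<in>{..<k} - {j}. \<xi> i (w (p i)))) *\<^sub>R w (p j))"
proof -
  let ?P = "{p. p permutes {..<k}}"
  let ?c = "\<lambda>p. of_int (sign p) * (\<Prod>i\<in>{..<k} - {j}. \<xi> i (w (p i)))"
  have "kwedge k w (\<xi>(j := blinfun_inner_right e)) = (\<Sum>p\<in>?P. ?c p * (e \<bullet> w (p j)))" for e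
    unfolding kwedge_def
  proof (rule sum.cong[OF refl])
    fix p
    have "(\<Prod>i<k. blinfun_apply ((\<xi>(j := blinfun_inner_right e)) i) (w (p i)))
      = (e \<bullet> w (p j)) * (\<Prod>i\<in>{..<k} - {j}. blinfun_apply ((\<xi>(j := blinfun_inner_right e)) i) (w (p i)))"
      using j by (subst prod.remove[of _ j]) auto
    also have "(\<Prod>i\<in>{..<k} - {j}. blinfun_apply ((\<xi>(j := blinfun_inner_right e)) i) (w (p i)))
      = (\<Prod>i\<in>{..<k} - {j}. \<xi> i (w (p i)))"
      by (rule prod.cong) auto
    finally show "of_int (sign p) * (\<Prod>i<k. blinfun_apply ((\<xi>(j := blinfun_inner_right e)) i) (w (p i)))
      = ?c p * (e \<bullet> w (p j))" by simp
  qed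
  then have "contr (kwedge k w) \<xi> j = (\<Sum>e\<in>Basis. \<Sum>p\<in>?P. ?c p *\<^sub>R ((w (p j) \<bullet> e) *\<^sub>R e))"
    by (simp add: contr_def scaleR_left.sum inner_commute)
  also have "\<dots> = (\<Sum>p\<in>?P. ?c p *\<^sub>R (\<Sum>e\<in>Basis. (w (p j) \<bullet> e) *\<^sub>R e))"
    by (subst sum.swap) (simp only: scaleR_right.sum)
  finally show ?thesis by (simp add: euclidean_representation)
qed

lemma contr_kwedge_in_span:
  fixes w :: "nat \<Rightarrow> 'e::euclidean_space"
  assumes j: "j < k"
  shows "contr (kwedge k w) \<xi> j \<in> span (w ` {..<k})"
  unfolding contr_kwedge[OF j]
proof (intro span_sum span_scale span_base)
  fix p assume "p \<in> {p. p permutes {..<k}}"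
  then show "w (p j) \<in> w ` {..<k}"
    using permutes_in_image[of p "{..<k}" j] j by auto
qed

text \<open>Only the identity survives in \<open>contr_kwedge\<close>: a moved index other than
  \<open>j\<close> gives a zero factor, and a permutation that fixes all other indices fixes
  \<open>j\<close> too.\<close>

lemma contr_dual_frame:
  fixes w :: "nat \<Rightarrow> 'e::euclidean_space" and \<eta> :: "nat \<Rightarrow> 'e \<Rightarrow>\<^sub>L real"
  assumes \<eta>: "\<And>i j. i < k \<Longrightarrow> j < k \<Longrightarrow> blinfun_apply (\<eta> i) (w j) = (if i = j then 1 else (0 :: real))" and j: "j < k"
  shows "contr (kwedge k w) \<eta> j = w j"
proof -
  let ?P = "{p. p permutes {..<k}}"
  let ?f = "\<lambda>p. (of_int (sign p) * (\<Prod>i\<in>{..<k} - {j}. blinfun_apply (\<eta> i) (w (p i)))) *\<^sub>R w (p j)"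
  have "?f p = 0" if p: "p permutes {..<k}" "p \<noteq> id" for p
  proof -
    have "\<exists>i\<in>{..<k} - {j}. p i \<noteq> i"
    proof (rule ccontr)
      assume c: "\<not> ?thesis"
      have "p j = j"
      proof (rule ccontr)
        assume pj: "p j \<noteq> j"
        have "p j < k" using permutes_in_image[OF p(1), of j] j by simp
        then have "p (p j) = p j" using c pj by auto
        then have "p j = j" using permutes_inj[OF p(1)] by (simp add: inj_eq)
        then show False using pj by simp
      qed
      then have "p i = i" for i using c permutes_not_in[OF p(1), of i] by (cases "i < k"; cases "i = j") auto
      then show False using p(2) by auto
    qed
    then obtain i where i: "i \<in> {..<k} - {j}" "p i \<noteq> i" by blast
    have "p i < k" using permutes_in_image[OF p(1), of i] i(1) by simp
    then have "blinfun_apply (\<eta> i) (w (p i)) = 0" using \<eta>[of i "p i"] i by auto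
    then have "(\<Prod>i\<in>{..<k} - {j}. blinfun_apply (\<eta> i) (w (p i))) = 0"
      using i(1) by (intro prod_zero) auto
    then show ?thesis by simp
  qed
  then have "sum ?f ?P = sum ?f {id}"
    by (intro sum.mono_neutral_right finite_permutations) (auto simp: permutes_id)
  also have "\<dots> = w j" using \<eta> by simp
  finally show ?thesis unfolding contr_kwedge[OF j] .
qed

text \<open>By \<open>contr_dual_frame\<close> each vector of a frame is a contraction of the
  \<open>k\<close>-vector itself, and such a contraction lies in the span of any other frame. So the
  union in \<open>kplane\<close> is over equal sets.\<close>

lemma kplane_kwedge:
  fixes w :: "nat \<Rightarrow> 'e::euclidean_space"
  assumes "kwedge k w \<xi>\<^sub>0 \<noteq> 0"
  shows "kplane k (kwedge k w) = span (w ` {..<k})"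
proof -
  have "span (v ` {..<k}) \<subseteq> span (w ` {..<k})" if vw: "kwedge k v = kwedge k w" for v
  proof (rule span_minimal[OF _ subspace_span], rule subsetI)
    obtain \<eta> where \<eta>: "\<And>i j. i < k \<Longrightarrow> j < k \<Longrightarrow> blinfun_apply (\<eta> i) (v j) = (if i = j then 1 else (0 :: real))"
      using dual_frame_exists[of k v \<xi>\<^sub>0] assms unfolding vw by blast
    fix x assume "x \<in> v ` {..<k}"
    then obtain j where j: "j < k" "x = v j" by auto
    then have "x = contr (kwedge k v) \<eta> j"
      by (simp only: contr_dual_frame[OF \<eta> j(1)])
    then show "x \<in> span (w ` {..<k})" using contr_kwedge_in_span[OF j(1)] by (simp only: vw)
  qed
  then show ?thesis
    unfolding kplane_def by (intro subset_antisym UN_least UN_upper) (simp_all only: mem_Collect_eq)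
qed

lemma kvec_frame:
  fixes a :: "'e::euclidean_space kvec"
  assumes "a \<in> simple_kvecs k" "a \<xi>\<^sub>0 \<noteq> 0"
  obtains w where "a = kwedge k w" "kplane k a = span (w ` {..<k})" "kwedge k w \<xi>\<^sub>0 \<noteq> 0"
  proof -
  obtain w where "a = kwedge k w" using assms(1) by (auto simp: simple_kvecs_def)
  then show thesis using that[of w] kplane_kwedge[of k w \<xi>\<^sub>0] assms(2) by simp
qed

lemma subspace_kplane:
  fixes a :: "'e::euclidean_space kvec"
  assumes "a \<in> simple_kvecs k" "a \<xi>\<^sub>0 \<noteq> 0"
  shows "subspace (kplane k a)"
  by (rule kvec_frame[OF assms]) (simp add: subspace_span)

lemma span_frame_sum:
  fixes w :: "nat \<Rightarrow> 'e::real_vector"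
  assumes "x \<in> span (w ` {..<k})"
  shows "\<exists>c. x = (\<Sum>j<k. c j *\<^sub>R w j)"
  using assms
proof (induction rule: span_induct_alt)
  case base
  show ?case by (rule exI[of _ "\<lambda>_. 0"]) simp
next
  case (step c x y)
  then obtain i d where "i < k" "x = w i" "y = (\<Sum>j<k. d j *\<^sub>R w j)" by auto
  then have "c *\<^sub>R x + y = (\<Sum>j<k. (d j + (if j = i then c else 0)) *\<^sub>R w j)"
    by (simp add: scaleR_left.add sum.distrib if_distrib[of "\<lambda>c. c *\<^sub>R _"] sum.delta cong: if_cong)
  then show ?case by (intro exI[of _ "\<lambda>j. d j + (if j = i then c else 0)"])
qed

text \<open>The vector is described by covectors \<open>\<eta>\<close> and numbers \<open>c\<close>
  alone. Keeping these and varying \<open>a\<close> extends \<open>v\<close> to nearby planes, which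
  is how lifts are built in \<open>tangent_lift_exists\<close>.\<close>

lemma kplane_contr:
  assumes a: "a \<in> simple_kvecs k" "a \<xi>\<^sub>0 \<noteq> 0" and v: "v \<in> kplane k a"
  shows "\<exists>\<eta> c. v = (\<Sum>j<k. c j *\<^sub>R contr a \<eta> j)"
proof -
  obtain w where w: "a = kwedge k w" "kplane k a = span (w ` {..<k})" "kwedge k w \<xi>\<^sub>0 \<noteq> 0"
    by (rule kvec_frame[OF a])
  obtain \<eta> where \<eta>: "\<And>i j. i < k \<Longrightarrow> j < k \<Longrightarrow> blinfun_apply (\<eta> i) (w j) = (if i = j then 1 else (0 :: real))"
    using dual_frame_exists[OF w(3)] by blast
  obtain c where "v = (\<Sum>j<k. c j *\<^sub>R w j)" using span_frame_sum[of v w k] v w(2) by auto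
  moreover have "(\<Sum>j<k. c j *\<^sub>R contr a \<eta> j) = (\<Sum>j<k. c j *\<^sub>R w j)"
    unfolding w(1) by (rule sum.cong[OF refl], subst contr_dual_frame[OF \<eta>]) auto
  ultimately have "v = (\<Sum>j<k. c j *\<^sub>R contr a \<eta> j)" by simp
  then show ?thesis by blast
qed

lemma push_kvec_kwedge:
  assumes "bounded_linear T"
  shows "push_kvec T (kwedge k w) = kwedge k (\<lambda>i. T (w i))"
proof -
  have "blinfun_apply (Blinfun (\<lambda>u. \<xi> (T u))) = (\<lambda>u. \<xi> (T u))" for \<xi> :: "'a \<Rightarrow>\<^sub>L real"
    by (rule bounded_linear_Blinfun_apply) (rule bounded_linear_compose[OF blinfun.bounded_linear_right assms])
  then show ?thesis by (simp add: push_kvec_def kwedge_def)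
qed

lemma contr_push_kvec_in_image:
  fixes T :: "'e::euclidean_space \<Rightarrow> 'e"
  assumes a: "a \<in> simple_kvecs k" "a \<xi>\<^sub>0 \<noteq> 0" and T: "linear T" and j: "j < k"
  shows "contr (push_kvec T a) \<xi> j \<in> T ` kplane k a"
proof -
  obtain w where w: "a = kwedge k w" "kplane k a = span (w ` {..<k})"
    by (rule kvec_frame[OF a])
  have "contr (push_kvec T a) \<xi> j \<in> span ((\<lambda>i. T (w i)) ` {..<k})"
    unfolding w(1) push_kvec_kwedge[OF T[unfolded linear_conv_bounded_linear]] by (rule contr_kwedge_in_span[OF j])
  also have "(\<lambda>i. T (w i)) ` {..<k} = T ` (w ` {..<k})" by auto
  also have "span \<dots> = T ` kplane k a"
    using w(2) span_linear_image[OF T] by simp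
  finally show ?thesis .
qed

text \<open>The factor is the determinant of the matrix that expresses \<open>u\<close> in a frame
  of \<open>a\<close>, by multiplicativity of the determinant.\<close>

lemma kwedge_in_kplane:
  fixes a :: "'e::euclidean_space kvec"
  assumes a: "a \<in> simple_kvecs k" "a \<xi>\<^sub>0 \<noteq> 0" and u: "\<And>i. i < k \<Longrightarrow> u i \<in> kplane k a"
  shows "\<exists>c. kwedge k u = (\<lambda>\<xi>. c * a \<xi>)"
proof -
  obtain w where w: "a = kwedge k w" "kplane k a = span (w ` {..<k})"
    by (rule kvec_frame[OF a])
  have "\<exists>c. u i = (\<Sum>j<k. c j *\<^sub>R w j)" if "i < k" for i
    using span_frame_sum[of "u i" w k] u[OF that] w(2) by auto
  then obtain C where C: "\<And>i. i < k \<Longrightarrow> u i = (\<Sum>j<k. C i j *\<^sub>R w j)" by metis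
  let ?C = "mat k k (\<lambda>(j, i). C i j)"
  have "kwedge k u \<xi> = Determinant.det ?C * a \<xi>" for \<xi>
  proof -
    have "pairing k \<xi> u = pairing k \<xi> w * ?C"
      using C by (intro eq_matI)
        (auto simp: scalar_prod_def atLeast0LessThan blinfun.sum_right blinfun.scaleR_right pairing_def intro!: sum.cong)
    then have "Determinant.det (pairing k \<xi> u) = Determinant.det (pairing k \<xi> w) * Determinant.det ?C"
      by (simp add: det_mult[of _ k])
    then show ?thesis by (simp add: kwedge_det w(1))
  qed
  then show ?thesis by blast
qed

section \<open>Positive definite matrices and orientation signs\<close>

lemma pos_def_det:
  fixes A :: "nat \<Rightarrow> nat \<Rightarrow> real"
  assumes pd: "\<And>c. (\<exists>i<n. c i \<noteq> 0) \<Longrightarrow> 0 < (\<Sum>i<n. \<Sum>j<n. c i * A i j * c j)"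
  shows "0 < Determinant.det (mat n n (\<lambda>(i, j). A i j))"
proof -
  \<comment> \<open>Segment from the identity matrix to \<open>A\<close>. Its matrices are positive
    definite, so a kernel vector paired with its image would give a positive number equal to 0. The
    determinant therefore never vanishes on the segment and keeps the sign of its initial value
    1.\<close>
  define M where "M s i j = (1 - s) * (if i = j then 1 else 0) + s * A i j" for s :: real and i j :: nat
  define f where "f s = Determinant.det (mat n n (\<lambda>(i, j). M s i j))" for s
  have cont: "continuous_on {0..1} f"
    unfolding f_def det_mat_permutes M_def prod.case by (intro continuous_intros)
  have f0: "f 0 = 1"
  proof -
    have "mat n n (\<lambda>(i, j). M 0 i j) = 1\<^sub>m n" by (intro eq_matI) (auto simp: M_def)
    then show ?thesis by (simp add: f_def)
  qed
  have nz: "f s \<noteq> 0" if s: "0 \<le> s" "s \<le> 1" for s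
  proof
    assume "f s = 0"
    then obtain v where v: "v \<in> carrier_vec n" "v \<noteq> 0\<^sub>v n" "mat n n (\<lambda>(i, j). M s i j) *\<^sub>v v = 0\<^sub>v n"
      unfolding f_def using det_0_iff_vec_prod_zero[of "mat n n (\<lambda>(i, j). M s i j)" n] by auto
    define c where "c = vec_index v"
    obtain i where i: "i < n" "c i \<noteq> 0"
      using v(1,2) by (auto simp: c_def vec_eq_iff)
    have row: "(\<Sum>j<n. M s i j * c j) = 0" if "i < n" for i
    proof -
      have "vec_index (mat n n (\<lambda>(i, j). M s i j) *\<^sub>v v) i = (\<Sum>j<n. M s i j * c j)"
        using that v(1) by (auto simp: scalar_prod_def atLeast0LessThan c_def intro!: sum.cong)
      then show ?thesis using v(3) that by simp
    qed
    have "0 = (\<Sum>i<n. c i * (\<Sum>j<n. M s i j * c j))" using row by simp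
    also have "\<dots> = (\<Sum>i<n. (1 - s) * (c i * c i) + s * (\<Sum>j<n. c i * A i j * c j))"
    proof (rule sum.cong[OF refl])
      fix i assume i: "i \<in> {..<n}"
      have "(\<Sum>j<n. M s i j * c j) = (\<Sum>j<n. (if i = j then (1 - s) * c j else 0) + s * (A i j * c j))"
        by (rule sum.cong) (auto simp: M_def algebra_simps)
      also have "\<dots> = (1 - s) * c i + s * (\<Sum>j<n. A i j * c j)"
        using i by (simp add: sum.distrib sum_distrib_left)
      finally have e: "(\<Sum>j<n. M s i j * c j) = (1 - s) * c i + s * (\<Sum>j<n. A i j * c j)" .
      have "(\<Sum>j<n. c i * A i j * c j) = c i * (\<Sum>j<n. A i j * c j)"
        by (simp add: sum_distrib_left mult.assoc)
      then show "c i * (\<Sum>j<n. M s i j * c j) = (1 - s) * (c i * c i) + s * (\<Sum>j<n. c i * A i j * c j)"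
        unfolding e by (simp add: algebra_simps)
    qed
    also have "\<dots> = (1 - s) * (\<Sum>i<n. c i * c i) + s * (\<Sum>i<n. \<Sum>j<n. c i * A i j * c j)"
      by (simp add: sum.distrib sum_distrib_left)
    finally have z: "(1 - s) * (\<Sum>i<n. c i * c i) + s * (\<Sum>i<n. \<Sum>j<n. c i * A i j * c j) = 0" by simp
    have p1: "0 < (\<Sum>i<n. c i * c i)"
      by (rule sum_pos2[of _ i]) (use i in \<open>auto simp: zero_less_mult_iff neq_iff\<close>)
    have p2: "0 < (\<Sum>i<n. \<Sum>j<n. c i * A i j * c j)" using pd i by blast
    show False
    proof (cases "s = 0")
      case True then show False using z p1 by simp
    next
      case False
      then have "0 < s * (\<Sum>i<n. \<Sum>j<n. c i * A i j * c j)" using p2 s by simp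
      moreover have "0 \<le> (1 - s) * (\<Sum>i<n. c i * c i)" using p1 s by simp
      ultimately show False using z by linarith
    qed
  qed
  have "0 < f 1"
  proof (rule ccontr)
    assume "\<not> 0 < f 1"
    then obtain s where "0 \<le> s" "s \<le> 1" "f s = 0"
      using IVT2'[of f 1 0 0] cont f0 by auto
    then show False using nz by blast
  qed
  then show ?thesis by (simp add: f_def M_def)
qed

text \<open>The sign \<open>(-1)\<^sup>k\<close> comes from moving the row of \<open>\<xi> 0\<close> past the other ones, together with the
  sign of \<open>\<xi> 0 (u j)\<close>.\<close>

lemma kwedge_block_det:
  fixes \<xi> :: "nat \<Rightarrow> 'e::real_normed_vector \<Rightarrow>\<^sub>L real"
  assumes "\<And>l. l < j \<Longrightarrow> \<xi> 0 (u l) = 0" "\<xi> 0 (u j) = - 1"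
  shows "kwedge (Suc j) u \<xi> = (- 1) ^ Suc j * Determinant.det (mat j j (\<lambda>(i, l). \<xi> (Suc i) (u l)))"
proof -
  let ?A = "pairing (Suc j) \<xi> u"
  have "Determinant.det ?A = (\<Sum>l<Suc j. ?A $$ (0, l) * cofactor ?A 0 l)"
    by (rule laplace_expansion_row) auto
  also have "\<dots> = - cofactor ?A 0 j"
    using assms by simp
  also have "cofactor ?A 0 j = (- 1) ^ j * Determinant.det (mat_delete ?A 0 j)"
    by (simp add: cofactor_def)
  also have "mat_delete ?A 0 j = mat j j (\<lambda>(i, l). \<xi> (Suc i) (u l))"
    by (intro eq_matI) (auto simp: mat_delete_def pairing_def)
  finally show ?thesis by (simp add: kwedge_det)
qed

text \<open>Since the \<open>u i\<close> lie in the plane, their wedge is \<open>c * a\<close>, with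
  \<open>c\<close> unique because \<open>a\<close> is nonzero. Evaluated at \<open>\<xi>\<close>, it
  is a sign times a positive definite determinant by \<open>kwedge_block_det\<close>, so
  \<open>c\<close> and \<open>a \<xi>\<close> have related signs.\<close>

lemma sgn_kwedge_frame_sign:
  fixes u :: "nat \<Rightarrow> 'e::euclidean_space" and \<xi> :: "nat \<Rightarrow> 'e \<Rightarrow>\<^sub>L real"
  assumes a: "a \<in> simple_kvecs (Suc j)" "a \<xi>\<^sub>0 \<noteq> 0" and u: "\<And>i. i < Suc j \<Longrightarrow> u i \<in> kplane (Suc j) a"
    and \<xi>: "\<And>l. l < j \<Longrightarrow> \<xi> 0 (u l) = 0" "\<xi> 0 (u j) = - 1"
    and pd: "\<And>c. (\<exists>i<j. c i \<noteq> 0) \<Longrightarrow> 0 < (\<Sum>i<j. \<Sum>l<j. c i * \<xi> (Suc i) (u l) * c l)"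
  shows "sgn (a \<xi>) = (- 1) ^ Suc j * frame_sign (Suc j) a u"
proof -
  define d where "d = Determinant.det (mat j j (\<lambda>(i, l). \<xi> (Suc i) (u l)))"
  have d: "d > 0" unfolding d_def by (rule pos_def_det) (rule pd)
  obtain c where c: "kwedge (Suc j) u = (\<lambda>\<xi>. c * a \<xi>)"
    using kwedge_in_kplane[of a "Suc j" \<xi>\<^sub>0 u, OF a u] by auto
  have "(THE c. kwedge (Suc j) u = (\<lambda>\<xi>. c * a \<xi>)) = c"
  proof (rule the_equality)
    show "c' = c" if "kwedge (Suc j) u = (\<lambda>\<xi>. c' * a \<xi>)" for c'
      using fun_cong[OF trans[OF that[symmetric] c], of \<xi>\<^sub>0] a(2) by simp
  qed (rule c)
  then have fs: "frame_sign (Suc j) a u = sgn c" by (simp add: frame_sign_def)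
  have e: "c * a \<xi> = (- 1) ^ Suc j * d"
    using kwedge_block_det[of j \<xi> u, OF \<xi>] fun_cong[OF c, of \<xi>] by (simp add: d_def)
  then have "sgn c * sgn (a \<xi>) = (- 1) ^ Suc j"
    unfolding sgn_mult[symmetric] e using d by (cases "even j") (auto simp: sgn_mult)
  moreover have "sgn c * sgn c = 1" using e d by (auto simp: sgn_mult[symmetric] sgn_if)
  ultimately have "sgn (a \<xi>) = sgn c * (- 1) ^ Suc j"
    by (metis mult.assoc mult_1)
  then show ?thesis by (simp add: fs)
qed

section \<open>Permutation sums and wedge products\<close>

text \<open>Antisymmetrisation without the factor 1/n!, chosen so that an iterated wedge product
  collapses to a single sum over permutations.\<close>

definition alt_sum :: "nat \<Rightarrow> 'w form \<Rightarrow> 'w form" where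
  "alt_sum n \<gamma> w = (\<Sum>\<pi> | \<pi> permutes {..<n}. of_int (sign \<pi>) * \<gamma> (\<lambda>i. w (\<pi> i)))"

lemma alt_sum_0: "alt_sum 0 \<gamma> w = \<gamma> w"
  unfolding alt_sum_def lessThan_0 permutes_empty by simp

definition shift_perm :: "nat \<Rightarrow> (nat \<Rightarrow> nat) \<Rightarrow> nat \<Rightarrow> nat" where
  "shift_perm p r i = (if i < p then i else p + r (i - p))"

lemma shift_perm_simps [simp]: "shift_perm p r (p + i) = p + r i" "i < p \<Longrightarrow> shift_perm p r i = i"
  by (simp_all add: shift_perm_def)

text \<open>Makes the facts on sign and support of \<open>map_permutation\<close> available for
  block permutations.\<close>

lemma shift_perm_eq_map:
  assumes "r permutes {..<q}"
  shows "shift_perm p r = map_permutation {..<q} (\<lambda>i. p + i) r"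
proof
  fix i
  have im: "(\<lambda>i. p + i) ` {..<q} = {p..<p+q}"
    by (simp add: lessThan_atLeast0 add.commute)
  show "shift_perm p r i = map_permutation {..<q} (\<lambda>i. p + i) r i"
  proof (cases "i \<in> {p..<p+q}")
    case True
    then obtain l where l: "l < q" "i = p + l"
      by (metis atLeastLessThan_iff le_Suc_ex nat_add_left_cancel_less)
    then show ?thesis
      using map_permutation_apply[of "\<lambda>i. p + i" "{..<q}" l r] by simp
  next
    case False
    then have "shift_perm p r i = i"
      using permutes_not_in[OF assms, of "i - p"] by (auto simp: shift_perm_def)
    then show ?thesis
      using False by (auto simp: map_permutation_def im restrict_id_def)
  qed
qed

lemma shift_perm_permutes:
  assumes "r permutes {..<q}"
  shows "shift_perm p r permutes {..<p + q}"
proof -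
  have "bij_betw (\<lambda>i. p + i) {..<q} {p..<p+q}"
    by (auto simp: bij_betw_def lessThan_atLeast0 add.commute)
  then have "shift_perm p r permutes {p..<p+q}"
    unfolding shift_perm_eq_map[OF assms] by (rule map_permutation_permutes) (rule assms)
  then show ?thesis
    by (rule permutes_subset) auto
qed

lemma sign_shift_perm:
  assumes "r permutes {..<q}"
  shows "sign (shift_perm p r) = sign r"
  unfolding shift_perm_eq_map[OF assms]
  by (rule sign_map_permutation) (use assms in auto)

lemma sign_comp_permutes:
  assumes "p permutes S" "q permutes S" "finite S"
  shows "sign (p \<circ> q) = sign p * sign q"
  using assms by (intro sign_compose permutes_imp_permutation)

text \<open>The inner alternating sum is absorbed by the outer one: composing with
  \<open>shift_perm p r\<close> leaves the first \<open>p\<close> arguments alone and carries the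
  sign of \<open>r\<close>. Each \<open>r\<close> contributes equally, which cancels the
  \<open>fact q\<close> in \<open>wedge\<close>.\<close>

lemma wedge_alt_sum:
  fixes \<alpha> \<gamma> :: "'w form"
  assumes \<alpha>: "\<And>w w'. (\<And>i. i < p \<Longrightarrow> w i = w' i) \<Longrightarrow> \<alpha> w = \<alpha> w'"
  shows "wedge p q \<alpha> (alt_sum q \<gamma>) = (\<lambda>w. alt_sum (p + q) (\<lambda>u. \<alpha> u * \<gamma> (\<lambda>i. u (p + i))) w / fact p)"
proof
  fix w :: "nat \<Rightarrow> 'w"
  let ?P = "{\<pi>. \<pi> permutes {..<p+q}}" and ?Q = "{r. r permutes {..<q}}"
  define f where "f \<pi> = real_of_int (sign \<pi>) * (\<alpha> (\<lambda>i. w (\<pi> i)) * \<gamma> (\<lambda>i. w (\<pi> (p + i))))" for \<pi>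
  have "(\<Sum>\<pi>\<in>?P. of_int (sign \<pi>) * \<alpha> (\<lambda>i. w (\<pi> i)) * alt_sum q \<gamma> (\<lambda>i. w (\<pi> (p + i))))
      = (\<Sum>\<pi>\<in>?P. \<Sum>r\<in>?Q. f (\<pi> \<circ> shift_perm p r))"
  proof (rule sum.cong[OF refl])
    fix \<pi> assume \<pi>: "\<pi> \<in> ?P"
    show "of_int (sign \<pi>) * \<alpha> (\<lambda>i. w (\<pi> i)) * alt_sum q \<gamma> (\<lambda>i. w (\<pi> (p + i)))
      = (\<Sum>r\<in>?Q. f (\<pi> \<circ> shift_perm p r))"
      unfolding alt_sum_def sum_distrib_left
    proof (rule sum.cong[OF refl])
      fix r assume r: "r \<in> ?Q"
      have "\<alpha> (\<lambda>i. w (\<pi> (shift_perm p r i))) = \<alpha> (\<lambda>i. w (\<pi> i))"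
        by (rule \<alpha>) simp
      moreover have "sign (\<pi> \<circ> shift_perm p r) = sign \<pi> * sign r"
        using \<pi> r shift_perm_permutes[of r q p] sign_shift_perm[of r q p]
        by (subst sign_comp_permutes) auto
      ultimately show "of_int (sign \<pi>) * \<alpha> (\<lambda>i. w (\<pi> i)) * (of_int (sign r) * \<gamma> (\<lambda>i. w (\<pi> (p + r i))))
        = f (\<pi> \<circ> shift_perm p r)"
        by (simp add: f_def)
    qed
  qed
  also have "\<dots> = (\<Sum>r\<in>?Q. \<Sum>\<pi>\<in>?P. f (\<pi> \<circ> shift_perm p r))"
    by (rule sum.swap)
  also have "\<dots> = (\<Sum>r\<in>?Q. \<Sum>\<pi>\<in>?P. f \<pi>)"
    by (intro sum.cong[OF refl] sum_permutations_compose_right[symmetric])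
       (use shift_perm_permutes in auto)
  also have "\<dots> = fact q * (\<Sum>\<pi>\<in>?P. f \<pi>)"
    by (simp add: card_permutations)
  finally show "wedge p q \<alpha> (alt_sum q \<gamma>) w
      = alt_sum (p + q) (\<lambda>u. \<alpha> u * \<gamma> (\<lambda>i. u (p + i))) w / fact p"
    unfolding wedge_def by (simp add: f_def alt_sum_def mult.commute)
qed

lemma wedge_scale_right: "wedge p q \<alpha> (\<lambda>w. \<beta> w / c) = (\<lambda>w. wedge p q \<alpha> \<beta> w / c)"
  by (simp add: wedge_def sum_divide_distrib mult.commute)

text \<open>By induction with \<open>wedge_alt_sum\<close>; each of the \<open>j\<close> two-forms
  contributes one factor \<open>1 / fact 2\<close>.\<close>

lemma wedge_power_alt_sum:
  fixes \<beta> :: "'w form"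
  assumes \<beta>: "\<And>w w'. (\<And>i. i < 2 \<Longrightarrow> w i = w' i) \<Longrightarrow> \<beta> w = \<beta> w'"
  shows "wedge_power 2 \<beta> j = (\<lambda>w. alt_sum (2 * j) (\<lambda>u. \<Prod>i<j. \<beta> (\<lambda>l. u (2 * i + l))) w / 2 ^ j)"
proof (induction j)
  case 0
  show ?case by (simp add: alt_sum_0)
next
  case (Suc j)
  let ?\<gamma> = "\<lambda>u. \<Prod>i<j. \<beta> (\<lambda>l. u (2 * i + l))"
  have "wedge_power 2 \<beta> (Suc j)
      = (\<lambda>w. alt_sum (2 + 2 * j) (\<lambda>u. \<beta> u * ?\<gamma> (\<lambda>i. u (2 + i))) w / fact 2 / 2 ^ j)"
    unfolding wedge_power.simps(2) Suc wedge_scale_right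
    by (subst wedge_alt_sum) (rule \<beta>, assumption, rule refl)
  moreover have "(\<lambda>u. \<beta> u * ?\<gamma> (\<lambda>i. u (2 + i))) = (\<lambda>u. \<Prod>i<Suc j. \<beta> (\<lambda>l. u (2 * i + l)))"
    by (simp add: prod.lessThan_Suc_shift del: prod.lessThan_Suc)
  ultimately show ?case
    by (simp add: mult.commute)
qed

lemma wedge_one_power:
  assumes \<alpha>: "\<And>w. \<alpha> w = om (w 0)" and \<beta>: "\<And>w. \<beta> w = be (w 0) (w 1)"
  shows "wedge 1 (2 * j) \<alpha> (wedge_power 2 \<beta> j) w =
    (\<Sum>\<pi> | \<pi> permutes {..<2 * j + 1}. of_int (sign \<pi>) *
      (om (w (\<pi> 0)) * (\<Prod>i<j. be (w (\<pi> (2 * i + 1))) (w (\<pi> (2 * i + 2)))))) / 2 ^ j"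
proof -
  have "wedge_power 2 \<beta> j = (\<lambda>w. alt_sum (2 * j) (\<lambda>u. \<Prod>i<j. \<beta> (\<lambda>l. u (2 * i + l))) w / 2 ^ j)"
    by (rule wedge_power_alt_sum) (simp add: \<beta>)
  then have "wedge 1 (2 * j) \<alpha> (wedge_power 2 \<beta> j)
      = (\<lambda>w. wedge 1 (2 * j) \<alpha> (alt_sum (2 * j) (\<lambda>u. \<Prod>i<j. \<beta> (\<lambda>l. u (2 * i + l)))) w / 2 ^ j)"
    by (simp only: wedge_scale_right)
  also have "wedge 1 (2 * j) \<alpha> (alt_sum (2 * j) (\<lambda>u. \<Prod>i<j. \<beta> (\<lambda>l. u (2 * i + l))))
     = (\<lambda>w. alt_sum (1 + 2 * j) (\<lambda>u. \<alpha> u * (\<Prod>i<j. \<beta> (\<lambda>l. u (1 + (2 * i + l))))) w / fact 1)"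
    by (rule wedge_alt_sum) (simp add: \<alpha>)
  finally have eq: "wedge 1 (2 * j) \<alpha> (wedge_power 2 \<beta> j) w =
      alt_sum (1 + 2 * j) (\<lambda>u. \<alpha> u * (\<Prod>i<j. \<beta> (\<lambda>l. u (1 + (2 * i + l))))) w / 2 ^ j"
    by (auto dest: fun_cong[of _ _ w])
  show ?thesis
    unfolding eq unfolding alt_sum_def by (simp add: \<alpha> \<beta> add.commute)
qed

section \<open>Signs and multiplicities of the surviving permutations\<close>

lemma sum_sign_flip:
  fixes G :: "(nat \<Rightarrow> nat) \<Rightarrow> real" and C :: "nat \<Rightarrow> nat \<Rightarrow> real"
  assumes ab: "a < n" "b < n" "a \<noteq> b"
    and G: "\<And>p. G (p \<circ> Transposition.transpose a b) = G p"
  shows "(\<Sum>p | p permutes {..<n}. of_int (sign p) * (G p * (C (p a) (p b) - C (p b) (p a))))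
    = 2 * (\<Sum>p | p permutes {..<n}. of_int (sign p) * (G p * C (p a) (p b)))"
proof -
  let ?P = "{p. p permutes {..<n}}" and ?t = "Transposition.transpose a b"
  have t: "?t permutes {..<n}"
    using ab by (intro permutes_swap_id) auto
  \<comment> \<open>Reindexing by the transposition swaps the arguments of \<open>C\<close> and
    reverses the sign, so the subtracted sum is minus the first one.\<close>
  have "(\<Sum>p\<in>?P. of_int (sign p) * (G p * C (p b) (p a)))
     = (\<Sum>p\<in>?P. of_int (sign (p \<circ> ?t)) * (G (p \<circ> ?t) * C ((p \<circ> ?t) b) ((p \<circ> ?t) a)))"
    by (rule sum_permutations_compose_right[OF t])
  also have "\<dots> = (\<Sum>p\<in>?P. - (of_int (sign p) * (G p * C (p a) (p b))))"
    by (rule sum.cong[OF refl])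
       (use ab t in \<open>auto simp: G sign_comp_permutes sign_swap_id\<close>)
  finally show ?thesis
    by (simp add: sum_negf sum_subtractf algebra_simps)
qed

text \<open>Induction on the number \<open>m\<close> of factors that hold a difference. Swapping the
  two arguments of factor \<open>m\<close> leaves all other factors, collected in \<open>G\<close>,
  unchanged, so every step yields a factor 2.\<close>

lemma sum_sign_flip_all:
  fixes W :: "nat \<Rightarrow> real" and C :: "nat \<Rightarrow> nat \<Rightarrow> real"
  assumes "m \<le> j"
  shows "(\<Sum>p | p permutes {..<2 * j + 1}. of_int (sign p) * (W (p 0) *
      (\<Prod>i<j. if i < m then C (p (2 * i + 1)) (p (2 * i + 2)) - C (p (2 * i + 2)) (p (2 * i + 1))
        else C (p (2 * i + 1)) (p (2 * i + 2)))))
    = 2 ^ m * (\<Sum>p | p permutes {..<2 * j + 1}. of_int (sign p) * (W (p 0) *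
      (\<Prod>i<j. C (p (2 * i + 1)) (p (2 * i + 2)))))"
  using assms
proof (induction m)
  case 0
  then show ?case by simp
next
  case (Suc m)
  let ?P = "{p. p permutes {..<2 * j + 1}}"
  let ?c = "\<lambda>p i. C (p (2 * i + 1)) (p (2 * i + 2))"
  let ?d = "\<lambda>p i. C (p (2 * i + 1)) (p (2 * i + 2)) - C (p (2 * i + 2)) (p (2 * i + 1))"
  define G where "G p = W (p 0) * (\<Prod>i\<in>{..<j} - {m}. if i < m then ?d p i else ?c p i)" for p
  have G: "G (p \<circ> Transposition.transpose (2 * m + 1) (2 * m + 2)) = G p" for p
  proof -
    have [simp]: "Transposition.transpose (2 * m + 1) (2 * m + 2) (2 * i + 1) = 2 * i + 1"
      "Transposition.transpose (2 * m + 1) (2 * m + 2) (2 * i + 2) = 2 * i + 2" if "i \<noteq> m" for i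
      using that by (auto simp: Transposition.transpose_def)
    have [simp]: "Transposition.transpose (2 * m + 1) (2 * m + 2) 0 = 0"
      by (simp add: Transposition.transpose_def)
    show ?thesis
      unfolding G_def by (intro arg_cong2[where f="(*)"] prod.cong) (auto simp del: One_nat_def add_2_eq_Suc')
  qed
  have m: "m < j"
    using Suc.prems by simp
  have split: "(\<Prod>i<j. if i < Suc m then ?d p i else ?c p i) = ?d p m * (\<Prod>i\<in>{..<j} - {m}. if i < m then ?d p i else ?c p i)"
    "(\<Prod>i<j. if i < m then ?d p i else ?c p i) = ?c p m * (\<Prod>i\<in>{..<j} - {m}. if i < m then ?d p i else ?c p i)" for p
    using m by (subst prod.remove[of _ m]; simp; intro disjI2 prod.cong refl if_cong; auto)+
  have "(\<Sum>p\<in>?P. of_int (sign p) * (W (p 0) * (\<Prod>i<j. if i < Suc m then ?d p i else ?c p i)))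
    = (\<Sum>p\<in>?P. of_int (sign p) * (G p * (C (p (2 * m + 1)) (p (2 * m + 2)) - C (p (2 * m + 2)) (p (2 * m + 1)))))"
    unfolding split G_def by (simp add: ac_simps)
  also have "\<dots> = 2 * (\<Sum>p\<in>?P. of_int (sign p) * (G p * C (p (2 * m + 1)) (p (2 * m + 2))))"
    by (rule sum_sign_flip, use m in simp, use m in simp, simp, rule G)
  also have "(\<Sum>p\<in>?P. of_int (sign p) * (G p * C (p (2 * m + 1)) (p (2 * m + 2))))
    = (\<Sum>p\<in>?P. of_int (sign p) * (W (p 0) * (\<Prod>i<j. if i < m then ?d p i else ?c p i)))"
    unfolding split G_def by (simp add: ac_simps)
  finally show ?case
    using Suc by simp
qed

text \<open>The entry in position \<open>a\<close> is carried past the next \<open>n\<close> entries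
  by \<open>n\<close> adjacent transpositions.\<close>

lemma cycle_perm_exists:
  "\<exists>c. c permutes {..<a + n + 1} \<and> sign c = (-1) ^ n \<and> c a = a + n \<and>
    (\<forall>i<a. c i = i) \<and> (\<forall>i<n. c (a + i + 1) = a + i)"
proof (induction n)
  case 0
  show ?case by (rule exI[of _ id]) (simp add: permutes_id[unfolded id_def])
next
  case (Suc n)
  then obtain c where c: "c permutes {..<a + n + 1}" "sign c = (-1) ^ n" "c a = a + n"
    "\<forall>i<a. c i = i" "\<forall>i<n. c (a + i + 1) = a + i" by auto
  let ?t = "Transposition.transpose (a + n) (a + n + 1)"
  have t: "?t permutes {..<a + Suc n + 1}"
    by (intro permutes_swap_id) auto
  have c': "c permutes {..<a + Suc n + 1}"
    by (rule permutes_subset[OF c(1)]) auto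
  have nfix: "c (Suc (a + n)) = Suc (a + n)"
    by (rule permutes_not_in[OF c(1)]) simp
  have "sign (?t \<circ> c) = (-1) ^ Suc n"
    unfolding sign_comp_permutes[OF t c' finite_lessThan] c(2) by (simp add: sign_swap_id)
  moreover have "(?t \<circ> c) (a + i + 1) = a + i" if "i < Suc n" for i
    using c(5) that nfix by (cases "i = n") (auto simp: Transposition.transpose_def)
  moreover have "?t (a + n) = a + n + 1" by simp
  moreover have "?t (c i) = i" if "i < a" for i
    using that c by (auto simp: Transposition.transpose_def)
  ultimately show ?case
    using permutes_compose[OF c' t] c by (intro exI[of _ "?t \<circ> c"]) (auto simp: o_def)
qed

text \<open>The perfect shuffle, which turns two consecutive blocks of length \<open>j\<close> into
  adjacent pairs and has j(j-1)/2 inversions. In the induction the new odd position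
  \<open>2 * j + 1\<close> passes the \<open>j\<close> entries of the second block; this is the
  cycle \<open>c\<close>.\<close>

lemma shuffle_perm_exists:
  "\<exists>s. s permutes {..<2 * j + 1} \<and> sign s = (-1) ^ (j * (j - 1) div 2) \<and> s 0 = 0 \<and>
    (\<forall>i<j. s (i + 1) = 2 * i + 1 \<and> s (j + 1 + i) = 2 * i + 2)"
proof (induction j)
  case 0
  show ?case by (rule exI[of _ id]) (simp add: permutes_id[unfolded id_def])
next
  case (Suc j)
  then obtain s where s: "s permutes {..<2 * j + 1}" "sign s = (-1) ^ (j * (j - 1) div 2)" "s 0 = 0"
    "\<And>i. i < j \<Longrightarrow> s (i + 1) = 2 * i + 1" "\<And>i. i < j \<Longrightarrow> s (j + 1 + i) = 2 * i + 2" by auto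
  obtain c where c: "c permutes {..<(j + 1) + j + 1}" "sign c = (-1) ^ j" "c (j + 1) = j + 1 + j"
    "\<And>i. i < j + 1 \<Longrightarrow> c i = i" "\<And>i. i < j \<Longrightarrow> c (j + 1 + i + 1) = j + 1 + i"
    using cycle_perm_exists[of "j + 1" j] by blast
  have s': "s permutes {..<2 * Suc j + 1}" and c': "c permutes {..<2 * Suc j + 1}"
    by (rule permutes_subset[OF s(1)] permutes_subset[OF c(1)]; force)+
  have fs: "s m = m" if "m > 2 * j" for m
    by (rule permutes_not_in[OF s(1)]) (use that in auto)
  have fc: "c m = m" if "m > 2 * j + 1" for m
    by (rule permutes_not_in[OF c(1)]) (use that in auto)
  have "Suc j * (Suc j - 1) div 2 = j + j * (j - 1) div 2"
  proof -
    have "even (j * (j - 1))" by (cases j) auto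
    moreover have "Suc j * (Suc j - 1) = 2 * j + j * (j - 1)"
      by (cases j) (auto simp: algebra_simps)
    ultimately show ?thesis by simp
  qed
  then have "sign (s \<circ> c) = (-1) ^ (Suc j * (Suc j - 1) div 2)"
    using s c by (simp add: sign_comp_permutes[OF s' c'] power_add)
  moreover have "(s \<circ> c) (i + 1) = 2 * i + 1" if "i < Suc j" for i
  proof (cases "i = j")
    case True
    then have "c (i + 1) = 2 * j + 1" using c(3) by simp
    then show ?thesis using fs[of "2 * j + 1"] True by simp
  next
    case False
    then show ?thesis using c(4)[of "i + 1"] s(4)[of i] that by simp
  qed
  moreover have "(s \<circ> c) (Suc j + 1 + i) = 2 * i + 2" if "i < Suc j" for i
  proof (cases "i = j")
    case True
    have "c (2 * j + 2) = 2 * j + 2" "s (2 * j + 2) = 2 * j + 2"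
      by (rule fc fs; simp)+
    moreover have "Suc j + 1 + i = 2 * j + 2" using True by simp
    ultimately show ?thesis using True by (simp only: o_apply)
  next
    case False
    then show ?thesis using c(5)[of i] s(5)[of i] that by simp
  qed
  moreover have "(s \<circ> c) 0 = 0"
    using c(4)[of 0] s(3) by simp
  ultimately show ?case
    using permutes_compose[OF c' s'] by blast
qed

text \<open>A permutation preserving the first block also preserves the second, so it is a product
  of one permutation on each; the inverse map restricts to the blocks and shifts the second one
  back.\<close>

lemma split_perm_bij:
  "bij_betw (\<lambda>(r, m). r \<circ> shift_perm (j + 1) m)
    ({r. r permutes {..<j + 1}} \<times> {m. m permutes {..<j}})
    {p. p permutes {..<2 * j + 1} \<and> p ` {..<j + 1} = {..<j + 1}}"
proof (rule bij_betwI[where g = "\<lambda>p. (restrict_id p {..<j + 1}, \<lambda>i. p (j + 1 + i) - (j + 1))"])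
  show "(\<lambda>(r, m). r \<circ> shift_perm (j + 1) m) \<in>
    {r. r permutes {..<j + 1}} \<times> {m. m permutes {..<j}} \<rightarrow>
    {p. p permutes {..<2 * j + 1} \<and> p ` {..<j + 1} = {..<j + 1}}"
  proof (rule Pi_I, unfold split_paired_all, simp only: prod.case mem_Sigma_iff mem_Collect_eq Suc_eq_plus1[symmetric], elim conjE)
    fix r m :: "nat \<Rightarrow> nat" assume r: "r permutes {..<Suc j}" and m: "m permutes {..<j}"
    have "shift_perm (Suc j) m permutes {..<Suc (2 * j)}"
      using shift_perm_permutes[OF m, of "Suc j"] by (simp add: mult_2)
    moreover have "r permutes {..<Suc (2 * j)}"
      by (rule permutes_subset[OF r]) auto
    moreover have "(r \<circ> shift_perm (Suc j) m) ` {..<Suc j} = r ` {..<Suc j}"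
      by (auto simp: image_iff)
    ultimately show "r \<circ> shift_perm (Suc j) m permutes {..<Suc (2 * j)} \<and>
      (r \<circ> shift_perm (Suc j) m) ` {..<Suc j} = {..<Suc j}"
      using permutes_image[OF r] permutes_compose[of "shift_perm (Suc j) m" "{..<Suc (2 * j)}" r]
      by (simp add: o_def)
  qed
  show "(\<lambda>p. (restrict_id p {..<j + 1}, \<lambda>i. p (j + 1 + i) - (j + 1)))
    \<in> {p. p permutes {..<2 * j + 1} \<and> p ` {..<j + 1} = {..<j + 1}}
    \<rightarrow> {r. r permutes {..<j + 1}} \<times> {m. m permutes {..<j}}"
  proof (rule Pi_I, clarify, intro conjI, goal_cases)
    case (1 p)
    have "bij_betw p {..<j + 1} {..<j + 1}"
      using 1 permutes_inj_on[OF 1(1)] by (auto simp: bij_betw_def)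
    then show ?case
      by (auto intro!: permutes_restrict_id)
  next
    case (2 p)
    have p: "j + 1 \<le> p (j + 1 + i) \<and> p (j + 1 + i) < 2 * j + 1" if "i < j" for i
    proof
      show "p (j + 1 + i) < 2 * j + 1"
        using permutes_in_image[OF 2(1), of "j + 1 + i"] that by auto
      show "j + 1 \<le> p (j + 1 + i)"
      proof (rule ccontr)
        assume "\<not> ?thesis"
        then have "p (j + 1 + i) \<in> p ` {..<j + 1}" using 2(2) by auto
        then obtain l where "l < j + 1" "p (j + 1 + i) = p l" by auto
        then show False using permutes_inj[OF 2(1)] by (auto dest!: injD)
      qed
    qed
    have "inj_on (\<lambda>i. p (j + 1 + i) - (j + 1)) {..<j}"
    proof (rule inj_onI)
      fix a b assume ab: "a \<in> {..<j}" "b \<in> {..<j}" "p (j + 1 + a) - (j + 1) = p (j + 1 + b) - (j + 1)"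
      then have "p (j + 1 + a) = p (j + 1 + b)"
        using p[of a] p[of b] by (auto simp: eq_diff_iff)
      then show "a = b" using permutes_inj[OF 2(1)] by (auto dest!: injD)
    qed
    moreover have "(\<lambda>i. p (j + 1 + i) - (j + 1)) ` {..<j} \<subseteq> {..<j}"
      using p by fastforce
    ultimately have "bij_betw (\<lambda>i. p (j + 1 + i) - (j + 1)) {..<j} {..<j}"
      by (simp add: bij_betw_def endo_inj_surj)
    moreover have "p (j + 1 + i) - (j + 1) = i" if "i \<notin> {..<j}" for i
      using permutes_not_in[OF 2(1), of "j + 1 + i"] that by auto
    ultimately show ?case unfolding mem_Collect_eq by (rule bij_imp_permutes)
  qed
next
  fix x assume "x \<in> {r. r permutes {..<j + 1}} \<times> {m. m permutes {..<j}}"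
  then obtain r m where x: "x = (r, m)" "r permutes {..<j + 1}" "m permutes {..<j}" by auto
  have "restrict_id (r \<circ> shift_perm (j + 1) m) {..<j + 1} = r"
    using permutes_not_in[OF x(2)] by (auto simp: restrict_id_def)
  moreover have "r (j + 1 + m i) = j + 1 + m i" for i
    using permutes_not_in[OF x(2), of "j + 1 + m i"] by auto
  ultimately show "(restrict_id (case x of (r, m) \<Rightarrow> r \<circ> shift_perm (j + 1) m) {..<j + 1},
      \<lambda>i. (case x of (r, m) \<Rightarrow> r \<circ> shift_perm (j + 1) m) (j + 1 + i) - (j + 1)) = x"
    by (simp only: x(1) prod.case o_def shift_perm_simps) (auto simp: o_def)
next
  fix p assume "p \<in> {p. p permutes {..<2 * j + 1} \<and> p ` {..<j + 1} = {..<j + 1}}"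
  then have p: "p permutes {..<2 * j + 1}" "p ` {..<j + 1} = {..<j + 1}" by auto
  have ge: "j + 1 \<le> p m" if "m \<ge> j + 1" for m
  proof (rule ccontr)
    assume "\<not> ?thesis"
    then have "p m \<in> p ` {..<j + 1}" using p(2) by auto
    then obtain l where "l < j + 1" "p m = p l" by auto
    then show False using permutes_inj[OF p(1)] that by (auto dest!: injD)
  qed
  show "(case (restrict_id p {..<j + 1}, \<lambda>i. p (j + 1 + i) - (j + 1)) of
      (r, m) \<Rightarrow> r \<circ> shift_perm (j + 1) m) = p"
  proof
    fix m
    show "(case (restrict_id p {..<j + 1}, \<lambda>i. p (j + 1 + i) - (j + 1)) of
      (r, m) \<Rightarrow> r \<circ> shift_perm (j + 1) m) m = p m"
      using ge[of m] by (cases "m < j + 1") (auto simp: restrict_id_def shift_perm_def)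
  qed
qed

text \<open>An index above \<open>j\<close> in one of the first \<open>j + 1\<close> slots makes the
  term vanish, so \<open>split_perm_bij\<close> applies. Every permutation \<open>m\<close> of the
  remaining slots contributes the same sum, whence \<open>fact j\<close>.\<close>

lemma sum_split_perm:
  fixes W :: "nat \<Rightarrow> real" and C :: "nat \<Rightarrow> nat \<Rightarrow> real"
  assumes W: "\<And>a. j < a \<Longrightarrow> W a = 0" and C: "\<And>a b. j < a \<Longrightarrow> C a b = 0"
  shows "(\<Sum>p | p permutes {..<2 * j + 1}. of_int (sign p) *
      (W (p 0) * (\<Prod>i<j. C (p (i + 1)) (p (j + 1 + i)))))
    = fact j * (\<Sum>r | r permutes {..<j + 1}. of_int (sign r) * (W (r 0) * (\<Prod>i<j. C (r (i + 1)) (j + 1 + i))))"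
proof -
  let ?q = "\<lambda>p. \<Prod>i<j. C (p (i + 1)) (p (j + 1 + i))"
  let ?P = "{r. r permutes {..<j + 1}}" and ?Q = "{m. m permutes {..<j}}"
  let ?R = "{p. p permutes {..<2 * j + 1} \<and> p ` {..<j + 1} = {..<j + 1}}"
  define f where "f p = of_int (sign p) * (W (p 0) * ?q p)" for p
  define g where "g r = of_int (sign r) * (W (r 0) * (\<Prod>i<j. C (r (i + 1)) (j + 1 + i)))" for r
  have "f p = 0" if p: "p permutes {..<2 * j + 1}" "p ` {..<j + 1} \<noteq> {..<j + 1}" for p
  proof -
    have "\<not> p ` {..<j + 1} \<subseteq> {..<j + 1}"
      using p(2) endo_inj_surj[of "{..<j + 1}" p] permutes_inj_on[OF p(1)] by auto
    then obtain a where a: "a < j + 1" "j < p a" by force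
    show ?thesis
    proof (cases a)
      case 0
      then show ?thesis using a W by (simp add: f_def)
    next
      case (Suc i)
      then have "?q p = 0"
        using a C by (intro prod_zero) auto
      then show ?thesis by (simp add: f_def)
    qed
  qed
  then have "(\<Sum>p | p permutes {..<2 * j + 1}. f p) = sum f ?R"
    by (intro sum.mono_neutral_right finite_permutations) auto
  also have "\<dots> = (\<Sum>(r, m)\<in>?P \<times> ?Q. f (r \<circ> shift_perm (j + 1) m))"
    using sum.reindex_bij_betw[OF split_perm_bij, of f j] by (simp add: case_prod_beta)
  \<comment> \<open>Reordering the factors by \<open>m\<close> moves \<open>m\<close> from the last
    slots to the slots from 1 to \<open>j\<close>, where it acts as the inverse of
    \<open>shift_perm 1 m\<close>. Both versions carry the sign of \<open>m\<close>.\<close>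
  also have "\<dots> = (\<Sum>(r, m)\<in>?P \<times> ?Q. g (r \<circ> inv_into UNIV (shift_perm 1 m)))"
  proof (rule sum.cong[OF refl], unfold split_paired_all, simp only: prod.case mem_Sigma_iff mem_Collect_eq, elim conjE)
    fix r m assume r: "r permutes {..<j + 1}" and m: "m permutes {..<j}"
    let ?n = "shift_perm 1 m" and ?s = "shift_perm (j + 1) m"
    have n: "?n permutes {..<j + 1}" and s: "?s permutes {..<2 * j + 1}"
      using shift_perm_permutes[OF m, of 1] shift_perm_permutes[OF m, of "j + 1"]
      by (simp_all add: mult_2)
    have r': "r permutes {..<2 * j + 1}"
      by (rule permutes_subset[OF r]) auto
    have sg: "sign (r \<circ> ?s) = sign r * sign m"
      using sign_comp_permutes[OF r' s] sign_shift_perm[OF m] by simp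
    have sn: "sign (r \<circ> inv_into UNIV ?n) = sign r * sign m"
      using sign_comp_permutes[OF r permutes_inv[OF n]] sign_shift_perm[OF m, of 1]
        sign_inverse[OF permutes_imp_permutation[OF _ n]] by simp
    have inv0: "inv_into UNIV ?n 0 = 0"
      using permutes_inverses(2)[OF n, of 0] by (simp add: shift_perm_def)
    have inv1: "inv_into UNIV ?n (m i + 1) = i + 1" for i
      using permutes_inverses(2)[OF n, of "1 + i"] by (simp only: shift_perm_simps add.commute)
    let ?u = "\<Prod>i<j. C (r (i + 1)) (r (j + 1 + m i))"
    let ?v = "\<Prod>i<j. C (r (inv_into UNIV ?n (i + 1))) (j + 1 + i)"
    have "?u = (\<Prod>i<j. C (r (inv_into UNIV ?n (m i + 1))) (j + 1 + m i))"
    proof (rule prod.cong[OF refl])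
      fix i assume "i \<in> {..<j}"
      have "r (j + 1 + m i) = j + 1 + m i"
        by (rule permutes_not_in[OF r]) simp
      then show "C (r (i + 1)) (r (j + 1 + m i)) = C (r (inv_into UNIV ?n (m i + 1))) (j + 1 + m i)"
        unfolding inv1 by simp
    qed
    also have "\<dots> = ?v"
      using prod.permute[OF m, of "\<lambda>i. C (r (inv_into UNIV ?n (i + 1))) (j + 1 + i)"] by (simp add: o_def)
    finally have pr: "?u = ?v" .
    have "(\<Prod>i<j. C ((r \<circ> ?s) (i + 1)) ((r \<circ> ?s) (j + 1 + i))) = ?u"
      by (rule prod.cong[OF refl]) (simp only: o_def shift_perm_simps, simp)
    then show "f (r \<circ> ?s) = g (r \<circ> inv_into UNIV ?n)"
      unfolding f_def g_def sg sn using pr by (simp add: inv0 del: One_nat_def)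
  qed
  also have "\<dots> = (\<Sum>m\<in>?Q. \<Sum>r\<in>?P. g (r \<circ> inv_into UNIV (shift_perm 1 m)))"
    by (subst sum.swap) (simp add: sum.cartesian_product)
  also have "\<dots> = (\<Sum>m\<in>?Q. \<Sum>r\<in>?P. g r)"
  proof (rule sum.cong[OF refl], rule sum_permutations_compose_right[symmetric])
    fix m assume "m \<in> ?Q"
    then show "inv_into UNIV (shift_perm 1 m) permutes {..<j + 1}"
      using shift_perm_permutes[of m j 1] by (auto intro: permutes_inv)
  qed
  also have "\<dots> = fact j * (\<Sum>r\<in>?P. g r)"
    by (simp add: card_permutations)
  finally show ?thesis
    by (simp only: f_def g_def)
qed

text \<open>The constants have separate origins: \<open>2 ^ j\<close> from putting the index above
  \<open>j\<close> second in each factor, the sign from unshuffling the pairs into blocks, and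
  \<open>fact j\<close> from the ways of assigning those indices to the factors.\<close>

lemma sum_perm_cross_terms:
  fixes W :: "nat \<Rightarrow> real" and B :: "nat \<Rightarrow> nat \<Rightarrow> real"
  assumes W: "\<And>a. j < a \<Longrightarrow> W a = 0"
    and B: "\<And>a b. j < a \<Longrightarrow> j < b \<Longrightarrow> B a b = 0" and anti: "\<And>a b. B a b = - B b a"
  shows "(\<Sum>p | p permutes {..<2 * j + 1}. of_int (sign p) *
      (W (p 0) * (\<Prod>i<j. B (p (2 * i + 1)) (p (2 * i + 2)))))
    = 2 ^ j * (-1) ^ (j * (j - 1) div 2) * fact j *
      (\<Sum>r | r permutes {..<j + 1}. of_int (sign r) * (W (r 0) * (\<Prod>i<j. B (r (i + 1)) (j + 1 + i))))"
proof -
  let ?P = "{p. p permutes {..<2 * j + 1}}"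
  \<comment> \<open>The part of \<open>B\<close> with an index up to \<open>j\<close> first and one
    above \<open>j\<close> second. Unless both indices are at most \<open>j\<close>,
    \<open>B\<close> is the antisymmetrisation of \<open>C\<close>.\<close>
  define C where "C a b = (if a \<le> j \<and> j < b then B a b else 0)" for a b
  let ?S = "\<lambda>n f. \<Sum>p | p permutes {..<n :: nat}. real_of_int (sign p) * f p"
  let ?A = "?S (2 * j + 1)"
  let ?p = "\<lambda>B p. \<Prod>i<j. B (p (2 * i + 1)) (p (2 * i + 2)) :: real"
  let ?q = "\<lambda>p. \<Prod>i<j. C (p (i + 1)) (p (j + 1 + i)) :: real"
  let ?r = "\<lambda>B r. \<Prod>i<j. B (r (i + 1)) (j + 1 + i) :: real"
  let ?d = "\<lambda>p. \<Prod>i<j. C (p (2 * i + 1)) (p (2 * i + 2)) - C (p (2 * i + 2)) (p (2 * i + 1))"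
  have BC: "B a b = C a b - C b a" if "\<not> (a \<le> j \<and> b \<le> j)" for a b
    using that B[of a b] anti[of a b] by (auto simp: C_def)
  have C0: "C a b - C b a = 0" if "a \<le> j \<and> b \<le> j" for a b
    using that by (auto simp: C_def)
  have "?A (\<lambda>p. W (p 0) * ?p B p)
    = ?A (\<lambda>p. W (p 0) * ?d p)"
  proof (rule sum.cong[OF refl], clarify)
    fix p assume p: "p permutes {..<2 * j + 1}"
    show "of_int (sign p) * (W (p 0) * ?p B p) =
      of_int (sign p) * (W (p 0) * ?d p)"
    proof (cases "\<exists>i<j. p (2 * i + 1) \<le> j \<and> p (2 * i + 2) \<le> j")
      case False
      then show ?thesis
        by (auto intro!: prod.cong BC)
    next
      case True
      then obtain l where l: "l < j" "p (2 * l + 1) \<le> j" "p (2 * l + 2) \<le> j" by auto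
      have rhs: "?d p = 0"
        using l C0 by (intro prod_zero) auto
      have "W (p 0) * ?p B p = 0"
      proof (rule ccontr)
        assume "\<not> ?thesis"
        then have nz: "p 0 \<le> j" "\<And>i. i < j \<Longrightarrow> p (2 * i + 1) \<le> j \<or> p (2 * i + 2) \<le> j"
          using W[of "p 0"] B by (auto simp: not_less[symmetric])
        \<comment> \<open>Pigeonhole: the positions in \<open>?T\<close> avoid slot 0 and factor
          \<open>l\<close>, and no factor contains two of them. So \<open>(m - 1) div 2\<close>, the
          number of the factor, injects \<open>?T\<close> into \<open>j - 1\<close> factors,
          although \<open>?T\<close> has \<open>j\<close> elements.\<close>
        let ?T = "{m \<in> {..<2 * j + 1}. j < p m}"
        have T: "m \<noteq> 0 \<and> (m - 1) div 2 < j \<and> (m - 1) div 2 \<noteq> l \<and> (m = 2 * ((m - 1) div 2) + 1 \<or> m = 2 * ((m - 1) div 2) + 2)" if "m \<in> ?T" for m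
        proof -
          have "m \<noteq> 0" using that nz by (cases "m = 0") auto
          moreover from this have m: "m = 2 * ((m - 1) div 2) + 1 \<or> m = 2 * ((m - 1) div 2) + 2"
            by presburger
          moreover have "(m - 1) div 2 < j" using that \<open>m \<noteq> 0\<close> by auto
          moreover have "(m - 1) div 2 \<noteq> l"
            using m l that by (metis (no_types, lifting) mem_Collect_eq not_less)
          ultimately show ?thesis by blast
        qed
        have "inj_on (\<lambda>m. (m - 1) div 2) ?T"
        proof (rule inj_onI)
          fix m m' assume m: "m \<in> ?T" "m' \<in> ?T" "(m - 1) div 2 = (m' - 1) div 2"
          show "m = m'"
            using T[OF m(1)] T[OF m(2)] m nz(2)[of "(m - 1) div 2"]
            by (metis (no_types, lifting) mem_Collect_eq not_less)
        qed
        then have "card ?T \<le> card ({..<j} - {l})"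
          by (rule card_inj_on_le) (use T in auto)
        also have "\<dots> < j" using l by simp
        finally have "card ?T < j" .
        moreover have "p ` ?T = {j + 1..<2 * j + 1}"
        proof -
          have "p ` ?T = p ` {..<2 * j + 1} \<inter> {m. j < m}" by auto
          then show ?thesis unfolding permutes_image[OF p] by auto
        qed
        then have "card ?T = j"
          using card_image[OF permutes_inj_on[OF p], of ?T] by simp
        ultimately show False by simp
      qed
      then show ?thesis by (simp only: rhs mult_zero_right)
    qed
  qed
  also have "\<dots> = 2 ^ j * ?A (\<lambda>p. W (p 0) * ?p C p)"
    by (subst sum_sign_flip_all[of j j, symmetric], simp, intro sum.cong arg_cong2[where f = "(*)"] prod.cong) auto
  also have "?A (\<lambda>p. W (p 0) * ?p C p)
    = (-1) ^ (j * (j - 1) div 2) * ?A (\<lambda>p. W (p 0) * ?q p)"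
  proof -
    obtain s where s: "s permutes {..<2 * j + 1}" "sign s = (-1) ^ (j * (j - 1) div 2)" "s 0 = 0"
      "\<And>i. i < j \<Longrightarrow> s (i + 1) = 2 * i + 1" "\<And>i. i < j \<Longrightarrow> s (j + 1 + i) = 2 * i + 2"
      using shuffle_perm_exists[of j] by blast
    have "?A (\<lambda>p. W (p 0) * ?q p)
      = (\<Sum>p\<in>?P. of_int (sign (p \<circ> s)) * (W ((p \<circ> s) 0) * ?q (p \<circ> s)))"
      by (rule sum_permutations_compose_right[OF s(1)])
    also have "\<dots> = (\<Sum>p\<in>?P. (-1) ^ (j * (j - 1) div 2) * (of_int (sign p) * (W (p 0) * ?p C p)))"
    proof (rule sum.cong[OF refl])
      fix p assume "p \<in> ?P"
      then have "sign (p \<circ> s) = sign p * (-1) ^ (j * (j - 1) div 2)"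
        using sign_comp_permutes[of p "{..<2 * j + 1}" s] s by simp
      moreover have "?q (p \<circ> s) = ?p C p"
        by (rule prod.cong[OF refl]) (simp only: o_def s(4,5) lessThan_iff)
      ultimately show "of_int (sign (p \<circ> s)) * (W ((p \<circ> s) 0) * ?q (p \<circ> s))
        = (-1) ^ (j * (j - 1) div 2) * (of_int (sign p) * (W (p 0) * ?p C p))"
        using s(3) by simp
    qed
    finally have e: "?A (\<lambda>p. W (p 0) * ?q p)
      = (-1) ^ (j * (j - 1) div 2) * ?A (\<lambda>p. W (p 0) * ?p C p)"
      by (simp only: sum_distrib_left)
    have cc: "(-1) ^ (j * (j - 1) div 2) * (-1) ^ (j * (j - 1) div 2) = (1 :: real)"
      unfolding power_mult_distrib[symmetric] by simp
    show ?thesis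
      unfolding e by (simp only: mult.assoc[symmetric, of "(-1) ^ (j * (j - 1) div 2)"] cc mult_1_left)
  qed
  also have "?A (\<lambda>p. W (p 0) * ?q p)
    = fact j * ?S (j + 1) (\<lambda>r. W (r 0) * ?r C r)"
    by (rule sum_split_perm) (use W in \<open>auto simp: C_def\<close>)
  also have "?S (j + 1) (\<lambda>r. W (r 0) * ?r C r)
    = ?S (j + 1) (\<lambda>r. W (r 0) * ?r B r)"
  proof (rule sum.cong[OF refl], clarify)
    fix r assume r: "r permutes {..<j + 1}"
    have "r (i + 1) \<le> j" if "i < j" for i
      using permutes_in_image[OF r, of "i + 1"] that by auto
    then show "of_int (sign r) * (W (r 0) * ?r C r)
      = of_int (sign r) * (W (r 0) * ?r B r)"
      by (auto simp: C_def intro!: prod.cong)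
  qed
  finally show ?thesis by (simp only: mult.assoc)
qed

text \<open>The vectors \<open>w i\<close> with \<open>i > j\<close> play the role of vertical vectors.\<close>

lemma wedge_one_power_vertical:
  fixes w :: "nat \<Rightarrow> 'w"
  assumes \<alpha>: "\<And>w. \<alpha> w = om (w 0)" and \<beta>: "\<And>w. \<beta> w = be (w 0) (w 1)"
    and om: "\<And>a. j < a \<Longrightarrow> om (w a) = 0"
    and be: "\<And>a b. j < a \<Longrightarrow> j < b \<Longrightarrow> be (w a) (w b) = 0" and anti: "\<And>u v. be u v = - be v u"
  shows "wedge 1 (2 * j) \<alpha> (wedge_power 2 \<beta> j) w = (-1) ^ (j * (j - 1) div 2) * fact j *
      (\<Sum>r | r permutes {..<j + 1}. of_int (sign r) *
        (om (w (r 0)) * (\<Prod>i<j. be (w (r (i + 1))) (w (j + 1 + i)))))"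
proof -
  define A where "A = (\<Sum>p | p permutes {..<2 * j + 1}. of_int (sign p) *
      (om (w (p 0)) * (\<Prod>i<j. be (w (p (2 * i + 1))) (w (p (2 * i + 2))))))"
  define R where "R = (\<Sum>r | r permutes {..<j + 1}. of_int (sign r) *
        (om (w (r 0)) * (\<Prod>i<j. be (w (r (i + 1))) (w (j + 1 + i)))))"
  have "A = 2 ^ j * (-1) ^ (j * (j - 1) div 2) * fact j * R"
    unfolding A_def R_def using om be anti
    by (rule sum_perm_cross_terms[of j "\<lambda>a. om (w a)" "\<lambda>a b. be (w a) (w b)"])
  moreover have "wedge 1 (2 * j) \<alpha> (wedge_power 2 \<beta> j) w = A / 2 ^ j"
    unfolding A_def using \<alpha> \<beta> by (rule wedge_one_power[where om = om and be = be and w = w])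
  ultimately show ?thesis
    unfolding R_def[symmetric] by simp
qed

section \<open>Smooth functions\<close>

abbreviation fderiv ("\<D>") where
  "\<D> f x \<equiv> frechet_derivative f (at x)"

lemma smooth_on_differentiable:
  "smooth_on S f \<Longrightarrow> x \<in> S \<Longrightarrow> f differentiable at x"
  unfolding smooth_on_def by (metis Ck_on.simps(2))

lemma smooth_on_has_derivative:
  "smooth_on S f \<Longrightarrow> x \<in> S \<Longrightarrow> (f has_derivative \<D> f x) (at x)"
  using smooth_on_differentiable frechet_derivative_works by blast

lemma smooth_on_frechet_derivative:
  "smooth_on S f \<Longrightarrow> smooth_on S (\<lambda>x. \<D> f x v)"
  unfolding smooth_on_def by (metis Ck_on.simps(2))

lemma smooth_on_continuous_on: "smooth_on S f \<Longrightarrow> continuous_on S f"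
  unfolding smooth_on_def by (metis Ck_on.simps(1))

lemma frechet_derivative_eqI:
  "(f has_derivative f') (at x) \<Longrightarrow> \<D> f x = f'"
  by (metis frechet_derivative_at)

text \<open>Both sides choose from the same set of derivatives, so the equality extends to points
  where that set is empty.\<close>

lemma frechet_derivative_cong_open:
  assumes "open S" "x \<in> S" "\<And>y. y \<in> S \<Longrightarrow> f y = g y"
  shows "\<D> f x = \<D> g x"
proof -
  have "(f has_derivative D) (at x) \<longleftrightarrow> (g has_derivative D) (at x)" for D
    using has_derivative_transform_within_open[OF _ assms(1,2)] assms(3) by metis
  then show ?thesis by (simp add: frechet_derivative_def)
qed

lemma linear_euclidean_sum:
  fixes f :: "'a::euclidean_space \<Rightarrow> 'b::real_vector"
  assumes "linear f"
  shows "f v = (\<Sum>e\<in>Basis. (v \<bullet> e) *\<^sub>R f e)"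
proof -
  have "f v = f (\<Sum>e\<in>Basis. (v \<bullet> e) *\<^sub>R e)"
    by (simp add: euclidean_representation)
  also have "\<dots> = (\<Sum>e\<in>Basis. (v \<bullet> e) *\<^sub>R f e)"
    using assms by (simp add: linear_sum linear_cmul)
  finally show ?thesis .
qed

text \<open>Needed to differentiate transition maps of the tangent bundle, whose fibre part is
  \<open>\<D> f y v\<close>. Linearity in \<open>v\<close> reduces it to finitely many products of a
  coordinate of \<open>v\<close> with a function of the base point.\<close>

lemma has_derivative_fderiv_pair:
  fixes f :: "'a::euclidean_space \<Rightarrow> 'b::real_normed_vector"
  assumes S: "open S" "x \<in> S" and f: "smooth_on S f"
  shows "((\<lambda>p. \<D> f (fst p) (snd p)) has_derivative
    (\<lambda>h. \<D> (\<lambda>y. \<D> f y v) x (fst h)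
        + \<D> f x (snd h))) (at (x, v))"
proof -
  let ?D = "\<lambda>y. \<D> f y"
  let ?D2 = "\<lambda>e. \<D> (\<lambda>y. ?D y e) x"
  have lin: "linear (?D y)" if "y \<in> S" for y
    using that f smooth_on_differentiable linear_frechet_derivative by blast
  have rep: "?D y w = (\<Sum>e\<in>Basis. (w \<bullet> e) *\<^sub>R ?D y e)" if "y \<in> S" for y w
    by (rule linear_euclidean_sum[OF lin[OF that]])
  have d2: "((\<lambda>y. ?D y e) has_derivative ?D2 e) (at x)" for e
    by (rule smooth_on_has_derivative[OF smooth_on_frechet_derivative[OF f] S(2)])
  have d2': "((\<lambda>p. ?D (fst p) e) has_derivative (\<lambda>h. ?D2 e (fst h))) (at (x, v))" for e
    by (rule has_derivative_compose[OF has_derivative_fst[OF has_derivative_ident]]) (simp add: d2)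
  have "((\<lambda>p. \<Sum>e\<in>Basis. (snd p \<bullet> e) *\<^sub>R ?D (fst p) e) has_derivative
      (\<lambda>h. \<Sum>e\<in>Basis. (snd (x, v) \<bullet> e) *\<^sub>R ?D2 e (fst h) + (snd h \<bullet> e) *\<^sub>R ?D (fst (x, v)) e)) (at (x, v))"
    by (intro has_derivative_sum has_derivative_scaleR has_derivative_inner_left has_derivative_snd
        has_derivative_ident d2')
  moreover have d2rep: "?D2 v h = (\<Sum>e\<in>Basis. (v \<bullet> e) *\<^sub>R ?D2 e h)" for h
  proof -
    have "((\<lambda>y. \<Sum>e\<in>Basis. (v \<bullet> e) *\<^sub>R ?D y e) has_derivative (\<lambda>h. \<Sum>e\<in>Basis. (v \<bullet> e) *\<^sub>R ?D2 e h)) (at x)"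
      by (intro has_derivative_sum has_derivative_scaleR_right d2)
    then have "((\<lambda>y. ?D y v) has_derivative (\<lambda>h. \<Sum>e\<in>Basis. (v \<bullet> e) *\<^sub>R ?D2 e h)) (at x)"
      by (rule has_derivative_transform_within_open[OF _ S]) (rule rep[symmetric])
    then show ?thesis
      by (simp add: frechet_derivative_eqI)
  qed
  moreover have "(\<lambda>h. \<Sum>e\<in>Basis. (snd (x, v) \<bullet> e) *\<^sub>R ?D2 e (fst h) + (snd h \<bullet> e) *\<^sub>R ?D (fst (x, v)) e)
    = (\<lambda>h. ?D2 v (fst h) + ?D x (snd h))"
    unfolding sum.distrib fst_conv snd_conv d2rep[symmetric] rep[OF S(2), symmetric] ..
  ultimately have "((\<lambda>p. \<Sum>e\<in>Basis. (snd p \<bullet> e) *\<^sub>R ?D (fst p) e) has_derivative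
    (\<lambda>h. ?D2 v (fst h) + ?D x (snd h))) (at (x, v))"
    by (simp only:)
  then show ?thesis
  proof (rule has_derivative_transform_within_open)
    show "open (S \<times> (UNIV :: 'a set))" using S by (intro open_Times) auto
    show "(x, v) \<in> S \<times> UNIV" using S by simp
    show "(\<Sum>e\<in>Basis. (snd p \<bullet> e) *\<^sub>R ?D (fst p) e) = ?D (fst p) (snd p)" if "p \<in> S \<times> UNIV" for p
      by (rule rep[symmetric]) (use that in auto)
  qed
qed

text \<open>The mean value theorem, applied to the increment of \<open>f\<close> in direction
  \<open>b\<close> as it moves in direction \<open>a\<close>, turns the second difference into an
  increment of the gradient \<open>L\<close>. Two remainders of the expansion of \<open>L\<close> at
  \<open>v\<close>, one at each end, give the error factor
  \<open>2 * norm a + norm b\<close>.\<close>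

lemma second_difference_bound:
  fixes f :: "'a::real_inner \<Rightarrow> real"
  assumes "0 < r" and f: "\<And>z. z \<in> ball v r \<Longrightarrow> (f has_derivative (\<lambda>u. L z \<bullet> u)) (at z)"
    and L: "(L has_derivative H) (at v)" and "0 < \<epsilon>"
  shows "\<exists>\<delta>>0. \<forall>t. 0 < t \<and> t < \<delta> \<longrightarrow>
    \<bar>f (v + t *\<^sub>R a + t *\<^sub>R b) - f (v + t *\<^sub>R a) - f (v + t *\<^sub>R b) + f v - t\<^sup>2 * (H b \<bullet> a)\<bar>
      \<le> \<epsilon> * t\<^sup>2 * ((2 * norm a + norm b) * norm a)"
proof -
  have H: "linear H" by (rule has_derivative_linear[OF L])
  obtain d where d: "d > 0" "\<And>y. norm (y - v) < d \<Longrightarrow> norm (L y - L v - H (y - v)) \<le> \<epsilon> * norm (y - v)"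
    using L[unfolded has_derivative_at_alt] \<open>0 < \<epsilon>\<close> by auto
  \<comment> \<open>Keeps the whole parallelogram spanned at \<open>v\<close> by
    \<open>t *\<^sub>R a\<close> and \<open>t *\<^sub>R b\<close> inside the ball where
    \<open>f\<close> has gradient \<open>L\<close> and where the expansion of \<open>L\<close> is
    accurate.\<close>
  define \<delta> where "\<delta> = min d r / (norm a + norm b + 1)"
  have pos: "norm a + norm b + 1 > 0"
    by (simp add: add_nonneg_pos)
  show ?thesis
  proof (intro exI[of _ \<delta>] conjI allI impI)
    show "0 < \<delta>" using d(1) \<open>0 < r\<close> pos by (simp add: \<delta>_def)
    fix t :: real assume t: "0 < t \<and> t < \<delta>"
    then have "t * (norm a + norm b + 1) < min d r"
      using pos by (simp add: \<delta>_def pos_less_divide_eq)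
    then have tn: "t * (norm a + norm b) < min d r"
      using t by (simp add: algebra_simps)
    have small: "norm (s *\<^sub>R (t *\<^sub>R a) + q *\<^sub>R (t *\<^sub>R b)) < min d r" if "0 \<le> s" "s \<le> 1" "0 \<le> q" "q \<le> 1" for s q
    proof -
      have "norm (s *\<^sub>R (t *\<^sub>R a) + q *\<^sub>R (t *\<^sub>R b)) \<le> s * (t * norm a) + q * (t * norm b)"
        using norm_triangle_ineq[of "s *\<^sub>R (t *\<^sub>R a)" "q *\<^sub>R (t *\<^sub>R b)"] that t by simp
      also have "\<dots> \<le> 1 * (t * norm a) + 1 * (t * norm b)"
        using that t by (intro add_mono mult_right_mono) auto
      finally show ?thesis using tn by (simp add: algebra_simps)
    qed
    let ?z = "\<lambda>s q. v + (s *\<^sub>R (t *\<^sub>R a) + q *\<^sub>R (t *\<^sub>R b))"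
    have fz: "((\<lambda>s. f (?z s q)) has_derivative (\<lambda>h. L (?z s q) \<bullet> (h *\<^sub>R (t *\<^sub>R a)))) (at s)"
      if "0 \<le> s" "s \<le> 1" "0 \<le> q" "q \<le> 1" for s q
    proof (rule has_derivative_compose[of "\<lambda>s. ?z s q" "\<lambda>h. h *\<^sub>R (t *\<^sub>R a)" s UNIV f "\<lambda>u. L (?z s q) \<bullet> u"])
      show "((\<lambda>s. ?z s q) has_derivative (\<lambda>h. h *\<^sub>R (t *\<^sub>R a))) (at s)"
        by (auto intro!: derivative_eq_intros)
      show "(f has_derivative (\<lambda>u. L (?z s q) \<bullet> u)) (at (?z s q))"
      proof (rule f)
        have "dist v (?z s q) = norm (s *\<^sub>R (t *\<^sub>R a) + q *\<^sub>R (t *\<^sub>R b))"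
          unfolding dist_norm by (subst norm_minus_commute) (simp only: add_diff_cancel_left')
        then show "?z s q \<in> ball v r"
          using small[OF that] by simp
      qed
    qed
    define \<phi> where "\<phi> s = f (?z s 1) - f (?z s 0)" for s
    have "\<exists>s\<in>{0<..<1}. \<phi> 1 - \<phi> 0 = L (?z s 1) \<bullet> ((1 - 0) *\<^sub>R (t *\<^sub>R a)) - L (?z s 0) \<bullet> ((1 - 0) *\<^sub>R (t *\<^sub>R a))"
    proof (rule mvt)
      fix s :: real assume s: "0 < s" "s < 1"
      show "(\<phi> has_derivative (\<lambda>h. L (?z s 1) \<bullet> (h *\<^sub>R (t *\<^sub>R a)) - L (?z s 0) \<bullet> (h *\<^sub>R (t *\<^sub>R a)))) (at s)"
        unfolding \<phi>_def using s by (intro has_derivative_diff fz) auto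
    next
      have "continuous (at s) \<phi>" if "s \<in> {0..1}" for s
        unfolding \<phi>_def using that
        by (intro continuous_diff has_derivative_continuous[OF fz]) auto
      then show "continuous_on {0..1} \<phi>"
        by (simp add: continuous_at_imp_continuous_on)
    qed (simp, intro bexI, assumption, simp)
    then obtain s where s: "0 < s" "s < 1" "\<phi> 1 - \<phi> 0 = (L (?z s 1) - L (?z s 0)) \<bullet> (t *\<^sub>R a)"
      by (auto simp: inner_diff_left right_diff_distrib)
    define R where "R q = L (?z s q) - L v - H (s *\<^sub>R (t *\<^sub>R a) + q *\<^sub>R (t *\<^sub>R b))" for q
    have R: "norm (R q) \<le> \<epsilon> * norm (s *\<^sub>R (t *\<^sub>R a) + q *\<^sub>R (t *\<^sub>R b))" if "0 \<le> q" "q \<le> 1" for q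
      using d(2)[of "?z s q"] small[of s q] s that by (simp add: R_def)
    have nR: "norm (R 1 - R 0) \<le> \<epsilon> * (t * (2 * norm a + norm b))"
    proof -
      have "norm (R 1 - R 0) \<le> norm (R 1) + norm (R 0)" by (rule norm_triangle_ineq4)
      also have "\<dots> \<le> \<epsilon> * norm (s *\<^sub>R (t *\<^sub>R a) + 1 *\<^sub>R (t *\<^sub>R b)) + \<epsilon> * norm (s *\<^sub>R (t *\<^sub>R a) + 0 *\<^sub>R (t *\<^sub>R b))"
        using R[of 1] R[of 0] by (intro add_mono) auto
      also have "\<dots> = \<epsilon> * (norm (s *\<^sub>R (t *\<^sub>R a) + t *\<^sub>R b) + norm (s *\<^sub>R (t *\<^sub>R a)))"
        by (simp add: algebra_simps)
      also have "\<dots> \<le> \<epsilon> * (t * (2 * norm a + norm b))"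
      proof (intro mult_left_mono)
        have "norm (s *\<^sub>R (t *\<^sub>R a)) = s * (t * norm a)" using s t by simp
        also have "\<dots> \<le> 1 * (t * norm a)" using s t by (intro mult_right_mono) auto
        finally have n1: "norm (s *\<^sub>R (t *\<^sub>R a)) \<le> t * norm a" by simp
        have "norm (s *\<^sub>R (t *\<^sub>R a) + t *\<^sub>R b) \<le> norm (s *\<^sub>R (t *\<^sub>R a)) + t * norm b"
          using norm_triangle_ineq[of "s *\<^sub>R (t *\<^sub>R a)" "t *\<^sub>R b"] t by simp
        then show "norm (s *\<^sub>R (t *\<^sub>R a) + t *\<^sub>R b) + norm (s *\<^sub>R (t *\<^sub>R a)) \<le> t * (2 * norm a + norm b)"
          using n1 by (simp add: algebra_simps)
      qed (use \<open>0 < \<epsilon>\<close> in simp)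
      finally show ?thesis .
    qed
    have "L (?z s 1) - L (?z s 0) = R 1 - R 0 + t *\<^sub>R H b"
      using H by (simp add: R_def linear_add linear_cmul)
    then have "\<phi> 1 - \<phi> 0 - t\<^sup>2 * (H b \<bullet> a) = (R 1 - R 0) \<bullet> (t *\<^sub>R a)"
      using s(3) by (simp add: inner_add_left power2_eq_square distrib_left)
    moreover have "\<phi> 1 - \<phi> 0 = f (v + t *\<^sub>R a + t *\<^sub>R b) - f (v + t *\<^sub>R a) - f (v + t *\<^sub>R b) + f v"
      by (simp add: \<phi>_def add.assoc)
    moreover have "\<bar>(R 1 - R 0) \<bullet> (t *\<^sub>R a)\<bar> \<le> (\<epsilon> * (t * (2 * norm a + norm b))) * (t * norm a)"
    proof -
      have "\<bar>(R 1 - R 0) \<bullet> (t *\<^sub>R a)\<bar> \<le> norm (R 1 - R 0) * norm (t *\<^sub>R a)"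
        by (rule Cauchy_Schwarz_ineq2)
      also have "\<dots> \<le> (\<epsilon> * (t * (2 * norm a + norm b))) * (t * norm a)"
        using nR t \<open>0 < \<epsilon>\<close> by (intro mult_mono) auto
      finally show ?thesis .
    qed
    ultimately show "\<bar>f (v + t *\<^sub>R a + t *\<^sub>R b) - f (v + t *\<^sub>R a) - f (v + t *\<^sub>R b) + f v - t\<^sup>2 * (H b \<bullet> a)\<bar>
      \<le> \<epsilon> * t\<^sup>2 * ((2 * norm a + norm b) * norm a)"
      by (simp add: power2_eq_square algebra_simps)
  qed
qed

text \<open>The second difference is symmetric in \<open>a\<close> and \<open>b\<close>, and by
  \<open>second_difference_bound\<close> it approximates \<open>t\<^sup>2\<close> times either
  side.\<close>

lemma second_derivative_symmetric:
  fixes f :: "'a::real_inner \<Rightarrow> real"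
  assumes "0 < r" and f: "\<And>z. z \<in> ball v r \<Longrightarrow> (f has_derivative (\<lambda>u. L z \<bullet> u)) (at z)"
    and L: "(L has_derivative H) (at v)"
  shows "H a \<bullet> b = H b \<bullet> a"
proof -
  define C where "C = (2 * norm a + norm b) * norm a + (2 * norm b + norm a) * norm b"
  have C: "C \<ge> 0" by (simp add: C_def)
  have "\<bar>H a \<bullet> b - H b \<bullet> a\<bar> \<le> 0 + e" if e: "0 < e" for e
  proof -
    define \<epsilon> where "\<epsilon> = e / (C + 1)"
    have \<epsilon>: "\<epsilon> > 0" "\<epsilon> * C \<le> e" using C e by (auto simp: \<epsilon>_def field_simps)
    obtain d1 where d1: "d1 > 0" "\<forall>t. 0 < t \<and> t < d1 \<longrightarrow>
      \<bar>f (v + t *\<^sub>R a + t *\<^sub>R b) - f (v + t *\<^sub>R a) - f (v + t *\<^sub>R b) + f v - t\<^sup>2 * (H b \<bullet> a)\<bar>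
      \<le> \<epsilon> * t\<^sup>2 * ((2 * norm a + norm b) * norm a)"
      using second_difference_bound[OF assms \<epsilon>(1), of a b] by blast
    obtain d2 where d2: "d2 > 0" "\<forall>t. 0 < t \<and> t < d2 \<longrightarrow>
      \<bar>f (v + t *\<^sub>R b + t *\<^sub>R a) - f (v + t *\<^sub>R b) - f (v + t *\<^sub>R a) + f v - t\<^sup>2 * (H a \<bullet> b)\<bar>
      \<le> \<epsilon> * t\<^sup>2 * ((2 * norm b + norm a) * norm b)"
      using second_difference_bound[OF assms \<epsilon>(1), of b a] by blast
    define t where "t = min d1 d2 / 2"
    have t: "0 < t" "t < d1" "t < d2" using d1 d2 by (auto simp: t_def)
    have "\<bar>t\<^sup>2 * (H a \<bullet> b) - t\<^sup>2 * (H b \<bullet> a)\<bar> \<le> \<epsilon> * t\<^sup>2 * C"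
      using d1(2)[rule_format, of t] d2(2)[rule_format, of t] t
      unfolding C_def distrib_left by (simp add: add.commute add.left_commute)
    moreover have "\<bar>t\<^sup>2 * (H a \<bullet> b) - t\<^sup>2 * (H b \<bullet> a)\<bar> = t\<^sup>2 * \<bar>H a \<bullet> b - H b \<bullet> a\<bar>"
      unfolding right_diff_distrib[symmetric] abs_mult by simp
    ultimately have "t\<^sup>2 * \<bar>H a \<bullet> b - H b \<bullet> a\<bar> \<le> t\<^sup>2 * (\<epsilon> * C)"
      by (simp only: ac_simps)
    then show ?thesis using \<epsilon> t by simp
  qed
  then have "\<bar>H a \<bullet> b - H b \<bullet> a\<bar> \<le> 0" by (rule field_le_epsilon)
  then show ?thesis by simp
qed

section \<open>The Legendre transformation of a Minkowski norm\<close>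

text \<open>Holds everything up to semidefiniteness of the Hessian; the curvature condition is added
  in the locale \<open>minkowski\<close>. On a Finsler manifold the smoothness of \<open>N\<close>
  is inherited from that of \<open>F\<close>, see \<open>minkowski_fibre\<close>.\<close>

locale smooth_norm =
  fixes N :: "'e::euclidean_space \<Rightarrow> real"
  assumes norm: "is_norm N" and smooth: "smooth_on (UNIV - {0}) N"
begin

abbreviation "DN v \<equiv> \<D> N v"

text \<open>The Legendre transform represented by a vector, that is, the gradient of half the
  squared norm. This makes its derivative an endomorphism of one space; \<open>LL\<close> below
  returns to covectors.\<close>

definition L :: "'e \<Rightarrow> 'e" where
  "L v = (\<Sum>e\<in>Basis. legendre1 N v e *\<^sub>R e)"

text \<open>The Hessian of half the squared norm as an endomorphism: the product rule applied to the
  coordinates \<open>N z * DN z e\<close> of \<open>L z\<close>.\<close>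

definition H :: "'e \<Rightarrow> 'e \<Rightarrow> 'e" where
  "H v w = (\<Sum>e\<in>Basis. (DN v w * DN v e + N v * \<D> (\<lambda>z. DN z e) v w) *\<^sub>R e)"

lemma N_nonneg: "0 \<le> N v" and N_eq_0_iff: "N v = 0 \<longleftrightarrow> v = 0" and N_scale: "N (c *\<^sub>R v) = \<bar>c\<bar> * N v"
  and N_triangle: "N (v + w) \<le> N v + N w"
  using norm by (auto simp: is_norm_def)

lemma N_pos: "v \<noteq> 0 \<Longrightarrow> 0 < N v"
  using N_nonneg[of v] N_eq_0_iff[of v] by linarith

lemma N_zero [simp]: "N 0 = 0"
  by (simp add: N_eq_0_iff)

lemma N_minus: "N (- v) = N v"
  using N_scale[of "-1" v] by simp

lemma N_normalize: "v \<noteq> 0 \<Longrightarrow> N (v /\<^sub>R N v) = 1"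
  using N_pos[of v] by (simp add: N_scale)

lemma N_derivative: "v \<noteq> 0 \<Longrightarrow> (N has_derivative DN v) (at v)"
  by (rule smooth_on_has_derivative[OF smooth]) simp

lemma DN_linear: "v \<noteq> 0 \<Longrightarrow> linear (DN v)"
  using N_derivative has_derivative_linear by blast

lemma legendre1_eq: "v \<noteq> 0 \<Longrightarrow> legendre1 N v u = N v * DN v u"
proof -
  assume "v \<noteq> 0"
  then have "((\<lambda>w. (N w)\<^sup>2) has_derivative (\<lambda>u. 2 * (N v * DN v u))) (at v)"
    by (auto intro!: derivative_eq_intros N_derivative simp: ac_simps)
  then show ?thesis
    by (simp add: legendre1_def frechet_derivative_eqI)
qed

lemma L_inner: "v \<noteq> 0 \<Longrightarrow> L v \<bullet> u = N v * DN v u"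
proof -
  assume v: "v \<noteq> 0"
  have "L v \<bullet> u = (\<Sum>e\<in>Basis. (N v * DN v e) * (e \<bullet> u))"
    using v by (simp add: L_def inner_sum_left legendre1_eq)
  also have "\<dots> = N v * (\<Sum>e\<in>Basis. (u \<bullet> e) *\<^sub>R DN v e)"
    by (simp add: sum_distrib_left inner_commute ac_simps)
  also have "\<dots> = N v * DN v u"
    using linear_euclidean_sum[OF DN_linear[OF v], of u] by simp
  finally show ?thesis .
qed

lemma legendre1_L: "v \<noteq> 0 \<Longrightarrow> legendre1 N v u = L v \<bullet> u"
  by (simp add: legendre1_eq L_inner)

lemma E_derivative: "v \<noteq> 0 \<Longrightarrow> ((\<lambda>w. (N w)\<^sup>2 / 2) has_derivative (\<lambda>u. L v \<bullet> u)) (at v)"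
  by (auto intro!: derivative_eq_intros N_derivative simp: L_inner ac_simps)

lemma DN_e_derivative:
  "v \<noteq> 0 \<Longrightarrow> ((\<lambda>z. DN z e) has_derivative \<D> (\<lambda>z. DN z e) v) (at v)"
  by (rule smooth_on_has_derivative[OF smooth_on_frechet_derivative[OF smooth]]) simp

lemma L_derivative:
  assumes v: "v \<noteq> 0"
  shows "(L has_derivative H v) (at v)"
proof -
  have "((\<lambda>z. \<Sum>e\<in>Basis. (N z * DN z e) *\<^sub>R e) has_derivative H v) (at v)"
    unfolding H_def
  proof (intro has_derivative_sum has_derivative_scaleR_left)
    fix e :: 'e
    show "((\<lambda>z. N z * DN z e) has_derivative
        (\<lambda>w. DN v w * DN v e + N v * \<D> (\<lambda>z. DN z e) v w)) (at v)"
      by (auto intro!: derivative_eq_intros N_derivative[OF v] DN_e_derivative[OF v])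
  qed
  then show ?thesis
    by (rule has_derivative_transform_within_open[of _ _ _ _ "- {0}"])
       (use v in \<open>auto simp: L_def legendre1_eq\<close>)
qed

lemma H_linear: "v \<noteq> 0 \<Longrightarrow> linear (H v)"
  using L_derivative has_derivative_linear by blast

lemma continuous_on_H: "continuous_on ((- {0}) \<times> UNIV) (\<lambda>p. H (fst p) (snd p))"
proof -
  have c: "continuous_on (- {0}) (\<lambda>v. H v b)" for b
    unfolding H_def Compl_eq_Diff_UNIV
    by (intro continuous_intros smooth_on_continuous_on[OF smooth]
        smooth_on_continuous_on[OF smooth_on_frechet_derivative[OF smooth]]
        smooth_on_continuous_on[OF smooth_on_frechet_derivative[OF smooth_on_frechet_derivative[OF smooth]]])
  have "continuous_on ((- {0}) \<times> UNIV) (\<lambda>p. \<Sum>b\<in>Basis. (snd p \<bullet> b) *\<^sub>R H (fst p) b)"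
    by (intro continuous_intros continuous_on_compose2[OF c]) auto
  moreover have "(\<Sum>b\<in>Basis. (snd p \<bullet> b) *\<^sub>R H (fst p) b) = H (fst p) (snd p)" if "p \<in> (- {0}) \<times> UNIV" for p
  proof -
    have "fst p \<noteq> 0" using that by auto
    then show ?thesis by (rule linear_euclidean_sum[OF H_linear, symmetric])
  qed
  ultimately show ?thesis
    by (simp cong: continuous_on_cong)
qed

lemma continuous_on_L: "continuous_on (- {0}) L"
  by (intro continuous_at_imp_continuous_on ballI has_derivative_continuous[OF L_derivative]) auto

text \<open>By the triangle inequality the right difference quotients of \<open>N\<close> at
  \<open>v\<close> in direction \<open>w\<close> are at most \<open>N w\<close>.\<close>

lemma L_le: assumes v: "v \<noteq> 0" shows "L v \<bullet> w \<le> N v * N w"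
proof -
  have "((\<lambda>t. N (v + t *\<^sub>R w)) has_derivative (\<lambda>h. DN v (h *\<^sub>R w))) (at 0)"
    by (rule has_derivative_compose[of "\<lambda>t. v + t *\<^sub>R w" "\<lambda>h. h *\<^sub>R w" 0 UNIV N "DN v"])
       (auto intro!: derivative_eq_intros N_derivative v)
  then have "((\<lambda>t. N (v + t *\<^sub>R w)) has_real_derivative DN v w) (at 0)"
    using DN_linear[OF v] by (simp add: has_field_derivative_def linear_cmul mult.commute[of _ "DN v w"])
  then have "((\<lambda>t. (N (v + t *\<^sub>R w) - N v) / t) \<longlongrightarrow> DN v w) (at_right 0)"
    by (auto simp: DERIV_def intro: filterlim_mono[OF _ order.refl at_le])
  moreover have "eventually (\<lambda>t. (N (v + t *\<^sub>R w) - N v) / t \<le> N w) (at_right 0)"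
    unfolding eventually_at_right_field
  proof (intro exI[of _ 1] conjI allI impI)
    fix t :: real assume t: "0 < t" "t < 1"
    have "N (v + t *\<^sub>R w) \<le> N v + t * N w"
      using N_triangle[of v "t *\<^sub>R w"] t by (simp add: N_scale)
    then show "(N (v + t *\<^sub>R w) - N v) / t \<le> N w"
      using t by (simp add: field_simps)
  qed simp
  ultimately have "DN v w \<le> N w"
    by (rule tendsto_upperbound) simp
  then show ?thesis
    using N_nonneg[of v] v by (simp add: L_inner mult_left_mono)
qed

text \<open>The hypotheses say that \<open>z\<close> minimises \<open>(N w)\<^sup>2 / 2 - \<xi> \<bullet> w\<close>.\<close>

lemma L_eqI:
  assumes z: "z \<noteq> 0" and le: "\<And>u. \<xi> \<bullet> u \<le> N z * N u" and eq: "\<xi> \<bullet> z = (N z)\<^sup>2"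
  shows "L z = \<xi>"
proof -
  have "((\<lambda>w. (N w)\<^sup>2 / 2 - \<xi> \<bullet> w) has_derivative (\<lambda>u. L z \<bullet> u - \<xi> \<bullet> u)) (at z)"
    by (intro has_derivative_diff E_derivative z has_derivative_inner_right has_derivative_ident)
  moreover have "(N z)\<^sup>2 / 2 - \<xi> \<bullet> z \<le> (N w)\<^sup>2 / 2 - \<xi> \<bullet> w" for w
  proof -
    have "\<xi> \<bullet> w \<le> N z * N w" by (rule le)
    moreover have "N z * N w \<le> (N z)\<^sup>2 / 2 + (N w)\<^sup>2 / 2"
      using sum_squares_bound[of "N z" "N w"] by simp
    ultimately show ?thesis using eq by simp
  qed
  ultimately have "(\<lambda>u. L z \<bullet> u - \<xi> \<bullet> u) = (\<lambda>u. 0)"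
    by (intro differential_zero_maxmin[of z UNIV "\<lambda>w. (N w)\<^sup>2 / 2 - \<xi> \<bullet> w"]) auto
  then have "(L z - \<xi>) \<bullet> (L z - \<xi>) = 0"
    by (simp add: inner_diff_left fun_eq_iff)
  then show ?thesis by simp
qed

lemma DN_self: "v \<noteq> 0 \<Longrightarrow> DN v v = N v"
proof -
  assume v: "v \<noteq> 0"
  have "((\<lambda>t. N (t *\<^sub>R v)) has_derivative (\<lambda>h. DN v (h *\<^sub>R v))) (at 1)"
    by (rule has_derivative_compose[of "\<lambda>t. t *\<^sub>R v" "\<lambda>h. h *\<^sub>R v" 1 UNIV N "DN v"])
       (auto intro!: derivative_eq_intros N_derivative v)
  moreover have "((\<lambda>t. N (t *\<^sub>R v)) has_derivative (\<lambda>h. h * N v)) (at 1)"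
  proof (rule has_derivative_transform_within_open)
    show "((\<lambda>t. t * N v) has_derivative (\<lambda>h. h * N v)) (at 1)"
      by (auto intro!: derivative_eq_intros)
    show "open {0::real<..}" "(1::real) \<in> {0<..}" by auto
    show "t * N v = N (t *\<^sub>R v)" if "t \<in> {0<..}" for t
      using that by (simp add: N_scale)
  qed
  ultimately have "(\<lambda>h. DN v (h *\<^sub>R v)) = (\<lambda>h. h * N v)"
    by (rule has_derivative_unique)
  then show ?thesis by (metis mult_1 scaleR_one)
qed

lemma L_self: "v \<noteq> 0 \<Longrightarrow> L v \<bullet> v = (N v)\<^sup>2"
  by (simp add: L_inner DN_self power2_eq_square)

lemma L_nonzero: "v \<noteq> 0 \<Longrightarrow> L v \<noteq> 0"
  using L_self[of v] N_pos[of v] by auto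

text \<open>The scaled covector satisfies the minimality conditions of \<open>L_eqI\<close> at the
  scaled point.\<close>

lemma L_scale:
  assumes "v \<noteq> 0" "0 < c" shows "L (c *\<^sub>R v) = c *\<^sub>R L v"
proof (rule L_eqI)
  show "c *\<^sub>R v \<noteq> 0" using assms by simp
  show "(c *\<^sub>R L v) \<bullet> u \<le> N (c *\<^sub>R v) * N u" for u
    using L_le[OF assms(1), of u] assms(2) by (simp add: N_scale)
  show "(c *\<^sub>R L v) \<bullet> (c *\<^sub>R v) = (N (c *\<^sub>R v))\<^sup>2"
    using assms by (simp add: N_scale L_self power2_eq_square)
qed

text \<open>Differentiate \<open>L z \<bullet> z\<close>, once by the product rule and once as the
  squared norm.\<close>

lemma H_inner_self: "v \<noteq> 0 \<Longrightarrow> H v w \<bullet> v = L v \<bullet> w"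
proof -
  assume v: "v \<noteq> 0"
  have "((\<lambda>z. L z \<bullet> z) has_derivative (\<lambda>w. L v \<bullet> w + H v w \<bullet> v)) (at v)"
    using has_derivative_inner[OF L_derivative[OF v] has_derivative_ident] by simp
  moreover have "((\<lambda>z. L z \<bullet> z) has_derivative (\<lambda>w. 2 * (L v \<bullet> w))) (at v)"
  proof (rule has_derivative_transform_within_open)
    show "((\<lambda>z. 2 * ((N z)\<^sup>2 / 2)) has_derivative (\<lambda>w. 2 * (L v \<bullet> w))) (at v)"
      by (rule has_derivative_mult_right[OF E_derivative[OF v]])
    show "open (- {0 :: 'e})" "v \<in> - {0}" using v by auto
    show "2 * ((N z)\<^sup>2 / 2) = L z \<bullet> z" if "z \<in> - {0}" for z
      using that by (simp add: L_self)
  qed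
  ultimately have "(\<lambda>w. L v \<bullet> w + H v w \<bullet> v) = (\<lambda>w. 2 * (L v \<bullet> w))"
    by (rule has_derivative_unique)
  then have "L v \<bullet> w + H v w \<bullet> v = 2 * (L v \<bullet> w)" by (rule fun_cong)
  then show ?thesis by simp
qed

lemma H_symmetric:
  assumes v: "v \<noteq> 0" shows "H v a \<bullet> b = H v b \<bullet> a"
proof (rule second_derivative_symmetric[of "norm v" v "\<lambda>w. (N w)\<^sup>2 / 2" L])
  show "0 < norm v" using v by simp
  fix z assume "z \<in> ball v (norm v)"
  then have "z \<noteq> 0" by auto
  then show "((\<lambda>w. (N w)\<^sup>2 / 2) has_derivative (\<lambda>u. L z \<bullet> u)) (at z)"
    by (rule E_derivative)
qed (rule L_derivative[OF v])

lemma L_directional: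
  assumes v: "v \<noteq> 0" shows "((\<lambda>t. (L (v + t *\<^sub>R w) - L v) /\<^sub>R t) \<longlongrightarrow> H v w) (at_right 0)"
proof -
  have "((\<lambda>t. L (v + t *\<^sub>R w)) has_derivative (\<lambda>h. H v (h *\<^sub>R w))) (at 0)"
    by (rule has_derivative_compose[of "\<lambda>t. v + t *\<^sub>R w" "\<lambda>h. h *\<^sub>R w" 0 UNIV L "H v"])
       (auto intro!: derivative_eq_intros L_derivative v)
  then have "((\<lambda>t. norm (L (v + t *\<^sub>R w) - L v - H v (t *\<^sub>R w)) / norm t) \<longlongrightarrow> 0) (at 0)"
    unfolding has_derivative_at by simp
  moreover have "eventually (\<lambda>t. norm (L (v + t *\<^sub>R w) - L v - H v (t *\<^sub>R w)) / norm t
      = norm ((L (v + t *\<^sub>R w) - L v) /\<^sub>R t - H v w)) (at (0::real))"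
    unfolding eventually_at_filter
  proof (rule always_eventually, intro allI impI)
    fix t :: real assume t: "t \<noteq> 0"
    then have "(L (v + t *\<^sub>R w) - L v) /\<^sub>R t - H v w = (L (v + t *\<^sub>R w) - L v - H v (t *\<^sub>R w)) /\<^sub>R t"
      using H_linear[OF v] by (simp add: linear_cmul scaleR_diff_right)
    then show "norm (L (v + t *\<^sub>R w) - L v - H v (t *\<^sub>R w)) / norm t
      = norm ((L (v + t *\<^sub>R w) - L v) /\<^sub>R t - H v w)"
      by (simp add: divide_inverse mult.commute)
  qed
  ultimately have "((\<lambda>t. norm ((L (v + t *\<^sub>R w) - L v) /\<^sub>R t - H v w)) \<longlongrightarrow> 0) (at 0)"
    by (rule Lim_transform_eventually)
  then have "((\<lambda>t. (L (v + t *\<^sub>R w) - L v) /\<^sub>R t) \<longlongrightarrow> H v w) (at 0)"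
    by (rule LIM_zero_cancel[OF tendsto_norm_zero_cancel])
  then show ?thesis
    by (rule filterlim_mono[OF _ order.refl at_le]) simp
qed

text \<open>Sum of \<open>L_le\<close> at the two points, with the mixed term bounded by the sum of
  squares. It is the source of semidefiniteness of the Hessian.\<close>

lemma L_monotone:
  assumes "v \<noteq> 0" "w \<noteq> 0" shows "0 \<le> (L w - L v) \<bullet> (w - v)"
proof -
  have "L v \<bullet> w \<le> N v * N w" "L w \<bullet> v \<le> N w * N v"
    using L_le assms by auto
  moreover have "2 * (N v * N w) \<le> (N v)\<^sup>2 + (N w)\<^sup>2"
    using sum_squares_bound[of "N v" "N w"] by simp
  ultimately show ?thesis
    using L_self assms by (simp add: inner_diff_left inner_diff_right algebra_simps)
qed

lemma H_nonneg:
  assumes v: "v \<noteq> 0" shows "0 \<le> H v w \<bullet> w"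
proof -
  have "((\<lambda>t. ((L (v + t *\<^sub>R w) - L v) /\<^sub>R t) \<bullet> w) \<longlongrightarrow> H v w \<bullet> w) (at_right 0)"
    by (intro tendsto_inner L_directional v tendsto_const)
  moreover have "eventually (\<lambda>t. 0 \<le> ((L (v + t *\<^sub>R w) - L v) /\<^sub>R t) \<bullet> w) (at_right 0)"
  proof -
    have "((\<lambda>t. v + t *\<^sub>R w) \<longlongrightarrow> v + 0 *\<^sub>R w) (at_right 0)"
      by (intro tendsto_intros)
    then have "eventually (\<lambda>t. v + t *\<^sub>R w \<noteq> 0) (at_right 0)"
      using v by (intro tendsto_imp_eventually_ne) auto
    moreover have "eventually (\<lambda>t::real. 0 < t) (at_right 0)"
      by (simp add: eventually_at_right_less)
    ultimately show ?thesis
    proof eventually_elim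
      case (elim t)
      have "0 \<le> (L (v + t *\<^sub>R w) - L v) \<bullet> (t *\<^sub>R w)"
        using L_monotone[OF v elim(1)] by simp
      then have "0 \<le> (L (v + t *\<^sub>R w) - L v) \<bullet> w"
        using elim(2) by (simp add: zero_le_mult_iff)
      then show ?case using elim(2) by simp
    qed
  qed
  ultimately show ?thesis
    by (intro tendsto_lowerbound[of _ _ "at_right 0"]) auto
qed

text \<open>For a symmetric semidefinite form an isotropic vector lies in the kernel: otherwise the
  form would become negative on \<open>w\<close> plus a small negative multiple of its
  image.\<close>

lemma H_degenerate:
  assumes v: "v \<noteq> 0" and w: "H v w \<bullet> w = 0" shows "H v w = 0"
proof -
  let ?u = "H v w"
  have "0 \<le> t * (2 * (?u \<bullet> ?u)) + t\<^sup>2 * (H v ?u \<bullet> ?u)" for t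
  proof -
    have "0 \<le> H v (w + t *\<^sub>R ?u) \<bullet> (w + t *\<^sub>R ?u)"
      by (rule H_nonneg[OF v])
    also have "\<dots> = H v w \<bullet> w + t * (?u \<bullet> ?u) + t * (H v ?u \<bullet> w) + t\<^sup>2 * (H v ?u \<bullet> ?u)"
      using H_linear[OF v]
      by (simp add: linear_add linear_cmul inner_add_left inner_add_right power2_eq_square algebra_simps)
    also have "H v ?u \<bullet> w = ?u \<bullet> ?u"
      by (rule H_symmetric[OF v])
    finally show ?thesis using w by simp
  qed
  note q = this
  show ?thesis
  proof (rule ccontr)
    assume "?u \<noteq> 0"
    then have p: "?u \<bullet> ?u > 0" by simp
    define B where "B = H v ?u \<bullet> ?u"
    have B: "B \<ge> 0" unfolding B_def by (rule H_nonneg[OF v])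
    \<comment> \<open>Small enough for the linear term to dominate: the quadratic polynomial in
      \<open>t\<close> takes a negative value here for every \<open>B \<ge> 0\<close>.\<close>
    define t where "t = - (?u \<bullet> ?u) / (B + 1)"
    have "t * (2 * (?u \<bullet> ?u)) + t\<^sup>2 * B = - ((?u \<bullet> ?u)\<^sup>2 * (B + 2)) / (B + 1)\<^sup>2"
      using B by (simp add: t_def power2_eq_square divide_simps) (simp add: algebra_simps)
    also have "\<dots> < 0"
      using p B by (intro divide_neg_pos) auto
    finally show False using q[of t] by (simp add: B_def)
  qed
qed

end

section \<open>Consequences of positive curvature: definite Hessian and inverse Legendre
  transform\<close>

abbreviation tspace :: "'v::real_normed_vector set \<Rightarrow> 'v \<Rightarrow> 'v set" where
  "tspace \<equiv> tangent_space flat_chart"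

lemma velocity_at_flat:
  "velocity_at flat_chart S \<gamma> p w \<longleftrightarrow> \<gamma> 0 = p \<and> (\<forall>\<^sub>F t in nhds 0. \<gamma> t \<in> S) \<and>
    (\<gamma> has_vector_derivative w) (at 0)"
  by (simp add: velocity_at_def flat_chart_def)

lemma vector_derivative_compose:
  assumes "(\<gamma> has_vector_derivative w) (at t)" "(f has_derivative f') (at (\<gamma> t))"
  shows "((\<lambda>t. f (\<gamma> t)) has_vector_derivative f' w) (at t)"
proof -
  have "((\<lambda>t. f (\<gamma> t)) has_derivative (\<lambda>h. f' (h *\<^sub>R w))) (at t)"
    using has_derivative_compose[OF assms(1)[unfolded has_vector_derivative_def] assms(2)] .
  then show ?thesis
    using has_derivative_linear[OF assms(2)] by (simp add: has_vector_derivative_def linear_cmul)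
qed

locale minkowski = smooth_norm N for N :: "'e::euclidean_space \<Rightarrow> real" +
  assumes mink: "minkowski_norm N"
begin

lemma unit_nonzero: "N v = 1 \<Longrightarrow> v \<noteq> 0"
  by auto

lemma L_dot_curve:
  assumes v: "N v = 1" and \<gamma>: "\<gamma> 0 = v" "(\<gamma> has_vector_derivative w) (at 0)"
    and ev: "\<forall>\<^sub>F t in nhds 0. N (\<gamma> t) = 1"
  shows "L v \<bullet> w = 0"
proof -
  have "((\<lambda>t. (N (\<gamma> t))\<^sup>2 / 2) has_vector_derivative (L v \<bullet> w)) (at 0)"
    by (rule vector_derivative_compose[OF \<gamma>(2)])
       (use \<gamma>(1) unit_nonzero[OF v] E_derivative in auto)
  moreover have "((\<lambda>t. (N (\<gamma> t))\<^sup>2 / 2) has_vector_derivative 0) (at 0)"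
  proof -
    obtain S where S: "open S" "0 \<in> S" "\<And>t. t \<in> S \<Longrightarrow> N (\<gamma> t) = 1"
      using ev unfolding eventually_nhds by auto
    show ?thesis
      by (rule has_vector_derivative_transform_within_open[of "\<lambda>t. 1 / 2" _ _ S]) (use S in auto)
  qed
  ultimately show ?thesis
    by (rule vector_derivative_unique_at)
qed

text \<open>Normalising the line \<open>v + t *\<^sub>R w\<close> leaves its initial velocity
  unchanged, because the derivative of \<open>N\<close> at \<open>v\<close> vanishes on
  \<open>w\<close>.\<close>

lemma sphere_curve:
  assumes v: "N v = 1" and w: "L v \<bullet> w = 0"
  shows "velocity_at flat_chart (unit_sphere N) (\<lambda>t. (v + t *\<^sub>R w) /\<^sub>R N (v + t *\<^sub>R w)) v w"
proof -
  have v0: "v \<noteq> 0" by (rule unit_nonzero[OF v])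
  have lin: "((\<lambda>t. v + t *\<^sub>R w) has_vector_derivative w) (at 0)"
    by (auto intro!: derivative_eq_intros simp: has_vector_derivative_def)
  have "((\<lambda>z. z /\<^sub>R N z) has_derivative (\<lambda>h. h /\<^sub>R N v + (- (inverse (N v) * DN v h * inverse (N v))) *\<^sub>R v)) (at v)"
    using v v0 by (auto intro!: derivative_eq_intros N_derivative simp: algebra_simps)
  then have "((\<lambda>t. (v + t *\<^sub>R w) /\<^sub>R N (v + t *\<^sub>R w)) has_vector_derivative
      (w /\<^sub>R N v + (- (inverse (N v) * DN v w * inverse (N v))) *\<^sub>R v)) (at 0)"
    by (intro vector_derivative_compose[OF lin]) simp
  moreover have "DN v w = 0" using w v v0 by (simp add: L_inner)
  ultimately have "((\<lambda>t. (v + t *\<^sub>R w) /\<^sub>R N (v + t *\<^sub>R w)) has_vector_derivative w) (at 0)"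
    using v by simp
  moreover have "\<forall>\<^sub>F t in nhds 0. (v + t *\<^sub>R w) /\<^sub>R N (v + t *\<^sub>R w) \<in> unit_sphere N"
  proof -
    have "((\<lambda>t. v + t *\<^sub>R w) \<longlongrightarrow> v + 0 *\<^sub>R w) (nhds 0)"
      by (intro tendsto_intros) (simp add: filterlim_ident)
    then have "\<forall>\<^sub>F t in nhds 0. v + t *\<^sub>R w \<noteq> 0"
      using v0 by (intro tendsto_imp_eventually_ne) auto
    then show ?thesis
      by eventually_elim (simp add: unit_sphere_def N_normalize)
  qed
  ultimately show ?thesis
    using v by (simp add: velocity_at_flat)
qed

lemma tangent_space_sphere:
  assumes v: "N v = 1"
  shows "tspace (unit_sphere N) v = {w. L v \<bullet> w = 0}"
proof
  show "tspace (unit_sphere N) v \<subseteq> {w. L v \<bullet> w = 0}"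
    using L_dot_curve[OF v] by (auto simp: tangent_space_def velocity_at_flat unit_sphere_def)
  show "{w. L v \<bullet> w = 0} \<subseteq> tspace (unit_sphere N) v"
    using sphere_curve[OF v] by (auto simp: tangent_space_def)
qed

text \<open>The tangent space is the hyperplane orthogonal to \<open>L v\<close>. For uniqueness,
  the part of a candidate orthogonal to \<open>L v\<close> is tangent and so vanishes; length and
  the outward condition fix the remaining factor.\<close>

lemma outer_normal_eq:
  assumes v: "N v = 1"
  shows "outer_normal (\<bullet>) (unit_sphere N) v = L v /\<^sub>R norm (L v)"
  unfolding outer_normal_def tangent_space_sphere[OF v]
proof (rule the_equality)
  have L: "L v \<noteq> 0" "L v \<bullet> v = 1"
    using L_nonzero L_self unit_nonzero[OF v] v by auto
  define l where "l = L v /\<^sub>R norm (L v)"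
  have l: "l \<bullet> l = 1" "0 < l \<bullet> v" "L v = norm (L v) *\<^sub>R l"
    using L by (auto simp: l_def dot_square_norm power2_eq_square)
  then show "(L v /\<^sub>R norm (L v)) \<bullet> (L v /\<^sub>R norm (L v)) = 1 \<and>
    (\<forall>w\<in>{w. L v \<bullet> w = 0}. (L v /\<^sub>R norm (L v)) \<bullet> w = 0) \<and> 0 < (L v /\<^sub>R norm (L v)) \<bullet> v"
    by (simp add: l_def)
  fix \<nu> assume \<nu>: "\<nu> \<bullet> \<nu> = 1 \<and> (\<forall>w\<in>{w. L v \<bullet> w = 0}. \<nu> \<bullet> w = 0) \<and> 0 < \<nu> \<bullet> v"
  define c where "c = \<nu> \<bullet> l"
  have "l \<bullet> (\<nu> - c *\<^sub>R l) = 0"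
    using l by (simp add: inner_diff_right c_def inner_commute)
  then have "L v \<bullet> (\<nu> - c *\<^sub>R l) = 0"
    by (subst l(3)) simp
  then have "\<nu> \<bullet> (\<nu> - c *\<^sub>R l) = 0" using \<nu> by blast
  then have "(\<nu> - c *\<^sub>R l) \<bullet> (\<nu> - c *\<^sub>R l) = 0"
    using \<open>l \<bullet> (\<nu> - c *\<^sub>R l) = 0\<close> by (simp add: inner_diff_left)
  then have \<nu>l: "\<nu> = c *\<^sub>R l" by simp
  then have "c * c = 1" "0 < c * (l \<bullet> v)" using \<nu> l by auto
  then have "c = 1" using l(2) by (simp add: zero_less_mult_iff square_eq_1_iff)
  then show "\<nu> = L v /\<^sub>R norm (L v)" using \<nu>l by (simp add: l_def)
qed

text \<open>A degenerate direction of the Hessian would have principal curvature \<open>0\<close>.\<close>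

lemma H_injective_unit:
  assumes v: "N v = 1" and w: "H v w = 0"
  shows "w = 0"
proof (rule ccontr)
  assume "w \<noteq> 0"
  let ?\<gamma> = "\<lambda>t. (v + t *\<^sub>R w) /\<^sub>R N (v + t *\<^sub>R w)"
  have v0: "v \<noteq> 0" by (rule unit_nonzero[OF v])
  have "L v \<bullet> w = 0"
    using H_inner_self[OF v0, of w] w by simp
  then have \<gamma>: "velocity_at flat_chart (unit_sphere N) ?\<gamma> v w"
    by (rule sphere_curve[OF v])
  then have \<gamma>': "(?\<gamma> has_vector_derivative w) (at 0)" "\<forall>\<^sub>F t in nhds 0. N (?\<gamma> t) = 1"
    by (auto simp: velocity_at_flat unit_sphere_def)
  have Lv: "L v \<noteq> 0" by (rule L_nonzero[OF v0])
  have nd: "((\<lambda>z. norm (L z)) has_derivative (\<lambda>h. H v h \<bullet> sgn (L v))) (at v)"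
    by (rule has_derivative_compose[OF L_derivative[OF v0] has_derivative_norm[OF Lv]])
  have "((\<lambda>z. L z /\<^sub>R norm (L z)) has_derivative
     (\<lambda>h. H v h /\<^sub>R norm (L v) + (- (inverse (norm (L v)) * (H v h \<bullet> sgn (L v)) * inverse (norm (L v)))) *\<^sub>R L v)) (at v)"
    using Lv by (auto intro!: derivative_eq_intros L_derivative[OF v0] nd simp: algebra_simps)
  then have "((\<lambda>t. L (?\<gamma> t) /\<^sub>R norm (L (?\<gamma> t))) has_vector_derivative
      (H v w /\<^sub>R norm (L v) + (- (inverse (norm (L v)) * (H v w \<bullet> sgn (L v)) * inverse (norm (L v)))) *\<^sub>R L v)) (at 0)"
    using v by (intro vector_derivative_compose[OF \<gamma>'(1)]) simp
  then have d: "((\<lambda>t. L (?\<gamma> t) /\<^sub>R norm (L (?\<gamma> t))) has_vector_derivative 0 *\<^sub>R w) (at 0)"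
    by (simp add: w)
  obtain T where T: "open T" "0 \<in> T" "\<And>t. t \<in> T \<Longrightarrow> N (?\<gamma> t) = 1"
    using \<gamma>'(2) unfolding eventually_nhds by auto
  have "((\<lambda>t. outer_normal (\<bullet>) (unit_sphere N) (?\<gamma> t)) has_vector_derivative 0 *\<^sub>R w) (at 0)"
    by (rule has_vector_derivative_transform_within_open[OF d T(1,2)]) (rule outer_normal_eq[OF T(3), symmetric])
  then have "principal_curvature (\<bullet>) (unit_sphere N) v 0"
    using \<gamma> \<open>w \<noteq> 0\<close> unfolding principal_curvature_def by blast
  moreover have "euclidean_metric ((\<bullet>) :: 'e \<Rightarrow> 'e \<Rightarrow> real)"
    by (auto simp: euclidean_metric_def bilinear_def inner_commute intro: linearI inner_add_left inner_add_right)
  moreover have "v \<in> unit_sphere N" using v by (simp add: unit_sphere_def)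
  ultimately show False
    using mink unfolding minkowski_norm_def by (metis less_irrefl)
qed

lemma H_scale:
  assumes v: "v \<noteq> 0" and c: "0 < c" shows "H (c *\<^sub>R v) w = H v w"
proof -
  have cv: "c *\<^sub>R v \<noteq> 0" using assms by simp
  have "((\<lambda>z. L (c *\<^sub>R z)) has_derivative (\<lambda>h. H (c *\<^sub>R v) (c *\<^sub>R h))) (at v)"
    by (rule has_derivative_compose[OF has_derivative_scaleR_right[OF has_derivative_ident]])
       (rule L_derivative[OF cv])
  moreover have "((\<lambda>z. L (c *\<^sub>R z)) has_derivative (\<lambda>h. c *\<^sub>R H v h)) (at v)"
  proof (rule has_derivative_transform_within_open)
    show "((\<lambda>z. c *\<^sub>R L z) has_derivative (\<lambda>h. c *\<^sub>R H v h)) (at v)"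
      by (rule has_derivative_scaleR_right[OF L_derivative[OF v]])
    show "open (- {0 :: 'e})" "v \<in> - {0}" using v by auto
    show "c *\<^sub>R L z = L (c *\<^sub>R z)" if "z \<in> - {0}" for z
      using that c by (simp add: L_scale)
  qed
  ultimately have "(\<lambda>h. H (c *\<^sub>R v) (c *\<^sub>R h)) = (\<lambda>h. c *\<^sub>R H v h)"
    by (rule has_derivative_unique)
  then have "H (c *\<^sub>R v) (c *\<^sub>R w) = c *\<^sub>R H v w" by (rule fun_cong)
  then show ?thesis using H_linear[OF cv] c by (simp add: linear_cmul)
qed

lemma H_injective:
  assumes v: "v \<noteq> 0" and w: "H v w = 0" shows "w = 0"
proof (rule H_injective_unit)
  show "N (v /\<^sub>R N v) = 1" by (rule N_normalize[OF v])
  show "H (v /\<^sub>R N v) w = 0" using H_scale[OF v, of "inverse (N v)" w] N_pos[OF v] w by simp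
qed

lemma H_pos:
  assumes v: "v \<noteq> 0" and w: "w \<noteq> 0" shows "0 < H v w \<bullet> w"
  using H_nonneg[OF v, of w] H_degenerate[OF v, of w] H_injective[OF v, of w] w by fastforce

lemma H_inj: "v \<noteq> 0 \<Longrightarrow> inj (H v)"
  using H_injective H_linear linear_injective_0 by blast

lemma H_surj: "v \<noteq> 0 \<Longrightarrow> surj (H v)"
  using H_inj H_linear linear_injective_imp_surjective by blast

text \<open>Equal images force equal norms, and then every point of the segment from
  \<open>v\<close> to \<open>w\<close> satisfies the conditions of \<open>L_eqI\<close> for the same
  covector. So \<open>L\<close> is constant along the segment and
  \<open>H v (w - v) = 0\<close>.\<close>

lemma L_injective:
  assumes "v \<noteq> 0" "w \<noteq> 0" "L v = L w" shows "v = w"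
proof -
  define \<xi> where "\<xi> = L v"
  have \<xi>v: "\<xi> \<bullet> v = (N v)\<^sup>2" "\<xi> \<bullet> w = (N w)\<^sup>2"
    using L_self[OF assms(1)] L_self[OF assms(2)] assms(3) by (auto simp: \<xi>_def)
  have le: "\<xi> \<bullet> u \<le> N v * N u" "\<xi> \<bullet> u \<le> N w * N u" for u
    using L_le[OF assms(1), of u] L_le[OF assms(2), of u] assms(3) by (auto simp: \<xi>_def)
  have n: "N w = N v"
  proof (rule antisym)
    show "N w \<le> N v" using le(1)[of w] \<xi>v N_pos[OF assms(2)] by (simp add: power2_eq_square)
    show "N v \<le> N w" using le(2)[of v] \<xi>v N_pos[OF assms(1)] by (simp add: power2_eq_square)
  qed
  define n where "n = N v"
  have n0: "n > 0" using N_pos[OF assms(1)] by (simp add: n_def)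
  have seg: "L (v + t *\<^sub>R (w - v)) = \<xi>" if t: "0 \<le> t" "t \<le> 1" for t
  proof -
    let ?z = "v + t *\<^sub>R (w - v)"
    have \<xi>z: "\<xi> \<bullet> ?z = n\<^sup>2"
      using \<xi>v n by (simp add: inner_add_right inner_diff_right n_def)
    have "?z = (1 - t) *\<^sub>R v + t *\<^sub>R w" by (simp add: algebra_simps)
    then have "N ?z \<le> (1 - t) * N v + t * N w"
      using N_triangle[of "(1 - t) *\<^sub>R v" "t *\<^sub>R w"] t by (simp add: N_scale)
    also have "\<dots> = n" using n by (simp add: n_def algebra_simps)
    finally have "N ?z \<le> n" .
    moreover have "n\<^sup>2 \<le> n * N ?z" using le(1)[of ?z] \<xi>z by (simp add: n_def)
    then have "n \<le> N ?z" using n0 by (simp add: power2_eq_square)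
    ultimately have Nz: "N ?z = n" by simp
    then have "?z \<noteq> 0" using n0 by auto
    then show "L ?z = \<xi>"
      using \<xi>z Nz le(1) by (intro L_eqI) (auto simp: n_def)
  qed
  have "\<forall>\<^sub>F t in at_right 0. (L (v + t *\<^sub>R (w - v)) - L v) /\<^sub>R t = 0"
    unfolding eventually_at_right_field
    by (intro exI[of _ 1]) (use seg in \<open>auto simp: \<xi>_def\<close>)
  then have "((\<lambda>t. (L (v + t *\<^sub>R (w - v)) - L v) /\<^sub>R t) \<longlongrightarrow> 0) (at_right 0)"
    by (rule tendsto_eventually)
  then have "H v (w - v) = 0"
    using L_directional[OF assms(1), of "w - v"] tendsto_unique trivial_limit_at_right_real by blast
  then show ?thesis
    using H_injective[OF assms(1)] by fastforce
qed

lemma L_inj_on: "inj_on L (- {0})"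
  using L_injective by (auto simp: inj_on_def)

definition G :: "'e \<Rightarrow> 'e" where "G = inv_into (- {0}) L"

lemma G_L: "v \<noteq> 0 \<Longrightarrow> G (L v) = v"
  unfolding G_def by (rule inv_into_f_f[OF L_inj_on]) simp

definition K :: "'e \<Rightarrow> 'e \<Rightarrow> 'e" where "K v = inv_into UNIV (H v)"

lemma H_K: "v \<noteq> 0 \<Longrightarrow> H v (K v \<eta>) = \<eta>"
  unfolding K_def by (rule surj_f_inv_f[OF H_surj])

lemma G_derivative:
  assumes v: "v \<noteq> 0" shows "(G has_derivative K v) (at (L v))"
proof (rule has_derivative_inverse_strong[of "- {0}" v L])
  show "open (- {0 :: 'e})" "v \<in> - {0}" using v by auto
  show "continuous_on (- {0}) L" by (rule continuous_on_L)
  show "G (L x) = x" if "x \<in> - {0}" for x using that by (simp add: G_L)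
  show "(L has_derivative H v) (at v)" by (rule L_derivative[OF v])
  show "H v \<circ> K v = id" using H_K[OF v] by (simp add: fun_eq_iff)
qed

text \<open>The map sending \<open>(v, w)\<close> to \<open>(v, H v w)\<close> is continuous and
  injective on an open set, hence a homeomorphism onto its image by invariance of domain.
  \<open>K\<close> is the second component of its inverse.\<close>

lemma continuous_on_K: "continuous_on ((- {0}) \<times> UNIV) (\<lambda>p. K (fst p) (snd p))"
proof -
  let ?\<Phi> = "\<lambda>p. (fst p, H (fst p) (snd p))" and ?S = "(- {0 :: 'e}) \<times> (UNIV :: 'e set)"
  have c: "continuous_on ?S ?\<Phi>"
    by (intro continuous_intros continuous_on_H)
  have inj: "inj_on ?\<Phi> ?S"
  proof (rule inj_onI)
    fix p q assume p: "p \<in> ?S" and e: "?\<Phi> p = ?\<Phi> q"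
    have 1: "fst p = fst q" and 2: "fst p \<noteq> 0" using p e by auto
    have "H (fst p) (snd p) = H (fst p) (snd q)" using e 1 by simp
    then have "snd p = snd q" by (rule injD[OF H_inj[OF 2]])
    with 1 show "p = q" by (rule prod_eqI)
  qed
  have o: "open ?S" by (intro open_Times) auto
  obtain \<Psi> where "homeomorphism ?S (?\<Phi> ` ?S) ?\<Phi> \<Psi>"
    by (rule invariance_of_domain_homeomorphism[OF o c order.refl inj])
  then have \<Psi>: "continuous_on (?\<Phi> ` ?S) \<Psi>" "\<And>p. p \<in> ?S \<Longrightarrow> \<Psi> (?\<Phi> p) = p"
    by (rule homeomorphism_cont2, rule homeomorphism_apply1)
  have *: "?\<Phi> (fst p, K (fst p) (snd p)) = p" "(fst p, K (fst p) (snd p)) \<in> ?S" if "p \<in> ?S" for p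
    using that H_K[of "fst p" "snd p"] by (cases p, simp)+
  have "?S \<subseteq> ?\<Phi> ` ?S"
  proof
    fix p assume p: "p \<in> ?S"
    show "p \<in> ?\<Phi> ` ?S"
      using imageI[OF *(2)[OF p], of ?\<Phi>] unfolding *(1)[OF p] .
  qed
  then have "continuous_on ?S (\<lambda>p. snd (\<Psi> p))"
    by (intro continuous_on_snd continuous_on_subset[OF \<Psi>(1)])
  moreover have "snd (\<Psi> p) = K (fst p) (snd p)" if "p \<in> ?S" for p
    using \<Psi>(2)[OF *(2)[OF that]] unfolding *(1)[OF that] by simp
  ultimately show ?thesis
    by (rule continuous_on_eq)
qed

end

section \<open>Change of variables for integrals over submanifolds\<close>

lemma tangent_space_map:
  assumes f: "(f has_derivative f') (at p)" "f ` S \<subseteq> T" and w: "w \<in> tspace S p"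
  shows "f' w \<in> tspace T (f p)"
proof -
  obtain \<gamma> where \<gamma>: "\<gamma> 0 = p" "\<forall>\<^sub>F t in nhds 0. \<gamma> t \<in> S" "(\<gamma> has_vector_derivative w) (at 0)"
    using w by (auto simp: tangent_space_def velocity_at_flat)
  have "((\<lambda>t. f (\<gamma> t)) has_vector_derivative f' w) (at 0)"
    using \<gamma> f by (intro vector_derivative_compose[OF \<gamma>(3)]) auto
  moreover have "\<forall>\<^sub>F t in nhds 0. f (\<gamma> t) \<in> T"
    using \<gamma>(2) by eventually_elim (use f(2) in auto)
  ultimately show ?thesis
    using \<gamma>(1) by (auto simp: tangent_space_def velocity_at_flat intro!: exI[of _ "\<lambda>t. f (\<gamma> t)"])
qed

text \<open>Lets a partial derivative be read as the velocity of a curve inside the patch. Points of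
  \<open>Rn m\<close> are extensional, and changing a coordinate below \<open>m\<close> preserves
  this.\<close>

lemma param_patch_coordinate_line:
  assumes D: "openin (Rn m) D" and t: "t \<in> D" and i: "i < m"
  shows "\<exists>U. open U \<and> t i \<in> U \<and> (\<forall>s\<in>U. t(i := s) \<in> D)"
proof -
  have ext: "t \<in> extensional {..<m}"
    using openin_subset[OF D] t by (auto simp: PiE_def)
  have "continuous_map euclideanreal (Rn m) (\<lambda>s. t(i := s))"
    unfolding continuous_map_componentwise
  proof (intro conjI ballI)
    show "(\<lambda>s. t(i := s)) ` topspace euclideanreal \<subseteq> extensional {..<m}"
      using ext i by (auto simp: extensional_def)
    show "continuous_map euclideanreal euclideanreal (\<lambda>s. (t(i := s)) l)" for l
      by (cases "l = i") auto
  qed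
  then have "openin euclideanreal {s \<in> topspace euclideanreal. t(i := s) \<in> D}"
    by (rule openin_continuous_map_preimage[OF _ D])
  then have "open {s. t(i := s) \<in> D}" by simp
  then show ?thesis
    using t by (intro exI[of _ "{s. t(i := s) \<in> D}"]) auto
qed

lemma partial_has_derivative:
  assumes "(\<lambda>s. g (t(i := s))) differentiable at (t i)"
  shows "((\<lambda>s. g (t(i := s))) has_vector_derivative partial g t i) (at (t i))"
  using assms by (simp add: partial_def vector_derivative_works)

lemma partial_tangent:
  assumes p: "param_patch m S D g" and t: "t \<in> D" and i: "i < m"
  shows "partial g t i \<in> tspace S (g t)"
proof -
  have gS: "g ` D \<subseteq> S"
    using p openin_subset[of "top_of_set S" "g ` D"] by (simp add: param_patch_def)
  obtain U where U: "open U" "t i \<in> U" "\<And>s. s \<in> U \<Longrightarrow> t(i := s) \<in> D"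
    using param_patch_coordinate_line[OF _ t i] p by (auto simp: param_patch_def)
  have d: "((\<lambda>s. g (t(i := s))) has_vector_derivative partial g t i) (at (t i + 0))"
    using p t i by (simp add: partial_has_derivative param_patch_def)
  have sh: "((\<lambda>s. t i + s) has_vector_derivative 1) (at 0)"
    by (auto intro!: derivative_eq_intros)
  have "((\<lambda>s. g (t(i := t i + s))) has_vector_derivative partial g t i) (at 0)"
    using vector_diff_chain_at[OF sh d] by (simp add: o_def)
  moreover have "\<forall>\<^sub>F s in nhds 0. g (t(i := t i + s)) \<in> S"
  proof -
    have "((\<lambda>s. t i + s) \<longlongrightarrow> t i + 0) (nhds 0)"
      by (intro tendsto_intros) (simp add: filterlim_ident)
    then have "\<forall>\<^sub>F s in nhds 0. t i + s \<in> U"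
      using U by (auto intro: topological_tendstoD)
    then show ?thesis
      by eventually_elim (use U gS in auto)
  qed
  ultimately show ?thesis
    by (auto simp: tangent_space_def velocity_at_flat intro!: exI[of _ "\<lambda>s. g (t(i := t i + s))"])
qed

lemma homeomorphism_imp_homeomorphic_map:
  assumes "homeomorphism S T f g"
  shows "homeomorphic_map (top_of_set S) (top_of_set T) f"
  unfolding homeomorphic_map_maps homeomorphic_maps_def
  using assms by (intro exI[of _ g]) (auto simp: homeomorphism_def continuous_map_in_subtopology)

lemma closure_homeomorphism_image:
  fixes \<psi> :: "'a::metric_space \<Rightarrow> 'b::metric_space"
  assumes \<psi>: "continuous_on T \<psi>" and A: "A \<subseteq> T" and p: "p \<in> T" "p \<in> closure A"
  shows "\<psi> p \<in> closure (\<psi> ` A)"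
proof -
  obtain x where x: "\<And>n. x n \<in> A" "x \<longlonglongrightarrow> p"
    using p(2) unfolding closure_sequential by auto
  then have "(\<psi> \<circ> x) \<longlonglongrightarrow> \<psi> p"
    using \<psi> p(1) A unfolding continuous_on_sequentially by blast
  then show ?thesis
    unfolding closure_sequential using x(1) by (intro exI[of _ "\<psi> \<circ> x"]) auto
qed

text \<open>The derivative is taken in the ambient space at the points of \<open>S\<close>, so
  partial derivatives of a patch transform by the ordinary chain rule. Joint continuity of
  \<open>\<phi>'\<close> keeps the transformed partial derivatives continuous; its injectivity keeps
  them independent.\<close>

locale diffeo =
  fixes S :: "'v::real_normed_vector set" and T :: "'w::real_normed_vector set"
    and \<phi> :: "'v \<Rightarrow> 'w" and \<psi> :: "'w \<Rightarrow> 'v" and \<phi>' :: "'v \<Rightarrow> 'v \<Rightarrow> 'w"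
  assumes hom: "homeomorphism S T \<phi> \<psi>"
    and der: "\<And>v. v \<in> S \<Longrightarrow> (\<phi> has_derivative \<phi>' v) (at v)"
    and inj: "\<And>v w. v \<in> S \<Longrightarrow> \<phi>' v w = 0 \<Longrightarrow> w = 0"
    and cont: "continuous_on (S \<times> UNIV) (\<lambda>p. \<phi>' (fst p) (snd p))"
begin

lemma linear: "v \<in> S \<Longrightarrow> linear (\<phi>' v)"
  using der has_derivative_linear by blast

lemma
  assumes p: "param_patch m S D g"
  shows param_patch_subset: "g ` D \<subseteq> S"
    and param_patch_partial: "\<lbrakk>t \<in> D; i < m\<rbrakk> \<Longrightarrow>
      ((\<lambda>s. \<phi> (g (t(i := s)))) has_vector_derivative \<phi>' (g t) (partial g t i)) (at (t i))"
proof -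
  show gS: "g ` D \<subseteq> S"
    using p openin_subset[of "top_of_set S" "g ` D"] by (simp add: param_patch_def)
  show "((\<lambda>s. \<phi> (g (t(i := s)))) has_vector_derivative \<phi>' (g t) (partial g t i)) (at (t i))"
    if "t \<in> D" "i < m"
  proof (rule vector_derivative_compose[where \<gamma> = "\<lambda>s. g (t(i := s))" and f = \<phi>])
    show "((\<lambda>s. g (t(i := s))) has_vector_derivative partial g t i) (at (t i))"
      using p that by (intro partial_has_derivative) (simp add: param_patch_def)
    show "(\<phi> has_derivative \<phi>' (g t)) (at (g (t(i := t i))))"
      using der gS that by auto
  qed
qed

lemma partial_compose:
  assumes "param_patch m S D g" "t \<in> D" "i < m"
  shows "partial (\<lambda>t. \<phi> (g t)) t i = \<phi>' (g t) (partial g t i)"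
  using param_patch_partial[OF assms] by (simp add: partial_def vector_derivative_at)

lemma param_patch_transport:
  assumes p: "param_patch m S D g"
  shows "param_patch m T D (\<lambda>t. \<phi> (g t))"
  unfolding param_patch_def
proof (intro conjI allI impI ballI)
  note gS = param_patch_subset[OF p]
  have img: "(\<lambda>t. \<phi> (g t)) ` D = \<phi> ` g ` D" by auto
  show D: "openin (Rn m) D" using p by (simp add: param_patch_def)
  show "openin (top_of_set T) ((\<lambda>t. \<phi> (g t)) ` D)"
    unfolding img using p by (intro homeomorphism_imp_open_map[OF hom]) (simp add: param_patch_def)
  have "homeomorphism (g ` D) (\<phi> ` g ` D) \<phi> \<psi>"
    by (rule homeomorphism_of_subsets[OF hom gS]) (use hom gS in \<open>auto simp: homeomorphism_def\<close>)
  then have "homeomorphic_map (top_of_set (g ` D)) (top_of_set (\<phi> ` g ` D)) \<phi>"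
    by (rule homeomorphism_imp_homeomorphic_map)
  moreover have "homeomorphic_map (subtopology (Rn m) D) (top_of_set (g ` D)) g"
    using p by (simp add: param_patch_def)
  ultimately show "homeomorphic_map (subtopology (Rn m) D) (top_of_set ((\<lambda>t. \<phi> (g t)) ` D)) (\<lambda>t. \<phi> (g t))"
    unfolding img using homeomorphic_map_compose by (force simp: o_def)
  have topD: "topspace (subtopology (Rn m) D) = D"
    using openin_subset[OF D] by (simp add: inf.absorb2)
  fix i assume i: "i < m"
  show "(\<lambda>s. \<phi> (g (t(i := s)))) differentiable at (t i)" if "t \<in> D" for t
    using param_patch_partial[OF p that i] by (auto intro: differentiableI_vector)
  have "continuous_map (subtopology (Rn m) D) (top_of_set (g ` D)) g"
    using p by (simp add: param_patch_def homeomorphic_imp_continuous_map)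
  then have "continuous_map (subtopology (Rn m) D) euclidean g"
    using continuous_map_in_subtopology by blast
  moreover have "continuous_map (subtopology (Rn m) D) euclidean (\<lambda>t. partial g t i)"
    using p i by (simp add: param_patch_def)
  ultimately have "continuous_map (subtopology (Rn m) D) euclidean (\<lambda>t. (g t, partial g t i))"
    unfolding prod_topology_euclidean[symmetric] by (rule continuous_map_pairedI)
  then have "continuous_map (subtopology (Rn m) D) (top_of_set (S \<times> UNIV)) (\<lambda>t. (g t, partial g t i))"
    using gS topD by (auto simp: continuous_map_in_subtopology)
  then have "continuous_map (subtopology (Rn m) D) euclidean
      ((\<lambda>p. \<phi>' (fst p) (snd p)) \<circ> (\<lambda>t. (g t, partial g t i)))"
    by (rule continuous_map_compose) (simp add: cont)
  then show "continuous_map (subtopology (Rn m) D) euclidean (\<lambda>t. partial (\<lambda>t. \<phi> (g t)) t i)"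
    by (rule continuous_map_eq) (use partial_compose[OF p _ i] topD in auto)
next
  fix t c i assume t: "t \<in> D" and s: "(\<Sum>i<m. c i *\<^sub>R partial (\<lambda>t. \<phi> (g t)) t i) = 0" and i: "i < m"
  have gt: "g t \<in> S" using param_patch_subset[OF p] t by auto
  have "\<phi>' (g t) (\<Sum>i<m. c i *\<^sub>R partial g t i) = (\<Sum>i<m. c i *\<^sub>R partial (\<lambda>t. \<phi> (g t)) t i)"
    using partial_compose[OF p t] linear[OF gt] by (simp add: linear_sum linear_cmul)
  then have "(\<Sum>i<m. c i *\<^sub>R partial g t i) = 0"
    using inj[OF gt] s by simp
  then show "c i = 0"
    using p t i by (simp add: param_patch_def)
qed

text \<open>The domains \<open>D j\<close> are kept, the parametrisations are composed with
  \<open>\<phi>\<close> and the weights with \<open>\<psi>\<close>. Hence the integrals compare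
  pointwise, and \<open>form\<close> has to be checked only on independent tangent vectors.\<close>

lemma has_form_integral_transport:
  assumes form: "\<And>v \<tau> \<tau>'. \<lbrakk>v \<in> S; \<And>i. i < m \<Longrightarrow> \<tau> i \<in> tspace S v;
      \<And>c. (\<Sum>i<m. c i *\<^sub>R \<tau> i) = 0 \<Longrightarrow> \<forall>i<m. c i = 0; \<And>i. i < m \<Longrightarrow> \<tau>' i = \<phi>' v (\<tau> i)\<rbrakk> \<Longrightarrow>
      ori' (\<phi> v) \<tau>' * \<eta>' (\<phi> v) \<tau>' = C * (ori v \<tau> * \<eta> v \<tau>)"
    and I: "has_form_integral m S ori \<eta> I"
  shows "has_form_integral m T ori' \<eta>' (C * I)"
proof -
  obtain N D g \<rho> where p: "\<And>j. j < (N::nat) \<Longrightarrow> param_patch m S (D j) (g j)"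
    and \<rho>: "\<And>j. j < N \<Longrightarrow> continuous_on S (\<rho> j)" "\<And>j p. j < N \<Longrightarrow> p \<in> S \<Longrightarrow> 0 \<le> \<rho> j p"
      "\<And>j. j < N \<Longrightarrow> S \<inter> closure {p\<in>S. \<rho> j p \<noteq> 0} \<subseteq> g j ` D j" "\<And>p. p \<in> S \<Longrightarrow> (\<Sum>j<N. \<rho> j p) = (1::real)"
    and I_eq: "I = (\<Sum>j<N. LINT t:D j|Rn_lborel m.
               \<rho> j (g j t) * ori (g j t) (partial (g j) t) * \<eta> (g j t) (partial (g j) t))"
    using I unfolding has_form_integral_def by blast
  have h: "\<phi> ` S = T" "\<psi> ` T = S" "\<And>v. v \<in> S \<Longrightarrow> \<psi> (\<phi> v) = v" "\<And>p. p \<in> T \<Longrightarrow> \<phi> (\<psi> p) = p"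
    "continuous_on T \<psi>"
    using hom by (auto simp: homeomorphism_def)
  have \<psi>T: "\<psi> p \<in> S" if "p \<in> T" for p using h that by auto
  let ?old = "\<lambda>j t. \<rho> j (g j t) * ori (g j t) (partial (g j) t) * \<eta> (g j t) (partial (g j) t)"
  let ?new = "\<lambda>j t. \<rho> j (\<psi> (\<phi> (g j t))) *
    ori' (\<phi> (g j t)) (partial (\<lambda>t. \<phi> (g j t)) t) * \<eta>' (\<phi> (g j t)) (partial (\<lambda>t. \<phi> (g j t)) t)"
  show ?thesis
    unfolding has_form_integral_def
  proof (intro exI[of _ N] exI[of _ D] exI[of _ "\<lambda>j t. \<phi> (g j t)"] exI[of _ "\<lambda>j p. \<rho> j (\<psi> p)"] conjI allI impI ballI)
    fix j assume j: "j < N"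
    show "param_patch m T (D j) (\<lambda>t. \<phi> (g j t))"
      by (rule param_patch_transport[OF p[OF j]])
    show "continuous_on T (\<lambda>p. \<rho> j (\<psi> p))"
      by (rule continuous_on_compose2[OF \<rho>(1)[OF j] h(5)]) (use h in auto)
    show "0 \<le> \<rho> j (\<psi> p)" if "p \<in> T" for p
      by (rule \<rho>(2)[OF j \<psi>T[OF that]])
    show "T \<inter> closure {p \<in> T. \<rho> j (\<psi> p) \<noteq> 0} \<subseteq> (\<lambda>t. \<phi> (g j t)) ` D j"
    proof
      fix p assume p: "p \<in> T \<inter> closure {p \<in> T. \<rho> j (\<psi> p) \<noteq> 0}"
      then have "\<psi> p \<in> closure (\<psi> ` {p \<in> T. \<rho> j (\<psi> p) \<noteq> 0})"
        by (intro closure_homeomorphism_image[OF h(5)]) auto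
      moreover have "\<psi> ` {p \<in> T. \<rho> j (\<psi> p) \<noteq> 0} \<subseteq> {p \<in> S. \<rho> j p \<noteq> 0}"
        using \<psi>T by auto
      ultimately have "\<psi> p \<in> closure {p \<in> S. \<rho> j p \<noteq> 0}"
        using closure_mono by blast
      then have "\<psi> p \<in> g j ` D j" using \<rho>(3)[OF j] \<psi>T p by blast
      then obtain t where "t \<in> D j" "\<psi> p = g j t" by auto
      then show "p \<in> (\<lambda>t. \<phi> (g j t)) ` D j" using h(4)[of p] p by auto
    qed
  next
    show "(\<Sum>j<N. \<rho> j (\<psi> p)) = 1" if "p \<in> T" for p
      by (rule \<rho>(4)[OF \<psi>T[OF that]])
  next
    have "C * (LINT t:D j|Rn_lborel m. ?old j t)
      = (LINT t:D j|Rn_lborel m. ?new j t)"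
      if j: "j < N" for j
    proof -
      have "?new j t
        = C * (?old j t)" if t: "t \<in> D j" for t
      proof -
        have gt: "g j t \<in> S" using param_patch_subset[OF p[OF j]] t by auto
        have "ori' (\<phi> (g j t)) (partial (\<lambda>t. \<phi> (g j t)) t) * \<eta>' (\<phi> (g j t)) (partial (\<lambda>t. \<phi> (g j t)) t)
          = C * (ori (g j t) (partial (g j) t) * \<eta> (g j t) (partial (g j) t))"
        proof (rule form[OF gt])
          show "partial (g j) t i \<in> tspace S (g j t)" if "i < m" for i
            by (rule partial_tangent[OF p[OF j] t that])
          show "\<forall>i<m. c i = 0" if "(\<Sum>i<m. c i *\<^sub>R partial (g j) t i) = 0" for c
            using p[OF j] t that by (auto simp: param_patch_def)
          show "partial (\<lambda>t. \<phi> (g j t)) t i = \<phi>' (g j t) (partial (g j) t i)" if "i < m" for i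
            by (rule partial_compose[OF p[OF j] t that])
        qed
        then show ?thesis using h(3)[OF gt] by (simp add: mult.assoc mult.left_commute)
      qed
      then have "(\<lambda>t. indicator (D j) t *\<^sub>R (?new j t))
        = (\<lambda>t. C * (indicator (D j) t *\<^sub>R (?old j t)))"
        by (intro ext) (auto simp only: indicator_def of_bool_def if_True if_False scaleR_one scaleR_zero_left mult_zero_right split: if_split)
      \<comment> \<open>A constant factor leaves the Bochner integral whether or not the integrand
        is integrable.\<close>
      then show ?thesis
        by (simp only: set_lebesgue_integral_def integral_mult_right_zero)
    qed
    then show "C * I = (\<Sum>j<N. LINT t:D j|Rn_lborel m. ?new j t)"
      unfolding I_eq sum_distrib_left by (intro sum.cong) auto
  qed
qed

end

text \<open>Since \<open>form_integral\<close> is 0 unless the value is unique, both implications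
  are used: together they transfer uniqueness, and its failure, between the two sides.\<close>

lemma form_integral_scale:
  assumes "C \<noteq> 0" and iff: "\<And>I. has_form_integral m S ori \<eta> I \<Longrightarrow> has_form_integral m' T ori' \<eta>' (C * I)"
    "\<And>I. has_form_integral m' T ori' \<eta>' I \<Longrightarrow> has_form_integral m S ori \<eta> (I / C)"
  shows "form_integral m' T ori' \<eta>' = C * form_integral m S ori \<eta>"
proof (cases "\<exists>!I. has_form_integral m S ori \<eta> I")
  case True
  then obtain I where I: "has_form_integral m S ori \<eta> I" "\<And>J. has_form_integral m S ori \<eta> J \<Longrightarrow> J = I"
    by auto
  have CI: "has_form_integral m' T ori' \<eta>' (C * I)" by (rule iff(1)[OF I(1)])
  have un: "J = C * I" if "has_form_integral m' T ori' \<eta>' J" for J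
    using I(2)[OF iff(2)[OF that]] \<open>C \<noteq> 0\<close> by (simp add: field_simps)
  have "\<exists>!J. has_form_integral m' T ori' \<eta>' J" using CI un by blast
  moreover have "(THE J. has_form_integral m' T ori' \<eta>' J) = C * I" using CI un by (rule the_equality)
  moreover have "(THE J. has_form_integral m S ori \<eta> J) = I" using I by (rule the_equality)
  ultimately show ?thesis using True by (simp add: form_integral_def)
next
  case False
  have "\<not> (\<exists>!J. has_form_integral m' T ori' \<eta>' J)"
  proof
    assume "\<exists>!J. has_form_integral m' T ori' \<eta>' J"
    then obtain J where J: "has_form_integral m' T ori' \<eta>' J" "\<And>I. has_form_integral m' T ori' \<eta>' I \<Longrightarrow> I = J"
      by auto
    have "I = J / C" if "has_form_integral m S ori \<eta> I" for I
      using J(2)[OF iff(1)[OF that]] \<open>C \<noteq> 0\<close> by (simp add: field_simps)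
    then show False using False iff(2)[OF J(1)] by blast
  qed
  then show ?thesis using False by (simp add: form_integral_def)
qed

definition riesz :: "('e::euclidean_space \<Rightarrow>\<^sub>L real) \<Rightarrow> 'e" where
  "riesz \<xi> = (\<Sum>e\<in>Basis. \<xi> e *\<^sub>R e)"

lemma riesz_inner: "riesz \<xi> \<bullet> u = \<xi> u"
proof -
  have "riesz \<xi> \<bullet> u = (\<Sum>e\<in>Basis. (u \<bullet> e) *\<^sub>R \<xi> e)"
    by (simp add: riesz_def inner_sum_left) (simp add: inner_commute mult.commute)
  also have "\<dots> = \<xi> u"
    by (rule linear_euclidean_sum[symmetric]) (simp add: blinfun.bounded_linear_right bounded_linear.linear)
  finally show ?thesis .
qed

lemma blinfun_inner_riesz: "blinfun_inner_right (riesz \<xi>) = \<xi>"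
  by (rule blinfun_eqI) (simp add: riesz_inner)

lemma riesz_blinfun_inner: "riesz (blinfun_inner_right a) = a"
  by (rule euclidean_eqI) (simp add: riesz_inner)

lemma bounded_linear_riesz: "bounded_linear (riesz :: _ \<Rightarrow> 'e::euclidean_space)"
  unfolding riesz_def
  by (intro bounded_linear_sum bounded_linear_scaleR_const blinfun.bounded_linear_left)

section \<open>The dual ball and the dual sphere\<close>

context smooth_norm
begin

lemma N_le_norm: "\<exists>C>0. \<forall>v. N v \<le> C * norm v"
proof -
  define C where "C = (\<Sum>e\<in>Basis. N e) + 1"
  have C: "C > 0" using N_nonneg by (simp add: C_def sum_nonneg add_nonneg_pos)
  have sum: "N (\<Sum>i\<in>I. f i) \<le> (\<Sum>i\<in>I. N (f i))" if "finite I" for f :: "'e \<Rightarrow> 'e" and I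
    using that by (induction I) (auto intro: order_trans[OF N_triangle])
  have "N v \<le> C * norm v" for v
  proof -
    have "N v = N (\<Sum>e\<in>Basis. (v \<bullet> e) *\<^sub>R e)" by (simp add: euclidean_representation)
    also have "\<dots> \<le> (\<Sum>e\<in>Basis. \<bar>v \<bullet> e\<bar> * N e)" using sum[of Basis "\<lambda>e. (v \<bullet> e) *\<^sub>R e"] by (simp add: N_scale)
    also have "\<dots> \<le> (\<Sum>e\<in>Basis. norm v * N e)"
      by (intro sum_mono mult_right_mono Basis_le_norm N_nonneg)
    also have "\<dots> \<le> C * norm v" unfolding sum_distrib_left[symmetric] C_def by (simp add: distrib_right distrib_left mult.commute)
    finally show ?thesis .
  qed
  then show ?thesis using C by blast
qed

lemma continuous_on_N: "continuous_on UNIV N"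
proof -
  obtain C where C: "C > 0" "\<And>v. N v \<le> C * norm v" using N_le_norm by auto
  have "C-lipschitz_on UNIV N"
  proof (rule lipschitz_onI)
    fix x y :: 'e
    have "N x \<le> N y + N (x - y)" "N y \<le> N x + N (y - x)"
      using N_triangle[of y "x - y"] N_triangle[of x "y - x"] by auto
    moreover have "N (y - x) = N (x - y)" using N_minus[of "x - y"] by simp
    ultimately have "\<bar>N x - N y\<bar> \<le> N (x - y)" by linarith
    also have "\<dots> \<le> C * dist x y" using C by (simp add: dist_norm)
    finally show "dist (N x) (N y) \<le> C * dist x y" by (simp add: dist_real_def)
  qed (use C in simp)
  then show ?thesis by (rule lipschitz_on_continuous_on)
qed

lemma norm_le_N: "\<exists>m>0. \<forall>v. m * norm v \<le> N v"
proof -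
  have "sphere (0::'e) 1 \<noteq> {}"
    using vector_choose_size[of 1] by (metis (no_types) dist_0_norm empty_iff mem_sphere zero_le_one)
  then obtain x where x: "x \<in> sphere 0 1" "\<And>y. y \<in> sphere 0 1 \<Longrightarrow> N x \<le> N y"
    using continuous_attains_inf[OF compact_sphere, of 0 1 N] continuous_on_subset[OF continuous_on_N] by blast
  have "N x * norm v \<le> N v" for v
  proof (cases "v = 0")
    case False
    then have "N x \<le> N (v /\<^sub>R norm v)" by (intro x(2)) simp
    then show ?thesis using False by (simp add: N_scale field_simps)
  qed simp
  moreover have "N x > 0" using x(1) by (intro N_pos) auto
  ultimately show ?thesis by blast
qed

lemma compact_unit_sphere: "compact (unit_sphere N)"
proof -
  obtain m where m: "m > 0" "\<And>v. m * norm v \<le> N v" using norm_le_N by auto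
  have "norm v \<le> 1 / m" if "N v = 1" for v
    using m(2)[of v] m(1) that by (simp add: field_simps)
  then have "bounded (unit_sphere N)"
    unfolding bounded_iff unit_sphere_def by blast
  moreover have "closed (unit_sphere N)"
    unfolding unit_sphere_def by (intro closed_Collect_eq continuous_on_N continuous_on_const)
  ultimately show ?thesis by (simp add: compact_eq_bounded_closed)
qed

lemma unit_sphere_nonempty: "unit_sphere N \<noteq> {}"
proof -
  obtain e :: 'e where "e \<in> Basis" using nonempty_Basis by blast
  then have "e \<noteq> 0" by auto
  then have "e /\<^sub>R N e \<in> unit_sphere N" using N_normalize by (simp add: unit_sphere_def)
  then show ?thesis by blast
qed

lemma dual_ball_iff: "\<xi> \<in> dual_ball N \<longleftrightarrow> (\<forall>v. \<xi> v \<le> N v)"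
proof
  assume \<xi>: "\<xi> \<in> dual_ball N"
  show "\<forall>v. \<xi> v \<le> N v"
  proof
    fix v show "\<xi> v \<le> N v"
    proof (cases "v = 0")
      case False
      then have "\<xi> (v /\<^sub>R N v) \<le> 1"
        using \<xi> N_normalize[OF False] by (auto simp: dual_ball_def)
      then show ?thesis using N_pos[OF False] by (simp add: blinfun.scaleR_right field_simps)
    qed simp
  qed
qed (auto simp: dual_ball_def intro: order_trans)

text \<open>On the compact unit sphere \<open>\<xi>\<close> attains a maximum below 1. Unit vectors
  have Euclidean length at most \<open>1 / m\<close>, so perturbing \<open>\<xi>\<close> by less
  than \<open>m\<close> times the gap keeps its values there at most 1.\<close>

lemma interior_dual_ballI:
  fixes \<xi> :: "'e \<Rightarrow>\<^sub>L real"
  assumes \<xi>: "\<And>v. N v = 1 \<Longrightarrow> \<xi> v < 1"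
  shows "\<xi> \<in> interior (dual_ball N)"
proof -
  have c: "continuous_on (unit_sphere N) (blinfun_apply \<xi>)"
    by (intro linear_continuous_on blinfun.bounded_linear_right)
  obtain x where x: "x \<in> unit_sphere N" "\<And>y. y \<in> unit_sphere N \<Longrightarrow> \<xi> y \<le> \<xi> x"
    using continuous_attains_sup[OF compact_unit_sphere unit_sphere_nonempty c] by blast
  obtain m where m: "m > 0" "\<And>v. m * norm v \<le> N v" using norm_le_N by auto
  define \<delta> where "\<delta> = m * (1 - \<xi> x)"
  have "\<delta> > 0" using m \<xi> x(1) by (simp add: \<delta>_def unit_sphere_def)
  moreover have "ball \<xi> \<delta> \<subseteq> dual_ball N"
  proof
    fix \<zeta> assume \<zeta>: "\<zeta> \<in> ball \<xi> \<delta>"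
    have unit: "\<zeta> v \<le> 1" if v: "N v = 1" for v
    proof -
      have nv: "norm v \<le> 1 / m" using m(2)[of v] m(1) v by (simp add: field_simps)
      have "\<zeta> v = \<xi> v + (\<zeta> - \<xi>) v"
        by (simp add: blinfun.diff_left)
      also have "(\<zeta> - \<xi>) v \<le> norm (\<zeta> - \<xi>) * norm v"
        using norm_blinfun[of "\<zeta> - \<xi>" v] by simp
      also have "\<dots> \<le> \<delta> * (1 / m)"
        using \<zeta> nv \<open>\<delta> > 0\<close> by (intro mult_mono) (auto simp: dist_norm norm_minus_commute)
      also have "\<dots> = 1 - \<xi> x" using m by (simp add: \<delta>_def)
      finally show ?thesis using x(2)[of v] v by (simp add: unit_sphere_def)
    qed
    have "\<zeta> v \<le> N v" for v
    proof (cases "v = 0")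
      case False
      then show ?thesis using unit[OF N_normalize[OF False]] N_pos[OF False]
        by (simp add: blinfun.scaleR_right field_simps)
    qed simp
    then show "\<zeta> \<in> dual_ball N" by (simp add: dual_ball_iff)
  qed
  ultimately show ?thesis by (auto simp: mem_interior)
qed

text \<open>The ball is closed, so its frontier is what lies outside the interior. A covector of
  value 1 at a unit vector leaves the ball under arbitrarily small stretching; the converse is
  \<open>interior_dual_ballI\<close>.\<close>

lemma dual_sphere_iff:
  "\<xi> \<in> dual_sphere N \<longleftrightarrow> \<xi> \<in> dual_ball N \<and> (\<exists>v. N v = 1 \<and> \<xi> v = 1)"
proof -
  have "closed (dual_ball N)"
  proof -
    have "dual_ball N = (\<Inter>v. {\<xi>. blinfun_apply \<xi> v \<le> N v})" by (auto simp: dual_ball_iff)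
    then show ?thesis
      by (auto intro!: closed_INT closed_Collect_le continuous_on_const linear_continuous_on blinfun.bounded_linear_left)
  qed
  then have "\<xi> \<in> dual_sphere N \<longleftrightarrow> \<xi> \<in> dual_ball N \<and> \<xi> \<notin> interior (dual_ball N)"
    by (simp add: dual_sphere_def frontier_def)
  moreover have "\<xi> \<notin> interior (dual_ball N) \<longleftrightarrow> (\<exists>v. N v = 1 \<and> \<xi> v = 1)" if \<xi>: "\<xi> \<in> dual_ball N"
  proof
    assume "\<xi> \<notin> interior (dual_ball N)"
    then obtain v where "N v = 1" "\<not> \<xi> v < 1" using interior_dual_ballI by blast
    then show "\<exists>v. N v = 1 \<and> \<xi> v = 1"
      using \<xi> unfolding dual_ball_iff by (metis linorder_not_less order_antisym_conv)
  next
    assume "\<exists>v. N v = 1 \<and> \<xi> v = 1"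
    then obtain v where v: "N v = 1" "\<xi> v = 1" by auto
    show "\<xi> \<notin> interior (dual_ball N)"
    proof
      assume "\<xi> \<in> interior (dual_ball N)"
      then obtain e where e: "e > 0" "ball \<xi> e \<subseteq> dual_ball N" by (auto simp: mem_interior)
      define d where "d = e / (2 * (norm \<xi> + 1))"
      have p: "norm \<xi> + 1 > 0" by (simp add: add_nonneg_pos)
      have "d > 0" using e p by (simp add: d_def)
      moreover from this have "d * norm \<xi> \<le> d * (norm \<xi> + 1)" by simp
      moreover have "d * (norm \<xi> + 1) = e / 2" using p unfolding d_def
        by (simp only: times_divide_eq_left mult_divide_mult_cancel_right less_numeral_extra(3) simp_thms order_less_imp_not_eq2)
      ultimately have d: "d > 0" "d * norm \<xi> < e" using e by simp_all
      have "dist \<xi> ((1 + d) *\<^sub>R \<xi>) = d * norm \<xi>"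
        using d by (simp add: dist_norm scaleR_add_left)
      then have "(1 + d) *\<^sub>R \<xi> \<in> dual_ball N" using d e by auto
      then have "((1 + d) *\<^sub>R \<xi>) v \<le> N v" by (simp add: dual_ball_iff)
      then show False using v d by (simp add: blinfun.scaleR_left)
    qed
  qed
  ultimately show ?thesis by blast
qed

definition LL :: "'e \<Rightarrow> 'e \<Rightarrow>\<^sub>L real" where "LL v = blinfun_inner_right (L v)"

lemma LL_apply: "(LL v) u = L v \<bullet> u"
  by (simp add: LL_def)

lemma LL_derivative: "v \<noteq> 0 \<Longrightarrow> (LL has_derivative (\<lambda>w. blinfun_inner_right (H v w))) (at v)"
  unfolding LL_def by (rule bounded_linear.has_derivative[OF bounded_linear_blinfun_inner_right L_derivative])

text \<open>A unit vector on which a covector of the dual sphere takes the value 1 satisfies the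
  conditions of \<open>L_eqI\<close>, so it is a preimage.\<close>

lemma dual_sphere_eq: "dual_sphere N = LL ` unit_sphere N"
proof
  show "LL ` unit_sphere N \<subseteq> dual_sphere N"
  proof (clarsimp simp: unit_sphere_def)
    fix v assume v: "N v = 1"
    then have v0: "v \<noteq> 0" by auto
    then show "LL v \<in> dual_sphere N"
      using L_le[OF v0] L_self[OF v0] v by (auto simp: dual_sphere_iff dual_ball_iff LL_apply)
  qed
  show "dual_sphere N \<subseteq> LL ` unit_sphere N"
  proof
    fix \<xi> assume "\<xi> \<in> dual_sphere N"
    then obtain v where v: "N v = 1" "\<xi> v = 1" and \<xi>: "\<And>u. \<xi> u \<le> N u"
      by (auto simp: dual_sphere_iff dual_ball_iff)
    have "L v = riesz \<xi>"
      by (rule L_eqI) (use v \<xi> in \<open>auto simp: riesz_inner\<close>)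
    then have "LL v = \<xi>" by (simp add: LL_def blinfun_inner_riesz)
    then show "\<xi> \<in> LL ` unit_sphere N" using v by (auto simp: unit_sphere_def)
  qed
qed

end

text \<open>Subtract from \<open>f\<close> a multiple of the inner product with the component
  \<open>z\<close> of \<open>v\<close> orthogonal to \<open>W\<close>; it vanishes on
  \<open>W\<close> but not at \<open>v\<close>.\<close>

lemma linear_extension_vanishing:
  fixes W :: "'e::euclidean_space set"
  assumes W: "subspace W" "v \<notin> W" and f: "linear (f :: 'e \<Rightarrow> real)"
  shows "\<exists>g. linear g \<and> g v = 0 \<and> (\<forall>w\<in>W. g w = f w)"
proof -
  obtain y z where yz: "y \<in> span W" "\<And>w. w \<in> span W \<Longrightarrow> Linear_Algebra.orthogonal z w" "v = y + z"
    using orthogonal_subspace_decomp_exists[of W v] by blast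
  have sp: "span W = W" using W by (simp add: span_eq_iff)
  have z0: "z \<noteq> 0" using yz W sp by auto
  have zv: "z \<bullet> v = z \<bullet> z" using yz by (simp add: inner_add_right Linear_Algebra.orthogonal_def)
  define g where "g x = f x - f v * (z \<bullet> x) / (z \<bullet> v)" for x
  have "linear g"
    unfolding g_def using f
    by (intro linearI) (simp_all add: linear_add linear_cmul inner_add_right algebra_simps add_divide_distrib)
  moreover have "g v = 0" using z0 zv by (simp add: g_def)
  moreover have "g w = f w" if "w \<in> W" for w
    using yz(2)[of w] that sp by (simp add: g_def Linear_Algebra.orthogonal_def)
  ultimately show ?thesis by blast
qed

section \<open>Singular points of the projection and the transformation between spheres\<close>

context minkowski
begin

text \<open>Evaluation at \<open>v\<close> attains its maximum over the dual sphere at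
  \<open>LL v\<close>, so its derivative along curves vanishes. Conversely \<open>H v\<close> is
  onto, and by \<open>H_inner_self\<close> a preimage of an annihilator of \<open>v\<close> is
  tangent to the unit sphere.\<close>

lemma tangent_space_dual_sphere:
  assumes v: "N v = 1"
  shows "tspace (dual_sphere N) (LL v) = {\<eta>. blinfun_apply \<eta> v = 0}"
proof
  have v0: "v \<noteq> 0" by (rule unit_nonzero[OF v])
  show "tspace (dual_sphere N) (LL v) \<subseteq> {\<eta>. blinfun_apply \<eta> v = 0}"
  proof
    fix \<eta> assume "\<eta> \<in> tspace (dual_sphere N) (LL v)"
    then obtain \<gamma> where \<gamma>: "\<gamma> 0 = LL v" "\<forall>\<^sub>F t in nhds 0. \<gamma> t \<in> dual_sphere N" "(\<gamma> has_vector_derivative \<eta>) (at 0)"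
      by (auto simp: tangent_space_def velocity_at_flat)
    obtain S where S: "open S" "0 \<in> S" "\<And>t. t \<in> S \<Longrightarrow> \<gamma> t \<in> dual_sphere N"
      using \<gamma>(2) unfolding eventually_nhds by auto
    have "((\<lambda>t. \<gamma> t v) has_vector_derivative blinfun_apply \<eta> v) (at 0)"
      using bounded_linear.has_vector_derivative[OF blinfun.bounded_linear_left \<gamma>(3)] .
    then have "((\<lambda>t. \<gamma> t v) has_derivative (\<lambda>h. h *\<^sub>R blinfun_apply \<eta> v)) (at 0)"
      by (simp add: has_vector_derivative_def)
    moreover have "\<gamma> t v \<le> \<gamma> 0 v" if "t \<in> S" for t
      using S(3)[OF that] \<gamma>(1) v L_self[OF v0] by (auto simp: dual_sphere_iff dual_ball_iff LL_apply dest!: spec[of _ v])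
    ultimately have "(\<lambda>h. h *\<^sub>R blinfun_apply \<eta> v) = (\<lambda>h. 0)"
      using S by (intro differential_zero_maxmin[of 0 S "\<lambda>t. \<gamma> t v"]) auto
    then show "\<eta> \<in> {\<eta>. blinfun_apply \<eta> v = 0}"
      by (metis (mono_tags) mem_Collect_eq scaleR_one)
  qed
  show "{\<eta>. blinfun_apply \<eta> v = 0} \<subseteq> tspace (dual_sphere N) (LL v)"
  proof
    fix \<eta> :: "'e \<Rightarrow>\<^sub>L real" assume "\<eta> \<in> {\<eta>. blinfun_apply \<eta> v = 0}"
    then have \<eta>: "blinfun_apply \<eta> v = 0" by simp
    define w where "w = K v (riesz \<eta>)"
    have Hw: "H v w = riesz \<eta>" unfolding w_def by (rule H_K[OF v0])
    then have "L v \<bullet> w = 0" using H_inner_self[OF v0, of w] \<eta> by (simp add: riesz_inner)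
    then have w: "w \<in> tspace (unit_sphere N) v"
      by (simp add: tangent_space_sphere[OF v])
    have "blinfun_inner_right (H v w) \<in> tspace (dual_sphere N) (LL v)"
      by (rule tangent_space_map[OF LL_derivative[OF v0] _ w]) (simp add: dual_sphere_eq)
    then show "\<eta> \<in> tspace (dual_sphere N) (LL v)"
      by (simp add: Hw blinfun_inner_riesz)
  qed
qed

text \<open>If \<open>v\<close> lies in the plane, restrictions of annihilators of \<open>v\<close>
  vanish at \<open>v\<close>, while the inner product with \<open>v\<close> does not. Otherwise
  \<open>linear_extension_vanishing\<close> realises every functional on the plane by an annihilator
  of \<open>v\<close>.\<close>

lemma sing_set_eq:
  assumes W: "subspace (kplane k a)"
  shows "sing_set k N a = LL ` {v. N v = 1 \<and> v \<in> kplane k a}"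
proof -
  have "dual_proj k a ` tspace (dual_sphere N) (LL v) \<noteq> dual_plane k a \<longleftrightarrow> v \<in> kplane k a"
    if v: "N v = 1" for v
  proof
    assume vW: "v \<in> kplane k a"
    have v0: "v \<noteq> 0" by (rule unit_nonzero[OF v])
    have "restrict (\<lambda>u. v \<bullet> u) (kplane k a) \<in> dual_plane k a"
      unfolding dual_plane_def using bounded_linear.linear[OF bounded_linear_inner_right] by blast
    moreover have "restrict (\<lambda>u. v \<bullet> u) (kplane k a) \<notin> dual_proj k a ` {\<eta>. blinfun_apply \<eta> v = 0}"
    proof
      assume "restrict (\<lambda>u. v \<bullet> u) (kplane k a) \<in> dual_proj k a ` {\<eta>. blinfun_apply \<eta> v = 0}"
      then obtain \<eta> :: "'e \<Rightarrow>\<^sub>L real" where "blinfun_apply \<eta> v = 0"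
        "restrict (\<lambda>u. v \<bullet> u) (kplane k a) = restrict (blinfun_apply \<eta>) (kplane k a)"
        by (auto simp: dual_proj_def)
      then show False using vW v0 by (metis inner_eq_zero_iff restrict_apply')
    qed
    ultimately show "dual_proj k a ` tspace (dual_sphere N) (LL v) \<noteq> dual_plane k a"
      unfolding tangent_space_dual_sphere[OF v] by blast
  next
    assume ne: "dual_proj k a ` tspace (dual_sphere N) (LL v) \<noteq> dual_plane k a"
    show "v \<in> kplane k a"
    proof (rule ccontr)
      assume vW: "v \<notin> kplane k a"
      have "dual_proj k a ` {\<eta>. blinfun_apply \<eta> v = 0} = dual_plane k a"
      proof
        show "dual_proj k a ` {\<eta>. blinfun_apply \<eta> v = 0} \<subseteq> dual_plane k a"
          unfolding dual_proj_def dual_plane_def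
          using bounded_linear.linear[OF blinfun.bounded_linear_right] by blast
        show "dual_plane k a \<subseteq> dual_proj k a ` {\<eta>. blinfun_apply \<eta> v = 0}"
        proof
          fix h assume "h \<in> dual_plane k a"
          then obtain f where f: "linear f" "h = restrict f (kplane k a)" by (auto simp: dual_plane_def)
          obtain g where g: "linear g" "g v = 0" "\<And>w. w \<in> kplane k a \<Longrightarrow> g w = f w"
            using linear_extension_vanishing[OF W vW f(1)] by blast
          have "bounded_linear g" using g(1) by (simp add: linear_conv_bounded_linear)
          then have gb: "blinfun_apply (Blinfun g) = g" by (rule bounded_linear_Blinfun_apply)
          have "h = dual_proj k a (Blinfun g)"
            unfolding dual_proj_def gb f(2) using g(3) by (auto simp: restrict_def)
          then show "h \<in> dual_proj k a ` {\<eta>. blinfun_apply \<eta> v = 0}"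
            using g(2) gb by (intro image_eqI[of _ _ "Blinfun g"]) auto
        qed
      qed
      then show False using ne by (simp add: tangent_space_dual_sphere[OF v])
    qed
  qed
  then show ?thesis
    unfolding sing_set_def dual_sphere_eq by (auto simp: unit_sphere_def)
qed

definition GG :: "('e \<Rightarrow>\<^sub>L real) \<Rightarrow> 'e" where "GG \<xi> = G (riesz \<xi>)"

lemma GG_LL: "v \<noteq> 0 \<Longrightarrow> GG (LL v) = v"
  by (simp add: GG_def LL_def riesz_blinfun_inner G_L)

lemma GG_derivative: "v \<noteq> 0 \<Longrightarrow> (GG has_derivative (\<lambda>\<eta>. K v (riesz \<eta>))) (at (LL v))"
  unfolding GG_def
  by (rule has_derivative_compose[OF bounded_linear_imp_has_derivative[OF bounded_linear_riesz]])
     (simp add: LL_def riesz_blinfun_inner G_derivative)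

lemma homeomorphism_LL:
  assumes "S \<subseteq> - {0}" shows "homeomorphism S (LL ` S) LL GG"
proof (rule homeomorphismI)
  show "continuous_on S LL"
    by (intro continuous_at_imp_continuous_on ballI has_derivative_continuous[OF LL_derivative]) (use assms in auto)
  show "continuous_on (LL ` S) GG"
    by (intro continuous_at_imp_continuous_on ballI)
       (use assms in \<open>auto intro!: has_derivative_continuous[OF GG_derivative]\<close>)
qed (use assms GG_LL in \<open>auto simp: subset_eq\<close>)

lemma diffeo_LL:
  assumes S: "S \<subseteq> - {0}"
  shows "diffeo S (LL ` S) LL GG (\<lambda>v w. blinfun_inner_right (H v w))"
proof
  show "homeomorphism S (LL ` S) LL GG" by (rule homeomorphism_LL[OF S])
  show "(LL has_derivative (\<lambda>w. blinfun_inner_right (H v w))) (at v)" if "v \<in> S" for v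
    using that S by (intro LL_derivative) auto
  show "w = 0" if "v \<in> S" "blinfun_inner_right (H v w) = 0" for v w
  proof -
    have "H v w = riesz 0" using that(2) riesz_blinfun_inner by metis
    then show ?thesis using that(1) S H_injective[of v w] by (auto simp: riesz_def)
  qed
  show "continuous_on (S \<times> UNIV) (\<lambda>p. blinfun_inner_right (H (fst p) (snd p)))"
    by (rule bounded_linear.continuous_on[OF bounded_linear_blinfun_inner_right])
       (rule continuous_on_subset[OF continuous_on_H], use S in auto)
qed

text \<open>The inverse as a diffeomorphism in its own right, for the transport back to the fibre;
  \<open>continuous_on_K\<close> supplies the joint continuity of its derivative.\<close>

lemma diffeo_GG:
  assumes S: "S \<subseteq> - {0}"
  shows "diffeo (LL ` S) S GG LL (\<lambda>\<xi> \<eta>. K (GG \<xi>) (riesz \<eta>))"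
proof
  have GG_nonzero: "GG \<xi> \<noteq> 0" if img: "\<xi> \<in> LL ` S" for \<xi>
  proof -
    obtain v where "\<xi> = LL v" "v \<in> S" by (rule imageE[OF img])
    moreover from this have "v \<noteq> 0" using S by auto
    ultimately show ?thesis by (simp add: GG_LL)
  qed
  show "homeomorphism (LL ` S) S GG LL"
    by (rule homeomorphism_symD[OF homeomorphism_LL[OF S]])
  show "(GG has_derivative (\<lambda>\<eta>. K (GG \<xi>) (riesz \<eta>))) (at \<xi>)" if img: "\<xi> \<in> LL ` S" for \<xi>
  proof -
    obtain v where "\<xi> = LL v" "v \<in> S" by (rule imageE[OF img])
    moreover from this have "v \<noteq> 0" using S by auto
    ultimately show ?thesis using GG_derivative[of v] by (simp add: GG_LL)
  qed
  show "\<eta> = 0" if "\<xi> \<in> LL ` S" "K (GG \<xi>) (riesz \<eta>) = 0" for \<xi> \<eta>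
  proof -
    have v: "GG \<xi> \<noteq> 0" by (rule GG_nonzero[OF that(1)])
    have "riesz \<eta> = 0" using H_K[OF v, of "riesz \<eta>"] H_linear[OF v] that(2) by (simp add: linear_0)
    then have "blinfun_inner_right (riesz \<eta>) = 0" by (intro blinfun_eqI) simp
    then show ?thesis by (simp add: blinfun_inner_riesz)
  qed
  have c1: "continuous_on (LL ` S \<times> UNIV) (\<lambda>p. GG (fst p))"
    by (rule continuous_on_compose2[OF homeomorphism_cont2[OF homeomorphism_LL[OF S]] continuous_on_fst[OF continuous_on_id]]) auto
  have c2: "continuous_on (LL ` S \<times> UNIV) (\<lambda>p. riesz (snd p) :: 'e)"
    by (rule bounded_linear.continuous_on[OF bounded_linear_riesz continuous_on_snd[OF continuous_on_id]])
  have "continuous_on (LL ` S \<times> UNIV) (\<lambda>p. K (fst (GG (fst p), riesz (snd p) :: 'e)) (snd (GG (fst p), riesz (snd p) :: 'e)))"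
    by (rule continuous_on_compose2[OF continuous_on_K continuous_on_Pair[OF c1 c2]])
       (use GG_nonzero in \<open>auto simp: image_subset_iff\<close>)
  then show "continuous_on (LL ` S \<times> UNIV) (\<lambda>p. K (GG (fst p)) (riesz (snd p)))"
    by simp
qed

end

section \<open>Charts and the Hilbert form in coordinates\<close>

lemma Ck_on_cong:
  assumes "open S" "\<And>x. x \<in> S \<Longrightarrow> f x = g x"
  shows "Ck_on n S f \<longleftrightarrow> Ck_on n S g"
  using assms(2)
proof (induction n arbitrary: f g)
  case 0
  then show ?case by (simp cong: continuous_on_cong)
next
  case (Suc n)
  have d: "\<D> f x = \<D> g x" if "x \<in> S" for x
    by (rule frechet_derivative_cong_open[OF assms(1) that]) (rule Suc.prems)
  have "f differentiable at x \<longleftrightarrow> g differentiable at x" if "x \<in> S" for x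
    using has_derivative_transform_within_open[OF _ assms(1) that, of f _ UNIV g]
      has_derivative_transform_within_open[OF _ assms(1) that, of g _ UNIV f] Suc.prems
    unfolding differentiable_def by metis
  moreover have "Ck_on n S (\<lambda>x. \<D> f x v) \<longleftrightarrow> Ck_on n S (\<lambda>x. \<D> g x v)" for v
    by (rule Suc.IH) (simp add: d)
  ultimately show ?case by simp
qed

lemma has_derivative_slice:
  assumes "(f has_derivative f') (at (y, w))"
  shows "((\<lambda>w. f (y, w)) has_derivative (\<lambda>h. f' (0, h))) (at w)"
proof (rule has_derivative_compose[of "\<lambda>w. (y, w)" "\<lambda>h. (0, h)" w UNIV f f'])
  show "((\<lambda>w. (y, w)) has_derivative (\<lambda>h. (0, h))) (at w)"
    by (intro has_derivative_Pair has_derivative_const has_derivative_ident)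
qed (rule assms)

text \<open>Induction on the order for all \<open>f\<close> at once: a derivative of the slice is a
  slice of a derivative in direction \<open>(0, v)\<close>.\<close>

lemma smooth_on_slice:
  assumes "open W" "y \<in> V" "smooth_on (V \<times> W) f"
  shows "smooth_on W (\<lambda>w. f (y, w))"
proof -
  have "Ck_on n W (\<lambda>w. f (y, w))" if "Ck_on n (V \<times> W) f" for n and f :: "'b \<times> 'a \<Rightarrow> 'c"
    using that
  proof (induction n arbitrary: f)
    case 0
    then show ?case
      using assms(2) by (auto intro!: continuous_on_compose2[of "V \<times> W" f] continuous_intros)
  next
    case (Suc n)
    have d: "((\<lambda>w. f (y, w)) has_derivative (\<lambda>h. \<D> f (y, w) (0, h))) (at w)" if "w \<in> W" for w
      using Suc.prems that assms(2) by (intro has_derivative_slice) (auto simp: frechet_derivative_works)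
    have "Ck_on n W (\<lambda>w. \<D> f (y, w) (0, v))" for v
      by (rule Suc.IH[of "\<lambda>p. \<D> f p (0, v)"]) (use Suc.prems in simp)
    moreover have "Ck_on n W (\<lambda>w. \<D> (\<lambda>w. f (y, w)) w v) \<longleftrightarrow>
      Ck_on n W (\<lambda>w. \<D> f (y, w) (0, v))" for v
      by (rule Ck_on_cong[OF assms(1)]) (simp add: frechet_derivative_eqI[OF d])
    ultimately show ?case using d by (auto simp: differentiable_def)
  qed
  then show ?thesis using assms(3) by (simp add: smooth_on_def)
qed

locale manifold =
  fixes X :: "'m topology" and ch :: "'m \<Rightarrow> ('m, 'e::euclidean_space) chart"
  assumes man: "smooth_manifold X ch"
begin

abbreviation "U x \<equiv> dom_chart (ch x)"
abbreviation "\<phi> x \<equiv> snd (ch x)"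
abbreviation "V x \<equiv> \<phi> x ` U x"
abbreviation "\<psi> x \<equiv> chart_inv (ch x)"
abbreviation "cc x z \<equiv> coord_change (ch x) (ch z)"
abbreviation "TC \<equiv> tangent_chart ch"

lemma chart:
  assumes "x \<in> topspace X"
  shows center_in_chart: "x \<in> U x" and openin_dom: "openin X (U x)" and open_image: "open (V x)"
    and homeo: "homeomorphic_map (subtopology X (U x)) (top_of_set (V x)) (\<phi> x)"
  using man assms unfolding smooth_manifold_def by blast+

lemma dom_subset: "x \<in> topspace X \<Longrightarrow> U x \<subseteq> topspace X"
  using openin_dom openin_subset by blast

lemma chart_inj: "x \<in> topspace X \<Longrightarrow> inj_on (\<phi> x) (U x)"
  using homeo[of x] dom_subset[of x]
  by (simp add: homeomorphic_map_def quotient_imp_continuous_map homeomorphic_imp_injective_map inf.absorb2)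

lemma chart_inv_chart: "x \<in> topspace X \<Longrightarrow> q \<in> U x \<Longrightarrow> \<psi> x (\<phi> x q) = q"
  by (simp add: chart_inj)

lemma chart_chart_inv: "y \<in> V x \<Longrightarrow> \<phi> x (\<psi> x y) = y" "y \<in> V x \<Longrightarrow> \<psi> x y \<in> U x"
  by (auto simp: f_inv_into_f inv_into_into)

lemma open_chart_image:
  assumes x: "x \<in> topspace X" and W: "openin X W" "W \<subseteq> U x"
  shows "open (\<phi> x ` W)"
proof -
  have "openin (subtopology X (U x)) W"
    using W by (auto simp: openin_subtopology)
  then have "openin (top_of_set (V x)) (\<phi> x ` W)"
    using homeomorphic_imp_open_map[OF homeo[OF x]] by (simp add: open_map_def)
  then show ?thesis
    using open_image[OF x] openin_open_eq by blast
qed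

lemma open_overlap:
  assumes "x \<in> topspace X" "z \<in> topspace X"
  shows "open (\<phi> x ` (U x \<inter> U z))"
  using assms by (intro open_chart_image openin_Int openin_dom) auto

lemma transition_smooth:
  "x \<in> topspace X \<Longrightarrow> z \<in> topspace X \<Longrightarrow> smooth_on (\<phi> x ` (U x \<inter> U z)) (\<phi> z \<circ> \<psi> x)"
  using man by (simp add: smooth_manifold_def)

lemma transition_derivative:
  assumes "x \<in> topspace X" "z \<in> topspace X" "q \<in> U x" "q \<in> U z"
  shows "((\<phi> z \<circ> \<psi> x) has_derivative cc x z q) (at (\<phi> x q))"
  unfolding coord_change_def
  by (rule smooth_on_has_derivative[OF transition_smooth[OF assms(1,2)]]) (use assms in auto)

lemma cc_linear:
  assumes "x \<in> topspace X" "z \<in> topspace X" "q \<in> U x" "q \<in> U z"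
  shows "linear (cc x z q)"
  by (rule has_derivative_linear[OF transition_derivative[OF assms]])

lemma cc_trans:
  assumes x: "x \<in> topspace X" "z \<in> topspace X" "w \<in> topspace X" and q: "q \<in> U x" "q \<in> U z" "q \<in> U w"
  shows "cc z w q (cc x z q u) = cc x w q u"
proof -
  let ?S = "\<phi> x ` (U x \<inter> U z \<inter> U w)"
  have "((\<lambda>y. (\<phi> w \<circ> \<psi> z) ((\<phi> z \<circ> \<psi> x) y)) has_derivative (\<lambda>h. cc z w q (cc x z q h))) (at (\<phi> x q))"
    by (rule has_derivative_compose[OF transition_derivative[OF x(1,2) q(1,2)]])
       (use transition_derivative[OF x(2,3) q(2,3)] chart_inv_chart[OF x(1) q(1)] in \<open>simp add: o_def\<close>)
  then have "((\<phi> w \<circ> \<psi> x) has_derivative (\<lambda>h. cc z w q (cc x z q h))) (at (\<phi> x q))"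
  proof (rule has_derivative_transform_within_open)
    show "open ?S" using x by (intro open_chart_image openin_Int openin_dom) auto
    show "\<phi> x q \<in> ?S" using q by auto
    show "(\<phi> w \<circ> \<psi> z) ((\<phi> z \<circ> \<psi> x) y) = (\<phi> w \<circ> \<psi> x) y" if "y \<in> ?S" for y
      using that chart_inv_chart[OF x(1)] chart_inv_chart[OF x(2)] by auto
  qed
  then show ?thesis
    using has_derivative_unique[OF transition_derivative[OF x(1,3) q(1,3)]] by metis
qed

lemma cc_self:
  assumes x: "x \<in> topspace X" and q: "q \<in> U x"
  shows "cc x x q u = u"
proof -
  have "((\<phi> x \<circ> \<psi> x) has_derivative (\<lambda>h. h)) (at (\<phi> x q))"
    by (rule has_derivative_transform_within_open[OF has_derivative_ident open_image[OF x]])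
       (use q chart_chart_inv[of _ x] in auto)
  then show ?thesis
    using has_derivative_unique[OF transition_derivative[OF x x q q]] by metis
qed

lemma cc_inverse:
  assumes "x \<in> topspace X" "z \<in> topspace X" "q \<in> U x" "q \<in> U z"
  shows "cc z x q (cc x z q u) = u"
  using cc_trans[OF assms(1,2,1,3,4,3)] cc_self[OF assms(1,3)] by simp

lemma tangent_chart_apply: "snd (TC (x, v)) (q, w) = (\<phi> x q, cc q x q w)"
  by (simp add: tangent_chart_def)

text \<open>Vectors at a point are recorded in that point's own chart, so inverting the bundle chart
  around \<open>x\<close> also converts \<open>u\<close> to the chart selected at the moving
  point.\<close>

lemma tangent_chart_inv:
  assumes x: "x \<in> topspace X" and y: "y \<in> V x"
  shows "chart_inv (TC (x, v)) (y, u) = (\<psi> x y, cc x (\<psi> x y) (\<psi> x y) u)"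
proof (rule inv_into_f_eq)
  have dom: "dom_chart (TC (x, v)) = U x \<times> UNIV" by (simp add: tangent_chart_def)
  have q: "\<psi> x y \<in> U x" "\<psi> x y \<in> topspace X"
    using chart_chart_inv(2)[OF y] dom_subset[OF x] by auto
  show "inj_on (snd (TC (x, v))) (dom_chart (TC (x, v)))"
    unfolding dom
  proof (rule inj_onI, clarify)
    fix q w q' w' assume a: "q \<in> U x" "q' \<in> U x" "snd (TC (x, v)) (q, w) = snd (TC (x, v)) (q', w')"
    then have qq: "q = q'" using chart_inj[OF x] by (simp add: tangent_chart_apply inj_on_def)
    have qX: "q \<in> topspace X" using a dom_subset[OF x] by auto
    have "w = w'"
      using a(3) cc_inverse[OF qX x center_in_chart[OF qX] a(1)] unfolding qq tangent_chart_apply by (metis Pair_inject)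
    then show "q = q' \<and> w = w'" using qq by simp
  qed
  show "(\<psi> x y, cc x (\<psi> x y) (\<psi> x y) u) \<in> dom_chart (TC (x, v))"
    unfolding dom using q by simp
  show "snd (TC (x, v)) (\<psi> x y, cc x (\<psi> x y) (\<psi> x y) u) = (y, u)"
    using cc_inverse[OF x q(2) q(1) center_in_chart[OF q(2)]] chart_chart_inv(1)[OF y]
    by (simp add: tangent_chart_apply)
qed

lemma tangent_chart_center: "x \<in> topspace X \<Longrightarrow> snd (TC (x, v)) (x, v) = (\<phi> x x, v)"
  by (simp add: tangent_chart_apply cc_self center_in_chart)

lemma open_tangent_image: "x \<in> topspace X \<Longrightarrow> open (V x \<times> (UNIV :: 'e set))"
  by (intro open_Times open_image open_UNIV)

lemma center_image: "x \<in> topspace X \<Longrightarrow> \<phi> x x \<in> V x"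
  using center_in_chart by auto

lemma tangent_map_fst:
  assumes x: "x \<in> topspace X"
  shows "tangent_map TC ch fst (x, v) w = fst w"
proof -
  have "((\<phi> x \<circ> fst \<circ> chart_inv (TC (x, v))) has_derivative fst) (at (\<phi> x x, v))"
  proof (rule has_derivative_transform_within_open[OF _ open_tangent_image[OF x]])
    show "(fst has_derivative fst) (at (\<phi> x x, v))"
      by (rule has_derivative_fst[OF has_derivative_ident])
    show "(\<phi> x x, v) \<in> V x \<times> UNIV" using center_image[OF x] by simp
    show "fst p = (\<phi> x \<circ> fst \<circ> chart_inv (TC (x, v))) p" if "p \<in> V x \<times> UNIV" for p
      using that tangent_chart_inv[OF x, of "fst p" v "snd p"] chart_chart_inv(1)[of "fst p" x] by auto
  qed
  then show ?thesis
    by (simp add: tangent_map_def tangent_chart_center[OF x] frechet_derivative_eqI)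
qed

lemma tangent_map_vertical:
  assumes x: "x \<in> topspace X"
  shows "tangent_map flat_chart TC (\<lambda>w. (x, w)) v \<tau> = (0, \<tau>)"
proof -
  have "snd (TC (x, v)) \<circ> (\<lambda>w. (x, w)) \<circ> chart_inv (flat_chart v) = (\<lambda>w. (\<phi> x x, w))"
    by (simp add: fun_eq_iff flat_chart_def tangent_chart_apply cc_self[OF x center_in_chart[OF x]] inv_def[symmetric])
  moreover have "((\<lambda>w. (\<phi> x x, w)) has_derivative (\<lambda>h. (0, h))) (at v)"
    by (intro has_derivative_Pair has_derivative_const has_derivative_ident)
  ultimately show ?thesis
    by (simp add: tangent_map_def frechet_derivative_eqI flat_chart_def)
qed

text \<open>A transition of the tangent bundle is a base transition together with its derivative, so
  the base part of a tangent vector transforms by the base transition. \<open>omega1\<close> sees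
  only this part.\<close>

lemma tangent_coord_change_fst:
  assumes x: "x \<in> topspace X" and y: "y \<in> V x" and q: "q = \<psi> x y"
  shows "fst (coord_change (TC (x, v)) (TC (q, w)) (q, cc x q q u) W) = cc x q q (fst W)"
proof -
  have qU: "q \<in> U x" and qX: "q \<in> topspace X"
    using chart_chart_inv(2)[OF y] dom_subset[OF x] q by auto
  have yq: "\<phi> x q = y" using chart_chart_inv(1)[OF y] q by simp
  let ?f = "\<phi> q \<circ> \<psi> x" and ?S = "\<phi> x ` (U x \<inter> U q)"
  have S: "open ?S" "y \<in> ?S"
    using open_overlap[OF x qX] qU center_in_chart[OF qX] yq by auto
  have sm: "smooth_on ?S ?f" by (rule transition_smooth[OF x qX])
  let ?D = "\<lambda>h. (\<D> ?f y (fst h),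
      \<D> (\<lambda>y. \<D> ?f y u) y (fst h) + \<D> ?f y (snd h))"
  have "((\<lambda>p. (?f (fst p), \<D> ?f (fst p) (snd p))) has_derivative ?D) (at (y, u))"
  proof (intro has_derivative_Pair has_derivative_fderiv_pair[OF S sm])
    show "((\<lambda>p. ?f (fst p)) has_derivative (\<lambda>h. \<D> ?f y (fst h))) (at (y, u))"
      by (rule has_derivative_compose[OF has_derivative_fst[OF has_derivative_ident]])
         (use smooth_on_has_derivative[OF sm S(2)] in \<open>simp add: o_def\<close>)
  qed
  then have "((snd (TC (q, w)) \<circ> chart_inv (TC (x, v))) has_derivative ?D) (at (y, u))"
  proof (rule has_derivative_transform_within_open)
    show "open (?S \<times> (UNIV :: 'e set))" by (intro open_Times S open_UNIV)
    show "(y, u) \<in> ?S \<times> UNIV" using S by simp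
    fix p assume "p \<in> ?S \<times> (UNIV :: 'e set)"
    then obtain r u' where p: "p = (\<phi> x r, u')" "r \<in> U x" "r \<in> U q" by auto
    have rX: "r \<in> topspace X" using p dom_subset[OF x] by auto
    have pr: "\<psi> x (\<phi> x r) = r" by (rule chart_inv_chart[OF x p(2)])
    have "chart_inv (TC (x, v)) p = (r, cc x r r u')"
      using tangent_chart_inv[OF x, of "\<phi> x r" v u'] p pr by simp
    moreover have "cc r q r (cc x r r u') = cc x q r u'"
      by (rule cc_trans[OF x rX qX p(2) center_in_chart[OF rX] p(3)])
    ultimately show "(?f (fst p), \<D> ?f (fst p) (snd p)) = (snd (TC (q, w)) \<circ> chart_inv (TC (x, v))) p"
      using p(1) pr by (simp add: tangent_chart_apply coord_change_def)
  qed
  then have "\<D> (snd (TC (q, w)) \<circ> chart_inv (TC (x, v))) (y, u) = ?D"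
    by (rule frechet_derivative_eqI)
  moreover have "snd (TC (x, v)) (q, cc x q q u) = (y, u)"
    using cc_inverse[OF x qX qU center_in_chart[OF qX]] yq by (simp add: tangent_chart_apply)
  ultimately have "coord_change (TC (x, v)) (TC (q, w)) (q, cc x q q u) = ?D"
    by (simp add: coord_change_def[of "TC (x, v)"])
  then show ?thesis
    by (simp add: coord_change_def yq)
qed

end

section \<open>The Finsler metric and its Hilbert form in coordinates\<close>

locale finsler =
  fixes X :: "'m topology" and ch :: "'m \<Rightarrow> ('m, 'e::euclidean_space) chart" and F :: "'m \<Rightarrow> 'e \<Rightarrow> real"
  assumes fins: "finsler_manifold X ch F"
begin

sublocale manifold X ch
  by unfold_locales (use fins in \<open>simp add: finsler_manifold_def\<close>)

definition Fc :: "'m \<Rightarrow> 'e \<times> 'e \<Rightarrow> real" where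
  "Fc x p = F (\<psi> x (fst p)) (cc x (\<psi> x (fst p)) (\<psi> x (fst p)) (snd p))"

lemma Fc_smooth:
  assumes x: "x \<in> topspace X"
  shows "smooth_on (V x \<times> (UNIV - {0})) (Fc x)"
proof -
  have sm: "smooth_on (V x \<times> (UNIV - {0})) ((\<lambda>(q, w). F q w) \<circ> chart_inv (TC (x, 0)))"
    using fins x by (simp add: finsler_manifold_def)
  have eq: "((\<lambda>(q, w). F q w) \<circ> chart_inv (TC (x, 0))) p = Fc x p" if "p \<in> V x \<times> (UNIV - {0})" for p
    using that tangent_chart_inv[OF x, of "fst p" 0 "snd p"] by (auto simp: Fc_def)
  have o: "open (V x \<times> (UNIV - {0 :: 'e}))"
    by (intro open_Times open_image[OF x]) (simp add: open_delete)
  have "Ck_on n (V x \<times> (UNIV - {0})) ((\<lambda>(q, w). F q w) \<circ> chart_inv (TC (x, 0)))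
      \<longleftrightarrow> Ck_on n (V x \<times> (UNIV - {0})) (Fc x)" for n
    by (rule Ck_on_cong[OF o]) (rule eq)
  then show ?thesis
    using sm unfolding smooth_on_def by blast
qed

lemma Fc_center: "x \<in> topspace X \<Longrightarrow> Fc x (\<phi> x x, w) = F x w"
  by (simp add: Fc_def chart_inv_chart center_in_chart cc_self)

lemma minkowski_fibre:
  assumes x: "x \<in> topspace X" shows "minkowski (F x)"
proof
  have mn: "minkowski_norm (F x)" using fins x by (simp add: finsler_manifold_def)
  then show "is_norm (F x)" "minkowski_norm (F x)" by (simp_all add: minkowski_norm_def)
  have "smooth_on (UNIV - {0}) (\<lambda>w. Fc x (\<phi> x x, w))"
    by (rule smooth_on_slice[OF _ center_image[OF x] Fc_smooth[OF x]]) (simp add: open_delete)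
  then show "smooth_on (UNIV - {0}) (F x)" by (simp add: Fc_center[OF x])
qed

text \<open>The Hilbert form in the chart around \<open>x\<close>, evaluated on a vector with projection \<open>b\<close>.\<close>

definition hilb :: "'m \<Rightarrow> 'e \<Rightarrow> 'e \<times> 'e \<Rightarrow> real" where
  "hilb x b p = Fc x p * \<D> (Fc x) p (0, b)"

text \<open>In coordinates the Hilbert form is the fibre derivative of half the square of
  \<open>Fc\<close>: on a fibre \<open>Fc\<close> is the norm composed with the linear coordinate
  change \<open>A\<close>, and the chain rule applies.\<close>

lemma coord_form_omega1:
  assumes x: "x \<in> topspace X" and y: "y \<in> V x" and u: "u \<noteq> 0"
  shows "coord_form TC (omega1 ch F) (TC (x, v)) (y, u) W = hilb x (fst (W 0)) (y, u)"
proof -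
  define q where "q = \<psi> x y"
  define A where "A = cc x q q"
  have qU: "q \<in> U x" and qX: "q \<in> topspace X"
    using chart_chart_inv(2)[OF y] dom_subset[OF x] q_def by auto
  interpret minkowski "F q" by (rule minkowski_fibre[OF qX])
  have A: "linear A" unfolding A_def by (rule cc_linear[OF x qX qU center_in_chart[OF qX]])
  have Au: "A u \<noteq> 0"
    using cc_inverse[OF x qX qU center_in_chart[OF qX], of u] u linear_0[OF cc_linear[OF qX x center_in_chart[OF qX] qU]]
    by (auto simp: A_def)
  have inv: "chart_inv (TC (x, v)) (y, u) = (q, A u)"
    using tangent_chart_inv[OF x y] by (simp add: q_def A_def)
  have "coord_form TC (omega1 ch F) (TC (x, v)) (y, u) W
    = legendre1 (F q) (A u) (fst (coord_change (TC (x, v)) (TC (q, A u)) (q, A u) (W 0)))"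
    by (simp add: coord_form_def inv omega1_def tangent_map_fst[OF qX])
  also have "\<dots> = legendre1 (F q) (A u) (A (fst (W 0)))"
    using tangent_coord_change_fst[OF x y q_def, of v "A u" u "W 0"] by (simp add: A_def)
  also have "\<dots> = F q (A u) * DN (A u) (A (fst (W 0)))"
    by (rule legendre1_eq[OF Au])
  also have "DN (A u) (A (fst (W 0))) = \<D> (Fc x) (y, u) (0, fst (W 0))"
  proof -
    have "(Fc x has_derivative \<D> (Fc x) (y, u)) (at (y, u))"
      by (rule smooth_on_has_derivative[OF Fc_smooth[OF x]]) (use y u in simp)
    then have "((\<lambda>u. Fc x (y, u)) has_derivative (\<lambda>h. \<D> (Fc x) (y, u) (0, h))) (at u)"
      by (rule has_derivative_slice)
    moreover have "((\<lambda>u. F q (A u)) has_derivative (\<lambda>h. DN (A u) (A h))) (at u)"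
      by (rule has_derivative_compose[OF linear_imp_has_derivative[OF A] N_derivative[OF Au]])
    moreover have "(\<lambda>u. Fc x (y, u)) = (\<lambda>u. F q (A u))"
      by (simp add: Fc_def q_def A_def)
    ultimately have "(\<lambda>h. \<D> (Fc x) (y, u) (0, h)) = (\<lambda>h. DN (A u) (A h))"
      using has_derivative_unique by metis
    then show ?thesis by (rule fun_cong[symmetric])
  qed
  also have "F q (A u) = Fc x (y, u)"
    by (simp add: Fc_def q_def A_def)
  finally show ?thesis by (simp add: hilb_def)
qed

lemma hilb_derivative:
  assumes x: "x \<in> topspace X" and y: "y \<in> V x" and u: "u \<noteq> 0"
  shows "(hilb x b has_derivative \<D> (hilb x b) (y, u)) (at (y, u))"
proof -
  have p: "(y, u) \<in> V x \<times> (UNIV - {0})" using y u by simp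
  have "hilb x b differentiable at (y, u)"
    unfolding hilb_def using Fc_smooth[OF x] p
    by (intro differentiable_mult smooth_on_differentiable[OF _ p] smooth_on_frechet_derivative)
  then show ?thesis by (simp add: frechet_derivative_works)
qed

text \<open>The complement of the zero section is open, so \<open>coord_form_omega1\<close> holds
  near the point and can be differentiated there.\<close>

lemma ext_deriv_omega1:
  assumes x: "x \<in> topspace X" and v: "v \<noteq> 0"
  shows "ext_deriv TC 1 (omega1 ch F) (x, v) W =
    \<D> (hilb x (fst (W 1))) (\<phi> x x, v) (W 0)
    - \<D> (hilb x (fst (W 0))) (\<phi> x x, v) (W 1)"
proof -
  let ?S = "V x \<times> (UNIV - {0 :: 'e})"
  have S: "open ?S" by (intro open_Times open_image[OF x]) (simp add: open_delete)
  have z: "(\<phi> x x, v) \<in> ?S" using center_image[OF x] v by simp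
  have "\<D> (\<lambda>y. coord_form TC (omega1 ch F) (TC (x, v)) y W') (\<phi> x x, v)
    = \<D> (hilb x (fst (W' 0))) (\<phi> x x, v)" for W'
  proof (rule frechet_derivative_cong_open[OF S z])
    fix p assume "p \<in> ?S"
    then show "coord_form TC (omega1 ch F) (TC (x, v)) p W' = hilb x (fst (W' 0)) p"
      using coord_form_omega1[OF x, of "fst p" "snd p" v W'] by (simp add: mem_Times_iff)
  qed
  then show ?thesis
    by (simp add: ext_deriv_def tangent_chart_center[OF x])
qed

lemma hilb_zero:
  assumes x: "x \<in> topspace X" and v: "v \<noteq> 0"
  shows "\<D> (hilb x 0) (\<phi> x x, v) w = 0"
proof -
  let ?S = "V x \<times> (UNIV - {0 :: 'e})"
  have S: "open ?S" by (intro open_Times open_image[OF x]) (simp add: open_delete)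
  have z: "(\<phi> x x, v) \<in> ?S" using center_image[OF x] v by simp
  have "\<D> (hilb x 0) (\<phi> x x, v) = \<D> (\<lambda>p. 0) (\<phi> x x, v)"
  proof (rule frechet_derivative_cong_open[OF S z])
    fix p assume p: "p \<in> ?S"
    have "linear (\<D> (Fc x) p)"
      by (rule has_derivative_linear[OF smooth_on_has_derivative[OF Fc_smooth[OF x] p]])
    then show "hilb x 0 p = 0" by (simp add: hilb_def linear_0 flip: zero_prod_def)
  qed
  then show ?thesis by simp
qed

text \<open>On the fibre over the centre of the chart, \<open>hilb x b\<close> is the inner product
  of \<open>b\<close> with the Legendre transform, whose derivative is the Hessian.\<close>

lemma hilb_vertical:
  assumes x: "x \<in> topspace X" and v: "v \<noteq> 0"
  shows "\<D> (hilb x b) (\<phi> x x, v) (0, \<tau>) = smooth_norm.H (F x) v \<tau> \<bullet> b"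
proof -
  interpret minkowski "F x" by (rule minkowski_fibre[OF x])
  have "((\<lambda>u. hilb x b (\<phi> x x, u)) has_derivative (\<lambda>h. \<D> (hilb x b) (\<phi> x x, v) (0, h))) (at v)"
    by (rule has_derivative_slice[OF hilb_derivative[OF x center_image[OF x] v]])
  moreover have "((\<lambda>u. hilb x b (\<phi> x x, u)) has_derivative (\<lambda>h. H v h \<bullet> b)) (at v)"
  proof (rule has_derivative_transform_within_open)
    show "((\<lambda>u. L u \<bullet> b) has_derivative (\<lambda>h. H v h \<bullet> b)) (at v)"
      by (rule has_derivative_inner_left[OF L_derivative[OF v]])
    show "open (- {0 :: 'e})" "v \<in> - {0}" using v by auto
    fix u :: 'e assume "u \<in> - {0}"
    then have u: "u \<noteq> 0" by simp
    have "hilb x b (\<phi> x x, u) = coord_form TC (omega1 ch F) (TC (x, u)) (\<phi> x x, u) (\<lambda>_. (b, 0))"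
      using coord_form_omega1[OF x center_image[OF x] u, of u "\<lambda>_. (b, 0)"] by simp
    also have "\<dots> = legendre1 (F x) u b"
    proof -
      have "((\<lambda>u. Fc x (\<phi> x x, u)) has_derivative (\<lambda>h. \<D> (Fc x) (\<phi> x x, u) (0, h))) (at u)"
        by (rule has_derivative_slice, rule smooth_on_has_derivative[OF Fc_smooth[OF x]])
           (use u center_image[OF x] in simp)
      then have "(F x has_derivative (\<lambda>h. \<D> (Fc x) (\<phi> x x, u) (0, h))) (at u)"
        by (simp add: Fc_center[OF x])
      then have "\<D> (Fc x) (\<phi> x x, u) (0, b) = DN u b"
        by (simp add: frechet_derivative_eqI)
      then show ?thesis
        using coord_form_omega1[OF x center_image[OF x] u, of u "\<lambda>_. (b, 0)"]
        by (simp add: hilb_def Fc_center[OF x] legendre1_eq[OF u])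
    qed
    finally show "L u \<bullet> b = hilb x b (\<phi> x x, u)" by (simp add: legendre1_L[OF u])
  qed
  ultimately have "(\<lambda>h. \<D> (hilb x b) (\<phi> x x, v) (0, h)) = (\<lambda>h. H v h \<bullet> b)"
    by (rule has_derivative_unique)
  then show ?thesis by (rule fun_cong)
qed

end

text \<open>For \<open>a = 0\<close> no \<open>f\<close> satisfies \<open>0 < a f\<close>, so the
  density takes its default value 0. Points of the unit bundle therefore carry nonzero
  \<open>k\<close>-vectors.\<close>

lemma HT_density_nonzero:
  assumes "HT_density k N a \<noteq> 0" shows "\<exists>\<xi>. a \<xi> \<noteq> 0"
proof (rule ccontr)
  assume "\<not> ?thesis"
  then have "\<not> has_proj_integral k N a I" for I by (auto simp: has_proj_integral_def)
  then show False using assms by (simp add: HT_density_def Ex1_def)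
qed

lemma push_kvec_id: "push_kvec (\<lambda>u. u) a = a"
  by (simp add: push_kvec_def blinfun_apply_inverse)

lemma tangent_space_mono: "S \<subseteq> T \<Longrightarrow> tspace S p \<subseteq> tspace T p"
  unfolding tangent_space_def velocity_at_flat by (auto elim!: eventually_mono)

text \<open>The component of the velocity orthogonal to \<open>W\<close> is the derivative of a
  function vanishing along the curve.\<close>

lemma tangent_space_subspace:
  fixes W :: "'e::euclidean_space set"
  assumes W: "subspace W" and w: "w \<in> tspace W p"
  shows "w \<in> W"
proof -
  obtain \<gamma> where \<gamma>: "\<forall>\<^sub>F t in nhds 0. \<gamma> t \<in> W" "(\<gamma> has_vector_derivative w) (at (0::real))"
    using w by (auto simp: tangent_space_def velocity_at_flat)
  obtain T where T: "open T" "0 \<in> T" "\<And>t. t \<in> T \<Longrightarrow> \<gamma> t \<in> W"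
    using \<gamma>(1) unfolding eventually_nhds by auto
  have sp: "span W = W" using W by (simp add: span_eq_iff)
  obtain y z where yz: "y \<in> span W" "\<And>w. w \<in> span W \<Longrightarrow> Linear_Algebra.orthogonal z w" "w = y + z"
    using orthogonal_subspace_decomp_exists[of W w] by blast
  have "((\<lambda>t. z \<bullet> \<gamma> t) has_vector_derivative z \<bullet> w) (at 0)"
    by (rule bounded_linear.has_vector_derivative[OF bounded_linear_inner_right \<gamma>(2)])
  moreover have "((\<lambda>t. z \<bullet> \<gamma> t) has_vector_derivative 0) (at 0)"
    by (rule has_vector_derivative_transform_within_open[of "\<lambda>t. 0" _ _ T])
       (use T yz(2) sp in \<open>auto simp: Linear_Algebra.orthogonal_def\<close>)
  ultimately have "z \<bullet> w = 0" by (rule vector_derivative_unique_at)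
  then have "z = 0" using yz(2)[OF yz(1)] yz(3) by (simp add: inner_add_right Linear_Algebra.orthogonal_def)
  then show ?thesis using yz sp by simp
qed

lemma kwedge_cong: "(\<And>i. i < k \<Longrightarrow> \<xi> i = \<xi>' i) \<Longrightarrow> kwedge k w \<xi> = kwedge k w \<xi>'"
  unfolding kwedge_def by (intro sum.cong refl arg_cong2[where f = "(*)"] prod.cong) auto

section \<open>Sections, lifts and the integrand\<close>

context finsler
begin

lemma section_point:
  assumes sec: "local_section k X ch F D \<sigma>" and q: "q \<in> D"
  shows "q \<in> topspace X" "fst (\<sigma> q) = q" "snd (\<sigma> q) \<in> simple_kvecs k" "\<exists>\<xi>. snd (\<sigma> q) \<xi> \<noteq> 0"
proof -
  have D: "openin X D" and \<sigma>: "\<sigma> q \<in> HT_unit_bundle k X F" "fst (\<sigma> q) = q"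
    using sec q by (auto simp: local_section_def)
  show "q \<in> topspace X" using D q openin_subset by blast
  show "fst (\<sigma> q) = q" by (rule \<sigma>)
  show "snd (\<sigma> q) \<in> simple_kvecs k" using \<sigma> by (auto simp: HT_unit_bundle_def)
  have "HT_density k (F q) (snd (\<sigma> q)) = 1" using \<sigma> by (auto simp: HT_unit_bundle_def)
  then show "\<exists>\<xi>. snd (\<sigma> q) \<xi> \<noteq> 0" by (intro HT_density_nonzero[of k "F q"]) simp
qed

lemma section_subspace:
  assumes "local_section k X ch F D \<sigma>" "q \<in> D"
  shows "subspace (kplane k (snd (\<sigma> q)))"
  using section_point(3,4)[OF assms] subspace_kplane by blast

text \<open>Since \<open>tangent_lift\<close> is a choice, its properties rest on existence. The
  lift is the velocity of a field of unit vectors in the planes of \<open>\<sigma>\<close>, followed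
  along a straight line of the chart in direction \<open>u\<close>.\<close>

lemma tangent_lift_exists:
  assumes sec: "local_section k X ch F D \<sigma>" and x: "x \<in> D"
    and v: "F x v = 1" "v \<in> kplane k (snd (\<sigma> x))"
  shows "\<exists>w. w \<in> tangent_space TC (U_bundle k X F D \<sigma>) (x, v) \<and> fst w = u"
proof -
  let ?U = "U_bundle k X F D \<sigma>"
  note P = section_point[OF sec]
  have xX: "x \<in> topspace X" by (rule P(1)[OF x])
  interpret Fx: minkowski "F x" by (rule minkowski_fibre[OF xX])
  have v0: "v \<noteq> 0" by (rule Fx.unit_nonzero[OF v(1)])
  obtain \<eta> c where vc: "v = (\<Sum>j<k. c j *\<^sub>R contr (snd (\<sigma> x)) \<eta> j)"
    using P(3,4)[OF x] kplane_contr v(2) by blast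
  define A where "A y = coord_kvec ch (ch x) (\<sigma> (\<psi> x y))" for y
  \<comment> \<open>Covectors and coefficients are frozen at \<open>x\<close> and only the
    \<open>k\<close>-vector moves. So \<open>vt\<close> is differentiable at the centre and stays in
    the coordinate image of the moving plane.\<close>
  define vt where "vt y = (\<Sum>j<k. c j *\<^sub>R contr (A y) \<eta> j)" for y
  define y0 where "y0 = \<phi> x x"
  define S where "S = \<phi> x ` (U x \<inter> D)"
  have xU: "x \<in> U x" by (rule center_in_chart[OF xX])
  have D: "openin X D" using sec by (simp add: local_section_def)
  have S: "open S" "y0 \<in> S"
    unfolding S_def y0_def using xX xU x D by (auto intro!: open_chart_image openin_Int openin_dom)
  have A_smooth: "smooth_on S (\<lambda>y. A y \<xi>)" for \<xi>
    using sec xX by (simp add: local_section_def S_def A_def)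
  have vt_diff: "vt differentiable at y0"
    unfolding vt_def contr_def
    by (intro differentiable_sum differentiable_scaleR differentiable_const
        smooth_on_differentiable[OF A_smooth S(2)] finite_lessThan finite_Basis ballI)
  have "cc x x x = (\<lambda>u. u)" using cc_self[OF xX xU] by auto
  then have "A y0 = snd (\<sigma> x)"
    by (simp add: A_def y0_def chart_inv_chart[OF xX xU] coord_kvec_def P(2)[OF x] push_kvec_id)
  then have vt0: "vt y0 = v" by (simp add: vt_def vc)
  \<comment> \<open>The Finsler norm of \<open>vt y\<close>. It is 1 at the centre and positive
    nearby, so dividing by it gives unit vectors.\<close>
  define n where "n y = Fc x (y, vt y)" for y
  have n0: "n y0 = 1" by (simp add: n_def vt0) (simp add: y0_def Fc_center[OF xX] v(1))
  have n_diff: "n differentiable at y0"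
  proof -
    have Fc_der: "(Fc x has_derivative \<D> (Fc x) (y0, vt y0)) (at (y0, vt y0))"
      by (rule smooth_on_has_derivative[OF Fc_smooth[OF xX]])
         (use vt0 v0 center_image[OF xX] in \<open>simp add: y0_def\<close>)
    have "((\<lambda>y. (y, vt y)) has_derivative (\<lambda>h. (h, \<D> vt y0 h))) (at y0)"
      using vt_diff by (intro has_derivative_Pair has_derivative_ident) (simp add: frechet_derivative_works)
    then show ?thesis
      using Fc_der unfolding n_def by (intro differentiableI[OF has_derivative_compose[where f = "\<lambda>y. (y, vt y)" and g = "Fc x"]])
  qed
  define w where "w y = vt y /\<^sub>R n y" for y
  have "w differentiable at y0"
    unfolding w_def using n0 n_diff vt_diff
    by (intro differentiable_scaleR differentiable_inverse) auto
  then have w_der: "(w has_derivative \<D> w y0) (at y0)"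
    by (simp add: frechet_derivative_works)
  have w0: "w y0 = v" by (simp add: w_def n0 vt0)
  \<comment> \<open>The inverse bundle chart turns the coordinate field into vectors in the charts
    of the moving points, the form in which \<open>U_bundle\<close> describes them.\<close>
  define \<gamma> where "\<gamma> t = chart_inv (TC (x, v)) (y0 + t *\<^sub>R u, w (y0 + t *\<^sub>R u))" for t
  have lim: "((\<lambda>t. y0 + t *\<^sub>R u) \<longlongrightarrow> y0) (nhds 0)"
  proof -
    have "((\<lambda>t. y0 + t *\<^sub>R u) \<longlongrightarrow> y0 + 0 *\<^sub>R u) (nhds 0)"
      by (intro tendsto_intros) (simp add: filterlim_ident)
    then show ?thesis by simp
  qed
  have "\<forall>\<^sub>F t in nhds 0. y0 + t *\<^sub>R u \<in> S"
    by (rule topological_tendstoD[OF lim S])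
  moreover have "\<forall>\<^sub>F t in nhds 0. 0 < n (y0 + t *\<^sub>R u)"
  proof -
    have "isCont n y0" by (rule differentiable_imp_continuous_within[OF n_diff])
    then have "((\<lambda>t. n (y0 + t *\<^sub>R u)) \<longlongrightarrow> n y0) (nhds 0)"
      by (rule isCont_tendsto_compose[OF _ lim])
    then show ?thesis by (rule order_tendstoD) (simp add: n0)
  qed
  ultimately have ev: "\<forall>\<^sub>F t in nhds 0. \<gamma> t \<in> ?U \<inter> dom_chart (TC (x, v)) \<and>
      snd (TC (x, v)) (\<gamma> t) = (y0 + t *\<^sub>R u, w (y0 + t *\<^sub>R u))"
  proof eventually_elim
    case (elim t)
    define y where "y = y0 + t *\<^sub>R u"
    obtain q where q: "y = \<phi> x q" "q \<in> U x" "q \<in> D" using elim(1) unfolding S_def y_def[symmetric] by auto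
    have qX: "q \<in> topspace X" by (rule P(1)[OF q(3)])
    have qU: "q \<in> U q" by (rule center_in_chart[OF qX])
    have \<psi>y: "\<psi> x y = q" using chart_inv_chart[OF xX q(2)] q(1) by simp
    have yV: "y \<in> V x" using q by auto
    define B where "B = cc x q q"
    define T where "T = cc q x q"
    have BT: "B (T z) = z" "T (B z) = z" for z
      unfolding B_def T_def using cc_inverse[OF qX xX qU q(2)] cc_inverse[OF xX qX q(2) qU] by auto
    have lin: "linear B" "linear T"
      unfolding B_def T_def using cc_linear[OF xX qX q(2) qU] cc_linear[OF qX xX qU q(2)] by auto
    have \<gamma>t: "\<gamma> t = (q, B (w y))"
      using tangent_chart_inv[OF xX yV, of v "w y"] by (simp add: \<gamma>_def y_def[symmetric] \<psi>y B_def)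
    obtain \<xi> where \<xi>: "snd (\<sigma> q) \<xi> \<noteq> 0" using P(4)[OF q(3)] by blast
    note sub = section_subspace[OF sec q(3)]
    have "A y = push_kvec T (snd (\<sigma> q))"
      by (simp add: A_def \<psi>y coord_kvec_def P(2)[OF q(3)] T_def)
    then have "contr (A y) \<eta> j \<in> T ` kplane k (snd (\<sigma> q))" if "j < k" for j
      using contr_push_kvec_in_image[OF P(3)[OF q(3)] \<xi> lin(2) that] by simp
    then have "vt y \<in> T ` kplane k (snd (\<sigma> q))"
      unfolding vt_def using linear_subspace_image[OF lin(2) sub]
      by (intro subspace_sum subspace_scale) auto
    then have Bvt: "B (vt y) \<in> kplane k (snd (\<sigma> q))" using BT by auto
    have ny: "n y = F q (B (vt y))" by (simp add: n_def Fc_def \<psi>y B_def)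
    have npos: "0 < n y" using elim(2) by (simp add: y_def)
    interpret Fq: minkowski "F q" by (rule minkowski_fibre[OF qX])
    have Bw: "B (w y) = B (vt y) /\<^sub>R n y" using lin(1) by (simp add: w_def linear_cmul)
    have "F q (B (w y)) = 1" using npos by (simp add: Bw Fq.N_scale ny)
    moreover have "B (w y) \<in> kplane k (snd (\<sigma> q))"
      unfolding Bw by (rule subspace_scale[OF sub Bvt])
    ultimately have "\<gamma> t \<in> ?U"
      using q(3) qX by (simp add: \<gamma>t U_bundle_def unit_bundle_def)
    moreover have "\<gamma> t \<in> dom_chart (TC (x, v))"
      using q(2) by (simp add: \<gamma>t tangent_chart_def)
    moreover have "snd (TC (x, v)) (\<gamma> t) = (y, w y)"
      using BT(2)[of "w y"] q(1) by (simp add: \<gamma>t tangent_chart_apply T_def)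
    ultimately show ?case by (simp add: y_def)
  qed
  have \<gamma>0: "\<gamma> 0 = (x, v)"
    using tangent_chart_inv[OF xX center_image[OF xX], of v v] chart_inv_chart[OF xX xU] cc_self[OF xX xU]
    by (simp add: \<gamma>_def w0) (simp add: y0_def)
  have "((\<lambda>t. (y0 + t *\<^sub>R u, w (y0 + t *\<^sub>R u))) has_vector_derivative (u, \<D> w y0 u)) (at 0)"
  proof -
    have 1: "((\<lambda>t. y0 + t *\<^sub>R u) has_vector_derivative u) (at 0)"
      by (auto intro!: derivative_eq_intros simp: has_vector_derivative_def)
    have 2: "((\<lambda>t. w (y0 + t *\<^sub>R u)) has_vector_derivative \<D> w y0 u) (at 0)"
      by (rule vector_derivative_compose[OF 1]) (simp add: w_der)
    show ?thesis by (rule has_vector_derivative_Pair[OF 1 2])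
  qed
  moreover obtain T where T: "open T" "0 \<in> T"
    "\<And>t. t \<in> T \<Longrightarrow> snd (TC (x, v)) (\<gamma> t) = (y0 + t *\<^sub>R u, w (y0 + t *\<^sub>R u))"
    using ev unfolding eventually_nhds by blast
  ultimately have "((\<lambda>t. snd (TC (x, v)) (\<gamma> t)) has_vector_derivative (u, \<D> w y0 u)) (at 0)"
    using has_vector_derivative_transform_within_open[of _ _ 0 T "\<lambda>t. snd (TC (x, v)) (\<gamma> t)"] by auto
  moreover have "\<forall>\<^sub>F t in nhds 0. \<gamma> t \<in> ?U \<inter> dom_chart (TC (x, v))"
    using ev by (rule eventually_mono) simp
  ultimately have "velocity_at TC (?U) \<gamma> (x, v) (u, \<D> w y0 u)"
    using \<gamma>0 by (simp add: velocity_at_def)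
  then show ?thesis
    unfolding tangent_space_def by (intro exI[of _ "(u, \<D> w y0 u)"]) auto
qed

lemma fst_tangent_lift:
  assumes "local_section k X ch F D \<sigma>" "x \<in> D" "F x v = 1" "v \<in> kplane k (snd (\<sigma> x))"
  shows "fst (tangent_lift ch (U_bundle k X F D \<sigma>) (x, v) u) = u"
proof -
  have xX: "x \<in> topspace X" by (rule section_point(1)[OF assms(1,2)])
  have "\<exists>w. w \<in> tangent_space TC (U_bundle k X F D \<sigma>) (x, v) \<and> tangent_map TC ch fst (x, v) w = u"
    using tangent_lift_exists[OF assms] by (simp add: tangent_map_fst[OF xX])
  then have "tangent_map TC ch fst (x, v) (tangent_lift ch (U_bundle k X F D \<sigma>) (x, v) u) = u"
    unfolding tangent_lift_def by (rule someI2_ex) blast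
  then show ?thesis by (simp add: tangent_map_fst[OF xX])
qed

text \<open>In \<open>be\<close> with second argument vertical, \<open>hilb_zero\<close> removes the
  first term and \<open>hilb_vertical\<close> evaluates the other, which carries a minus sign. The
  \<open>j\<close> factors thus give \<open>(- 1) ^ j\<close>, and the sum over permutations is a
  wedge evaluated on Legendre covectors.\<close>

lemma omega1_power_eq:
  assumes x: "x \<in> topspace X" and v: "v \<noteq> 0"
    and b: "\<And>i. i \<le> j \<Longrightarrow> fst (w i) = b i" and \<tau>: "\<And>i. w (Suc j + i) = (0, \<tau> i)"
  shows "omega1_power (Suc j) ch F (x, v) w = (- 1) ^ (j * (j - 1) div 2) * fact j * (- 1) ^ j *
    kwedge (Suc j) b (case_nat (smooth_norm.LL (F x) v) (\<lambda>i. blinfun_inner_right (smooth_norm.H (F x) v (\<tau> i))))"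
proof -
  interpret minkowski "F x" by (rule minkowski_fibre[OF x])
  let ?\<xi> = "case_nat (LL v) (\<lambda>i. blinfun_inner_right (H v (\<tau> i)))"
  define om where "om W = L v \<bullet> fst W" for W :: "'e \<times> 'e"
  define be where "be W W' = \<D> (hilb x (fst W')) (\<phi> x x, v) W
    - \<D> (hilb x (fst W)) (\<phi> x x, v) W'" for W W'
  let ?B = "\<lambda>r. \<Prod>i<j. be (w (r (i + 1))) (w (j + 1 + i))"
  have fst0: "fst (w a) = 0" if "j < a" for a
    using \<tau>[of "a - Suc j"] that by simp
  have om: "omega1 ch F (x, v) w = om (w 0)" for w
    by (simp add: omega1_def tangent_map_fst[OF x] legendre1_L[OF v] om_def)
  have be: "ext_deriv TC 1 (omega1 ch F) (x, v) w = be (w 0) (w 1)" for w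
    unfolding be_def by (rule ext_deriv_omega1[OF x v])
  have "omega1_power (Suc j) ch F (x, v) w
    = wedge 1 (2 * j) (omega1 ch F (x, v)) (wedge_power 2 (ext_deriv TC 1 (omega1 ch F) (x, v)) j) w"
    by (simp add: omega1_power_def)
  also have "\<dots> = (- 1) ^ (j * (j - 1) div 2) * fact j *
      (\<Sum>r | r permutes {..<j + 1}. of_int (sign r) *
        (om (w (r 0)) * ?B r))"
  proof (rule wedge_one_power_vertical[where om = om and be = be])
    show "om (w a) = 0" if "j < a" for a using fst0[OF that] by (simp add: om_def)
    show "be (w a) (w b) = 0" if "j < a" "j < b" for a b
      using fst0[OF that(1)] fst0[OF that(2)] by (simp add: be_def hilb_zero[OF x v])
    show "be u v = - be v u" for u v by (simp add: be_def)
  qed (rule om, rule be)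
  also have "(\<Sum>r | r permutes {..<j + 1}. of_int (sign r) *
        (om (w (r 0)) * ?B r))
    = (\<Sum>r | r permutes {..<Suc j}. (- 1) ^ j * (of_int (sign r) *
        (\<Prod>i<Suc j. blinfun_apply (?\<xi> i) (b (r i)))))"
  proof (rule sum.cong)
    fix r assume "r \<in> {r. r permutes {..<Suc j}}"
    then have r: "r i \<le> j" if "i \<le> j" for i
      using permutes_in_image[of r "{..<Suc j}" i] that by auto
    have bb: "be (w (r (i + 1))) (w (j + 1 + i)) = (- 1) * (H v (\<tau> i) \<bullet> b (r (Suc i)))" if i: "i < j" for i
    proof -
      have "w (j + 1 + i) = (0, \<tau> i)" using \<tau>[of i] by simp
      then show ?thesis
        using b[OF r[of "i + 1"]] i by (simp add: be_def hilb_zero[OF x v] hilb_vertical[OF x v])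
    qed
    have "?B r = (\<Prod>i<j. (- 1) * (H v (\<tau> i) \<bullet> b (r (Suc i))))"
      by (rule prod.cong[OF refl]) (rule bb, simp)
    also have "\<dots> = (- 1) ^ j * (\<Prod>i<j. H v (\<tau> i) \<bullet> b (r (Suc i)))"
      by (simp only: prod.distrib prod_constant card_lessThan)
    finally have pr: "?B r = (- 1) ^ j * (\<Prod>i<j. H v (\<tau> i) \<bullet> b (r (Suc i)))" .
    have "om (w (r 0)) = L v \<bullet> b (r 0)" using b[OF r[of 0]] by (simp add: om_def)
    then show "of_int (sign r) * (om (w (r 0)) * ?B r)
      = (- 1) ^ j * (of_int (sign r) *
        (\<Prod>i<Suc j. blinfun_apply (?\<xi> i) (b (r i))))"
      unfolding pr by (simp add: prod.lessThan_Suc_shift LL_apply del: prod.lessThan_Suc)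
  qed simp
  also have "\<dots> = (- 1) ^ j * kwedge (Suc j) b ?\<xi>"
    by (simp only: kwedge_def sum_distrib_left)
  finally show ?thesis by (simp only: mult.assoc)
qed

text \<open>\<open>Theta\<close> depends on tangent vectors only through their base part, and
  \<open>fst \<circ> \<sigma>\<close> is the identity on \<open>D\<close>.\<close>

lemma pullback_Theta:
  assumes sec: "local_section k X ch F D \<sigma>" and x: "x \<in> D"
  shows "pullback_section ch \<sigma> (Theta k F) x b = busemann_form k (F x) (snd (\<sigma> x)) (kwedge k b)"
proof -
  note P = section_point[OF sec]
  have xX: "x \<in> topspace X" by (rule P(1)[OF x])
  have xU: "x \<in> U x" by (rule center_in_chart[OF xX])
  let ?S = "\<phi> x ` (U x \<inter> D)"
  have D: "openin X D" using sec by (simp add: local_section_def)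
  have "((\<phi> x \<circ> (fst \<circ> \<sigma>) \<circ> \<psi> x) has_derivative (\<lambda>h. h)) (at (\<phi> x x))"
  proof (rule has_derivative_transform_within_open[OF has_derivative_ident])
    show "open ?S" using xX D by (auto intro!: open_chart_image openin_Int openin_dom)
    show "\<phi> x x \<in> ?S" using xU x by auto
    show "y = (\<phi> x \<circ> (fst \<circ> \<sigma>) \<circ> \<psi> x) y" if "y \<in> ?S" for y
      using that P(2) chart_inv_chart[OF xX] by auto
  qed
  then have "tangent_map ch ch (fst \<circ> \<sigma>) x u = u" for u
    by (simp add: tangent_map_def P(2)[OF x] frechet_derivative_eqI)
  then show ?thesis
    by (simp add: pullback_section_def Theta_def kvec_tangent_map_def P(2)[OF x])
qed

end

section \<open>Comparison of the two integrals\<close>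

theorem proposition20:
  fixes X :: "'m topology"
    and ch :: "'m \<Rightarrow> ('m, 'e::euclidean_space) chart"
    and F :: "'m \<Rightarrow> 'e \<Rightarrow> real"
    and k :: nat
    and D :: "'m set"
    and \<sigma> :: "'m \<Rightarrow> 'm \<times> 'e kvec"
  assumes "finsler_manifold X ch F"
    and "1 \<le> k"
    and "local_section k X ch F D \<sigma>"
  shows "\<forall>x\<in>D. \<forall>b :: nat \<Rightarrow> 'e.
    pullback_section ch \<sigma> (Theta k F) x b =
      (- 1) ^ (k * (k + 1) div 2) / (fact k * unit_ball_vol (real k)) *
      fibre_integral k ch (U_bundle k X F D \<sigma>) \<sigma> (omega1_power k ch F) x b"
proof (intro ballI allI)
  fix x and b :: "nat \<Rightarrow> 'e" assume x: "x \<in> D"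
  obtain j where k: "k = Suc j" using \<open>1 \<le> k\<close> by (cases k) auto
  have k1: "k - 1 = j" by (simp add: k)
  interpret finsler X ch F by unfold_locales (rule assms(1))
  note sec = assms(3)
  note P = section_point[OF sec x]
  interpret minkowski "F x" by (rule minkowski_fibre[OF P(1)])
  define a where "a = snd (\<sigma> x)"
  obtain \<xi>\<^sub>0 where a: "a \<in> simple_kvecs k" "a \<xi>\<^sub>0 \<noteq> 0" using P(3,4) by (auto simp: a_def)
  have W: "subspace (kplane k a)" by (rule subspace_kplane[OF a])
  define S where "S = {v. F x v = 1 \<and> v \<in> kplane k a}"
  have S0: "S \<subseteq> - {0}" using unit_nonzero by (auto simp: S_def)
  have fib: "{v. (x, v) \<in> U_bundle k X F D \<sigma>} = S"
    using x P(1) by (auto simp: U_bundle_def unit_bundle_def S_def a_def)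
  define \<eta> where "\<eta> v \<tau> = omega1_power k ch F (x, v) (\<lambda>i. if i < k then tangent_lift ch (U_bundle k X F D \<sigma>) (x, v) (b i)
          else tangent_map flat_chart TC (\<lambda>w. (x, w)) v (\<tau> (i - k)))" for v \<tau>
  \<comment> \<open>The sign produced by \<open>omega1_power_eq\<close>, equal to
    (-1)^(k(k-1)/2).\<close>
  define s :: real where "s = (- 1) ^ (j * (j - 1) div 2) * (- 1) ^ j"
  let ?\<beta> = "euler_contraction (kwedge k b)"
  have ss: "s * s = 1" unfolding s_def by (simp add: power_mult_distrib[symmetric] mult.commute mult.left_commute)
  \<comment> \<open>Ratio of the signed integrands: \<open>(- 1) ^ k\<close> compares the
    orientations, \<open>s\<close> is its own inverse, and \<open>fact j\<close> is the multiplicity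
    in the wedge power.\<close>
  define C where "C = (- 1) ^ k * s / fact j"
  have C0: "C \<noteq> 0" by (simp add: C_def s_def)
  have form: "sing_ori a (LL v) \<tau>' * ?\<beta> (LL v) \<tau>' = C * (fibre_ori k a v \<tau> * \<eta> v \<tau>)"
    if v: "v \<in> S" and \<tau>: "\<And>i. i < j \<Longrightarrow> \<tau> i \<in> tspace S v"
      and indep: "\<And>c. (\<Sum>i<j. c i *\<^sub>R \<tau> i) = 0 \<Longrightarrow> \<forall>i<j. c i = 0"
      and \<tau>': "\<And>i. i < j \<Longrightarrow> \<tau>' i = blinfun_inner_right (H v (\<tau> i))" for v \<tau> \<tau>'
  proof -
    have v1: "F x v = 1" "v \<in> kplane k a" using v by (auto simp: S_def)
    have v0: "v \<noteq> 0" by (rule unit_nonzero[OF v1(1)])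
    have L\<tau>: "L v \<bullet> \<tau> i = 0" if "i < j" for i
      using \<tau>[OF that] tangent_space_mono[of S "unit_sphere (F x)" v] tangent_space_sphere[OF v1(1)]
      by (auto simp: S_def unit_sphere_def)
    have W\<tau>: "\<tau> i \<in> kplane k a" if "i < j" for i
      using \<tau>[OF that] tangent_space_mono[of S "kplane k a" v] tangent_space_subspace[OF W]
      by (auto simp: S_def)
    let ?\<xi> = "case_nat (LL v) \<tau>'" and ?u = "\<lambda>i. if i < k - 1 then \<tau> i else - v"
    have sgn: "sgn (a ?\<xi>) = (- 1) ^ Suc j * frame_sign (Suc j) a ?u"
    proof (rule sgn_kwedge_frame_sign[OF a[unfolded k]])
      show "?u i \<in> kplane (Suc j) a" if "i < Suc j" for i
        using W\<tau>[of i] v1(2) W that by (auto simp: k subspace_neg)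
      show "?\<xi> 0 (?u l) = 0" if "l < j" for l
        using L\<tau>[OF that] that by (simp add: k LL_apply)
      show "?\<xi> 0 (?u j) = - 1"
        using L_self[OF v0] v1(1) by (simp add: k LL_apply)
      \<comment> \<open>The matrix in question is the Gram matrix of the \<open>\<tau> i\<close> for
        the Hessian at \<open>v\<close>. Their independence makes it definite.\<close>
      fix c :: "nat \<Rightarrow> real" assume c: "\<exists>i<j. c i \<noteq> 0"
      define z where "z = (\<Sum>i<j. c i *\<^sub>R \<tau> i)"
      have "z \<noteq> 0" using indep[of c] c by (auto simp: z_def)
      then have "0 < H v z \<bullet> z" by (rule H_pos[OF v0])
      also have "H v z \<bullet> z = (\<Sum>i<j. \<Sum>l<j. c i * (H v (\<tau> i) \<bullet> \<tau> l) * c l)"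
        using H_linear[OF v0]
        by (simp add: z_def linear_sum linear_cmul inner_sum_left inner_sum_right sum_distrib_left ac_simps)
           (intro sum.cong refl, subst H_symmetric[OF v0], rule refl)
      also have "\<dots> = (\<Sum>i<j. \<Sum>l<j. c i * ?\<xi> (Suc i) (?u l) * c l)"
        by (intro sum.cong refl) (simp add: k \<tau>')
      finally show "0 < (\<Sum>i<j. \<Sum>l<j. c i * ?\<xi> (Suc i) (?u l) * c l)" .
    qed
    have "\<eta> v \<tau> = (- 1) ^ (j * (j - 1) div 2) * fact j * (- 1) ^ j *
      kwedge (Suc j) b (case_nat (LL v) (\<lambda>i. blinfun_inner_right (H v (\<tau> i))))"
      unfolding \<eta>_def k
    proof (rule omega1_power_eq[OF P(1) v0])
      show "fst (if i < Suc j then tangent_lift ch (U_bundle (Suc j) X F D \<sigma>) (x, v) (b i)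
          else tangent_map flat_chart TC (\<lambda>w. (x, w)) v (\<tau> (i - Suc j))) = b i" if "i \<le> j" for i
        using fst_tangent_lift[OF sec x v1(1) v1(2)[unfolded a_def]] that by (simp add: k)
      show "(if Suc j + i < Suc j then tangent_lift ch (U_bundle (Suc j) X F D \<sigma>) (x, v) (b (Suc j + i))
          else tangent_map flat_chart TC (\<lambda>w. (x, w)) v (\<tau> (Suc j + i - Suc j))) = (0, \<tau> i)" for i
        by (simp add: tangent_map_vertical[OF P(1)])
    qed
    also have "kwedge (Suc j) b (case_nat (LL v) (\<lambda>i. blinfun_inner_right (H v (\<tau> i)))) = kwedge k b ?\<xi>"
      unfolding k by (rule kwedge_cong) (auto simp: \<tau>' split: nat.split)
    finally have \<eta>v: "\<eta> v \<tau> = s * fact j * kwedge k b ?\<xi>" by (simp add: s_def)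
    have "C * (fibre_ori k a v \<tau> * \<eta> v \<tau>) = (s * s) * ((- 1) ^ k * fibre_ori k a v \<tau>) * kwedge k b ?\<xi>"
      by (simp add: \<eta>v C_def)
    also have "\<dots> = sgn (a ?\<xi>) * kwedge k b ?\<xi>"
      using sgn by (simp add: ss fibre_ori_def k)
    finally show ?thesis by (simp add: sing_ori_def euler_contraction_def)
  qed
  interpret LD: diffeo S "LL ` S" LL GG "\<lambda>v w. blinfun_inner_right (H v w)"
    by (rule diffeo_LL[OF S0])
  interpret GD: diffeo "LL ` S" S GG LL "\<lambda>\<xi> \<eta>. K (GG \<xi>) (riesz \<eta>)"
    by (rule diffeo_GG[OF S0])
  have GGS: "GG ` LL ` S \<subseteq> S"
  proof clarify
    fix v assume "v \<in> S"
    moreover from this have "v \<noteq> 0" using S0 by auto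
    ultimately show "GG (LL v) \<in> S" by (simp add: GG_LL)
  qed
  have "form_integral j (LL ` S) (sing_ori a) ?\<beta>
    = C * form_integral j S (fibre_ori k a) \<eta>"
  proof (rule form_integral_scale[OF C0])
    fix I assume I: "has_form_integral j S (fibre_ori k a) \<eta> I"
    show "has_form_integral j (LL ` S) (sing_ori a) ?\<beta> (C * I)"
      by (rule LD.has_form_integral_transport[OF _ I]) (rule form)
  next
    fix I assume I: "has_form_integral j (LL ` S) (sing_ori a) ?\<beta> I"
    have "has_form_integral j S (fibre_ori k a) \<eta> ((1 / C) * I)"
    proof (rule GD.has_form_integral_transport[OF _ I])
      fix \<zeta> \<tau> \<tau>'
      assume \<zeta>: "\<zeta> \<in> LL ` S" and \<tau>: "\<And>i. i < j \<Longrightarrow> \<tau> i \<in> tspace (LL ` S) \<zeta>"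
        and indep: "\<And>c. (\<Sum>i<j. c i *\<^sub>R \<tau> i) = 0 \<Longrightarrow> \<forall>i<j. c i = 0"
        and \<tau>': "\<And>i. i < j \<Longrightarrow> \<tau>' i = K (GG \<zeta>) (riesz (\<tau> i))"
      obtain v where v: "v \<in> S" "\<zeta> = LL v" using \<zeta> by auto
      have v0: "v \<noteq> 0" using v S0 by auto
      have Gv: "GG \<zeta> = v" using v GG_LL[OF v0] by simp
      have inv: "\<tau> i = blinfun_inner_right (H v (\<tau>' i))" if "i < j" for i
        using \<tau>'[OF that] by (simp add: Gv H_K[OF v0] blinfun_inner_riesz)
      \<comment> \<open>The same pointwise identity serves backwards: \<open>\<tau>\<close> is the
        image under the Hessian of the pulled back frame \<open>\<tau>'\<close>, which is tangent to
        \<open>S\<close> and independent.\<close>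
      have "sing_ori a (LL v) \<tau> * ?\<beta> (LL v) \<tau> = C * (fibre_ori k a v \<tau>' * \<eta> v \<tau>')"
      proof (rule form[OF v(1)])
        fix i assume i: "i < j"
        have "K (GG \<zeta>) (riesz (\<tau> i)) \<in> tspace S (GG \<zeta>)"
          by (rule tangent_space_map[OF GD.der[OF \<zeta>] GGS \<tau>[OF i]])
        then show "\<tau>' i \<in> tspace S v" using \<tau>'[OF i] Gv by simp
        show "\<tau> i = blinfun_inner_right (H v (\<tau>' i))" by (rule inv[OF i])
      next
        fix c assume c: "(\<Sum>i<j. c i *\<^sub>R \<tau>' i) = 0"
        have "(\<Sum>i<j. c i *\<^sub>R \<tau> i) = blinfun_inner_right (H v (\<Sum>i<j. c i *\<^sub>R \<tau>' i))"
          by (simp add: linear_sum[OF LD.linear[OF v(1)]] linear_cmul[OF LD.linear[OF v(1)]] inv)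
        also have "\<dots> = 0" using LD.linear[OF v(1)] unfolding c by (rule linear_0)
        finally show "\<forall>i<j. c i = 0" by (rule indep)
      qed
      then show "fibre_ori k a (GG \<zeta>) \<tau>' * \<eta> (GG \<zeta>) \<tau>'
        = 1 / C * (sing_ori a \<zeta> \<tau> * ?\<beta> \<zeta> \<tau>)"
        using C0 unfolding Gv unfolding v(2) by simp
    qed
    then show "has_form_integral j S (fibre_ori k a) \<eta> (I / C)" by simp
  qed
  moreover have "fibre_integral k ch (U_bundle k X F D \<sigma>) \<sigma> (omega1_power k ch F) x b
    = form_integral j S (fibre_ori k a) \<eta>"
    unfolding fibre_integral_def fib \<eta>_def[abs_def] a_def k1 by (rule refl)
  moreover have "pullback_section ch \<sigma> (Theta k F) x b
    = 1 / (real k * unit_ball_vol (real k)) * form_integral j (LL ` S) (sing_ori a) ?\<beta>"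
    unfolding pullback_Theta[OF sec x] busemann_form_def a_def[symmetric] sing_set_eq[OF W] S_def k1 by (rule refl)
  \<comment> \<open>With \<open>k = j + 1\<close>, \<open>k * fact j\<close> is
    \<open>fact k\<close>, and k(k+1)/2 differs from j(j-1)/2 by \<open>k + j\<close>, which matches
    the sign of \<open>C\<close>.\<close>
  moreover have "1 / (real k * unit_ball_vol (real k)) * C = (- 1) ^ (k * (k + 1) div 2) / (fact k * unit_ball_vol (real k))"
  proof -
    have "even (j * (j - 1))" by (cases j) auto
    moreover have "k * (k + 1) = j * (j - 1) + 2 * (k + j)"
      unfolding k by (cases j) (auto simp: algebra_simps)
    ultimately have "k * (k + 1) div 2 = j * (j - 1) div 2 + (k + j)" by simp
    then have "(- 1) ^ (k * (k + 1) div 2) = (- 1) ^ k * s" by (simp add: s_def power_add)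
    moreover have "fact k = real k * fact j" by (simp add: k)
    ultimately show ?thesis by (simp add: C_def)
  qed
  ultimately show "pullback_section ch \<sigma> (Theta k F) x b =
      (- 1) ^ (k * (k + 1) div 2) / (fact k * unit_ball_vol (real k)) *
      fibre_integral k ch (U_bundle k X F D \<sigma>) \<sigma> (omega1_power k ch F) x b"
    by (simp only: mult.assoc[symmetric])
qed

end
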